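(* Let $L$ be a linear connection on a vector bundle $F$ over $M$ and $L'$ a linear connection on $TM$. Then, for all $k\ge1$, the derived multilinear connections $L_k=D^{k-1}L$ on $T^kF$ are weakly symmetric (jet-compatible), i.e. their splitting maps $\Phi_k:A^kF\to T^kF$ satisfy $$\Phi_k\big((A^kF)^{\Sigma_k}\big)=(T^kF)^{\Sigma_k}=J^kF .$$
   Context: $\mathbb{K}$ is a commutative unital Hausdorff topological ring with open dense unit group and continuous inversion; topological modules are Hausdorff. A map $f:V\supset U\to W$ is $C^1$ if there is a continuous $f^{[1]}$ on $\{(x,v,t)\in U\times V\times\mathbb{K}:x+tv\in U\}$ with $f(x+tv)-f(x)=tf^{[1]}(x,v,t)$; $df(x)v=f^{[1]}(x,v,0)$; $C^{j+1}$ means $C^1$ with $f^{[1]}$ of class $C^j$; smooth means $C^j$ for all $j$. Manifolds, vector bundles, tangent bundles are defined by charts; $M$ is modelled on $V$, fibers of $F$ on $W$; everything is smooth. Coordinates. In a bundle chart over $U\subset V$, points of $F$ are written $x+\varepsilon_0w$; applying $T$ successively with units $\varepsilon_1,\dots,\varepsilon_k$, points of $T^kF$ are $x+\sum_{0\neq\alpha\in\{0,1\}^{k+1}}\varepsilon^\alpha v_\alpha$, $\alpha=(\alpha_0,\dots,\alpha_k)$, $\varepsilon^\alpha=\prod\varepsilon_i^{\alpha_i}$, with $v_\alpha\in V$ if $\alpha_0=0$ and $v_\alpha\in W$ if $\alpha_0=1$. Let $F^\alpha$ be a copy of $TM$ if $\alpha_0=0$ and of $F$ if $\alpha_0=1$;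 $A^kF=\bigoplus_{\alpha\ne0}F^\alpha$ (direct sum of vector bundles over $M$). The group $\Sigma_k$ acts on $T^kF$ and $A^kF$ by permuting $\varepsilon_1,\dots,\varepsilon_k$ (fixing $\varepsilon_0$; well-defined independently of charts); superscript $\Sigma_k$ denotes fixed points. A linear connection on $F$ is a smooth family of $\mathbb{K}$-module structures on the fibers of $TF\to M$ such that in each bundle chart there are bilinear maps $b_x:W\times V\to W$ (Christoffel tensor, smooth in all variables) such that the structure on $(TF)_x=W\times V\times W$ is the push-forward of the chart's linear structure under $(w,v,w')\mapsto(w,v,w'+b_x(w,v))$. Its splitting map is $\Phi_1:A^1F=F\oplus TM\oplus F\to TF$, in charts $\Phi_1(x;\varepsilon_0w,\varepsilon_1v,\varepsilon_0\varepsilon_1w')=x+\varepsilon_0w+\varepsilon_1v+\varepsilon_0\varepsilon_1(w'+b_x(w,v))$. Let $b_x$, $c_x$ be the Christoffel tensors of $L$ and $L'$ (when $F=TM$ one takes $L'=L$). Derived connections. $L_1=L$, and $\Phi_{k+1}=D\Phi_k:A^{k+1}F\to T^{k+1}F$ is defined inductively as follows: let $T\Phi_k$ be the tangent map of $\Phi_k$ with respect to $\varepsilon_{k+1}$, and let $e$ be the multi-index with $\varepsilon^e=\varepsilon_{k+1}$; in charts $$\Phi_{k+1}\Big(x;(v_\beta)_{\beta}\Big)=T\Phi_k\Big(x+\varepsilon_{k+1}v_e+\sum_{\alpha\ne0,\ \alpha_{k+1}=0}\varepsilon^\alpha\big(v_\alpha+\varepsilon_{k+1}(v_{\alpha+e}+d^\alpha_x(v_\alpha,v_e))\big)\Big),$$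 where $d^\alpha_x=c_x$ if $\alpha_0=0$ and $d^\alpha_x=b_x$ if $\alpha_0=1$. (This is chart-independent.) $L_{k+1}=DL_k$ is the linear structure on the fibers of $T^{k+1}F\to M$ obtained as push-forward under $\Phi_{k+1}$ of the linear structure of $A^{k+1}F$. Weakly symmetric means that $J^kF=(T^kF)^{\Sigma_k}$ is a linear subbundle of $(T^kF,L_k)$, which is equivalent to the displayed equality. *)

theory Defs
  imports "HOL-Analysis.Analysis" "HOL-Library.Function_Algebras"
begin

section \<open>Differential calculus over a topological ring\<close>

class base_ring = comm_ring_1 + topological_ab_group_add + topological_comm_monoid_mult + t2_space +
  assumes open_units: "open {u. u dvd 1}"
    and units_meet_open: "open S \<Longrightarrow> S \<noteq> {} \<Longrightarrow> \<exists>u\<in>S. u dvd 1"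
    and nhds_inverse: "u * v = 1 \<Longrightarrow> open S \<Longrightarrow> v \<in> S \<Longrightarrow>
          \<exists>R. open R \<and> u \<in> R \<and> (\<forall>u'\<in>R. \<forall>v'. u' * v' = 1 \<longrightarrow> v' \<in> S)"

text \<open>The last two axioms in the usual form (\<open>closure\<close> and \<open>continuous_on\<close> cannot be used in a
  class specification):\<close>

lemma dense_units: "closure {u::'k::base_ring. u dvd 1} = UNIV"
proof -
  have "x \<in> closure {u::'k. u dvd 1}" for x
    unfolding closure_iff_nhds_not_empty
  proof (intro allI impI)
    fix R S :: "'k set" assume "S \<subseteq> R" "open S" "x \<in> S"
    then obtain u where "u \<in> S" "u dvd 1" using units_meet_open[of S] by auto
    then show "{u. u dvd 1} \<inter> R \<noteq> {}" using \<open>S \<subseteq> R\<close> by auto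
  qed
  then show ?thesis by blast
qed

lemma continuous_on_inverse: "continuous_on {u::'k::base_ring. u dvd 1} (\<lambda>u. THE v. u * v = 1)"
proof -
  have uniq: "v = v'" if "u * v = 1" "u * v' = 1" for u v v' :: 'k
  proof -
    have "v = v * (u * v')" by (simp add: that(2))
    also have "\<dots> = (u * v) * v'" by (simp only: ac_simps)
    also have "\<dots> = v'" by (simp add: that(1))
    finally show ?thesis .
  qed
  have the_inv: "(THE v. u * v = 1) = v" if "u * v = 1" for u v :: 'k
    by (rule the_equality[where P = "\<lambda>v. u * v = 1", OF that uniq[OF _ that]])
  show ?thesis
    unfolding continuous_on_topological
  proof (intro ballI allI impI)
    fix u :: 'k and S
    assume u: "u \<in> {u. u dvd 1}" and S: "open S" "(THE v. u * v = 1) \<in> S"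
    from u have "u dvd 1" by simp
    then obtain v where "1 = u * v" by (rule dvdE)
    then have v: "u * v = 1" by (rule sym)
    have "v \<in> S" using S(2) by (simp only: the_inv[OF v])
    then obtain R where R: "open R" "u \<in> R" "\<forall>u'\<in>R. \<forall>v'. u' * v' = 1 \<longrightarrow> v' \<in> S"
      using nhds_inverse[OF v S(1)] by blast
    have "(THE v. u' * v = 1) \<in> S" if "u' dvd 1" "u' \<in> R" for u'
    proof -
      from that(1) obtain v' where "1 = u' * v'" by (rule dvdE)
      then have v': "u' * v' = 1" by (rule sym)
      then have "v' \<in> S" using R(3) that(2) by blast
      then show ?thesis by (simp only: the_inv[OF v'])
    qed
    then show "\<exists>A. open A \<and> u \<in> A \<and> (\<forall>y\<in>{u. u dvd 1}. y \<in> A \<longrightarrow> (THE v. y * v = 1) \<in> S)"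
      using R(1,2) by blast
  qed
qed

text \<open>A topological module is carried by a submodule of a type; its topology is the subspace
  topology of the type.\<close>

record ('k, 'a) tmodule =
  car :: "'a set"
  scl :: "'k \<Rightarrow> 'a \<Rightarrow> 'a"

definition full_mod :: "('k \<Rightarrow> 'a \<Rightarrow> 'a) \<Rightarrow> ('k, 'a) tmodule" where
  "full_mod s = \<lparr>car = UNIV, scl = s\<rparr>"

definition prod_mod :: "('k, 'a) tmodule \<Rightarrow> ('k, 'b) tmodule \<Rightarrow> ('k, 'a \<times> 'b) tmodule" where
  "prod_mod A B = \<lparr>car = car A \<times> car B, scl = (\<lambda>t (a, b). (scl A t a, scl B t b))\<rparr>"

definition topological_module ::
  "('k::base_ring \<Rightarrow> 'a::{topological_ab_group_add, t2_space} \<Rightarrow> 'a) \<Rightarrow> bool" where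
  "topological_module s \<longleftrightarrow> module s \<and> continuous_on UNIV (\<lambda>(t, x). s t x)"

definition dq_dom :: "('k, 'a::plus) tmodule \<Rightarrow> 'a set \<Rightarrow> ('a \<times> 'a \<times> 'k) set" where
  "dq_dom A U = {(x, v, t). x \<in> U \<and> v \<in> car A \<and> x + scl A t v \<in> U}"

text \<open>\<open>f1\<close> is the continuous map written $f^{[1]}$.\<close>

definition diff_quot ::
  "('k::topological_space, 'a::{topological_space, plus}) tmodule \<Rightarrow>
   ('k, 'b::{topological_space, minus}) tmodule \<Rightarrow> 'a set \<Rightarrow> ('a \<Rightarrow> 'b) \<Rightarrow>
   ('a \<times> 'a \<times> 'k \<Rightarrow> 'b) \<Rightarrow> bool" where
  "diff_quot A B U f f1 \<longleftrightarrow>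
     f ` U \<subseteq> car B \<and> f1 ` dq_dom A U \<subseteq> car B \<and> continuous_on (dq_dom A U) f1 \<and>
     (\<forall>(x, v, t) \<in> dq_dom A U. f (x + scl A t v) - f x = scl B t (f1 (x, v, t)))"

text \<open>\<open>Df A B U f x v\<close> is $df(x)v = f^{[1]}(x,v,0)$.  For \<open>U\<close> open in \<open>A\<close> the map $f^{[1]}$ is
  unique, since the units are dense and modules are Hausdorff.\<close>

definition Df ::
  "('k::{topological_space, zero}, 'a::{topological_space, plus}) tmodule \<Rightarrow>
   ('k, 'b::{topological_space, minus}) tmodule \<Rightarrow> 'a set \<Rightarrow> ('a \<Rightarrow> 'b) \<Rightarrow> 'a \<Rightarrow> 'a \<Rightarrow> 'b" where
  "Df A B U f x v = (THE y. \<exists>f1. diff_quot A B U f f1 \<and> y = f1 (x, v, 0))"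

text \<open>The domain of $f^{[j]}$ lies in $A^{[j]}$, where $A^{[0]} = A$ and
  $A^{[j+1]} = A^{[j]} \times A^{[j]} \times K$.  To have all these modules in one type, an element of
  $A^{[j]}$ is encoded as a full binary tree of depth \<open>j\<close> with leaves in \<open>A\<close> and inner nodes
  labelled by scalars.  The label at a position (a word over \<open>bool\<close>) is given by the first function
  for leaves and by the second for inner nodes; both are 0 elsewhere.  The topology inherited from
  the function spaces is the product topology of $A^{[j]}$.\<close>

type_synonym ('a, 'k) tree = "(bool list \<Rightarrow> 'a) \<times> (bool list \<Rightarrow> 'k)"

definition leaf :: "'a::zero \<Rightarrow> ('a, 'k::zero) tree" where
  "leaf a = ((\<lambda>p. if p = [] then a else 0), (\<lambda>p. 0))"

definition unleaf :: "('a, 'k) tree \<Rightarrow> 'a" where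
  "unleaf z = fst z []"

definition node :: "('a::zero, 'k) tree \<times> ('a, 'k) tree \<times> 'k \<Rightarrow> ('a, 'k) tree" where
  "node = (\<lambda>(x, v, t).
     ((\<lambda>p. case p of [] \<Rightarrow> 0 | r # q \<Rightarrow> (if r then fst v q else fst x q)),
      (\<lambda>p. case p of [] \<Rightarrow> t | r # q \<Rightarrow> (if r then snd v q else snd x q))))"

definition unnode :: "('a, 'k) tree \<Rightarrow> ('a, 'k) tree \<times> ('a, 'k) tree \<times> 'k" where
  "unnode z =
     (((\<lambda>q. fst z (False # q)), (\<lambda>q. snd z (False # q))),
      ((\<lambda>q. fst z (True # q)), (\<lambda>q. snd z (True # q))),
      snd z [])"

definition leaf_mod :: "('k::mult_zero, 'a::zero) tmodule \<Rightarrow> ('k, ('a, 'k) tree) tmodule" where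
  "leaf_mod A = \<lparr>car = leaf ` car A, scl = (\<lambda>t z. ((\<lambda>p. scl A t (fst z p)), (\<lambda>p. t * snd z p)))\<rparr>"

definition node_mod :: "('k, ('a::zero, 'k) tree) tmodule \<Rightarrow> ('k, ('a, 'k) tree) tmodule" where
  "node_mod X = X\<lparr>car := node ` (car X \<times> car X \<times> UNIV)\<rparr>"

primrec tree_class_C :: "nat \<Rightarrow> ('k::base_ring, ('a::{topological_space, ab_group_add}, 'k) tree) tmodule \<Rightarrow>
    ('k, 'b::{topological_space, ab_group_add}) tmodule \<Rightarrow> ('a, 'k) tree set \<Rightarrow> (('a, 'k) tree \<Rightarrow> 'b) \<Rightarrow> bool"
where
  "tree_class_C 0 X B U f \<longleftrightarrow> f ` U \<subseteq> car B \<and> continuous_on U f"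
| "tree_class_C (Suc j) X B U f \<longleftrightarrow>
     (\<exists>f1. diff_quot X B U f f1 \<and>
           tree_class_C j (node_mod X) B (node ` dq_dom X U) (f1 \<circ> unnode))"

definition class_C :: "nat \<Rightarrow> ('k::base_ring, 'a::{topological_space, ab_group_add}) tmodule \<Rightarrow>
    ('k, 'b::{topological_space, ab_group_add}) tmodule \<Rightarrow> 'a set \<Rightarrow> ('a \<Rightarrow> 'b) \<Rightarrow> bool" where
  "class_C j A B U f \<longleftrightarrow> tree_class_C j (leaf_mod A) B (leaf ` U) (f \<circ> unleaf)"

definition smooth :: "('k::base_ring, 'a::{topological_space, ab_group_add}) tmodule \<Rightarrow>
    ('k, 'b::{topological_space, ab_group_add}) tmodule \<Rightarrow> 'a set \<Rightarrow> ('a \<Rightarrow> 'b) \<Rightarrow> bool" where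
  "smooth A B U f \<longleftrightarrow> (\<forall>j. class_C j A B U f)"


section \<open>Vector bundles\<close>

text \<open>A bundle over \<open>base\<close> with total space \<open>total\<close> and a bundle atlas indexed by \<open>charts\<close>:
  \<open>chart i\<close> is a chart of the base on the domain \<open>dom i\<close>, and \<open>bchart i\<close> is the bundle chart over
  it, with values in \<open>V \<times> W\<close>.  The maps \<open>chart i\<close> form the atlas of the base manifold.\<close>

record ('k, 'v, 'w, 'm, 'f, 'i) vbundle =
  scV :: "'k \<Rightarrow> 'v \<Rightarrow> 'v"
  scW :: "'k \<Rightarrow> 'w \<Rightarrow> 'w"
  base :: "'m topology"
  total :: "'f topology"
  proj :: "'f \<Rightarrow> 'm"
  charts :: "'i set"
  dom :: "'i \<Rightarrow> 'm set"
  chart :: "'i \<Rightarrow> 'm \<Rightarrow> 'v"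
  bchart :: "'i \<Rightarrow> 'f \<Rightarrow> 'v \<times> 'w"

abbreviation "mV B \<equiv> full_mod (scV B)"
abbreviation "mW B \<equiv> full_mod (scW B)"
abbreviation "mF B \<equiv> prod_mod (mV B) (mW B)"

definition chart_range :: "('k, 'v, 'w, 'm, 'f, 'i) vbundle \<Rightarrow> 'i \<Rightarrow> 'v set" where
  "chart_range B i = chart B i ` dom B i"

definition overlap :: "('k, 'v, 'w, 'm, 'f, 'i) vbundle \<Rightarrow> 'i \<Rightarrow> 'i \<Rightarrow> 'v set" where
  "overlap B i j = chart B i ` (dom B i \<inter> dom B j)"

definition bdom :: "('k, 'v, 'w, 'm, 'f, 'i) vbundle \<Rightarrow> 'i \<Rightarrow> 'f set" where
  "bdom B i = {z \<in> topspace (total B). proj B z \<in> dom B i}"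

definition base_tr :: "('k, 'v, 'w, 'm, 'f, 'i) vbundle \<Rightarrow> 'i \<Rightarrow> 'i \<Rightarrow> 'v \<Rightarrow> 'v" where
  "base_tr B i j = chart B j \<circ> inv_into (dom B i) (chart B i)"

definition total_tr :: "('k, 'v, 'w, 'm, 'f, 'i) vbundle \<Rightarrow> 'i \<Rightarrow> 'i \<Rightarrow> 'v \<times> 'w \<Rightarrow> 'v \<times> 'w" where
  "total_tr B i j = bchart B j \<circ> inv_into (bdom B i) (bchart B i)"

definition vector_bundle ::
  "('k::base_ring, 'v::{topological_ab_group_add, t2_space}, 'w::{topological_ab_group_add, t2_space},
    'm, 'f, 'i) vbundle \<Rightarrow> bool" where
  "vector_bundle B \<longleftrightarrow>
     topological_module (scV B) \<and> topological_module (scW B) \<and>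
     topspace (base B) = (\<Union>i\<in>charts B. dom B i) \<and>
     proj B ` topspace (total B) \<subseteq> topspace (base B) \<and>
     continuous_map (total B) (base B) (proj B) \<and>
     (\<forall>i\<in>charts B.
        openin (base B) (dom B i) \<and> open (chart_range B i) \<and>
        homeomorphic_map (subtopology (base B) (dom B i)) (top_of_set (chart_range B i)) (chart B i) \<and>
        homeomorphic_map (subtopology (total B) (bdom B i)) (top_of_set (chart_range B i \<times> UNIV)) (bchart B i) \<and>
        (\<forall>z\<in>bdom B i. fst (bchart B i z) = chart B i (proj B z))) \<and>
     (\<forall>i\<in>charts B. \<forall>j\<in>charts B.
        smooth (mV B) (mV B) (overlap B i j) (base_tr B i j) \<and>
        smooth (mF B) (mF B) (overlap B i j \<times> UNIV) (total_tr B i j) \<and>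
        (\<forall>x\<in>overlap B i j. module_hom (scW B) (scW B) (\<lambda>w. snd (total_tr B i j (x, w)))))"


subsection \<open>The tangent bundle of the base\<close>

text \<open>Tangent vectors are classes of triples (chart, point of the chart range, vector).\<close>

definition tvec ::
  "('k::base_ring, 'v::{topological_ab_group_add, t2_space}, 'w, 'm, 'f, 'i) vbundle \<Rightarrow>
   'i \<Rightarrow> 'v \<times> 'v \<Rightarrow> ('i \<times> 'v \<times> 'v) set" where
  "tvec B i = (\<lambda>(x, v). {(j, y, v'). j \<in> charts B \<and> x \<in> overlap B i j \<and> y = base_tr B i j x \<and>
                v' = Df (mV B) (mV B) (overlap B i j) (base_tr B i j) x v})"

definition tvecs ::
  "('k::base_ring, 'v::{topological_ab_group_add, t2_space}, 'w, 'm, 'f, 'i) vbundle \<Rightarrow>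
   ('i \<times> 'v \<times> 'v) set set" where
  "tvecs B = {tvec B i (x, v) | i x v. i \<in> charts B \<and> x \<in> chart_range B i}"

definition tangent_bundle ::
  "('k::base_ring, 'v::{topological_ab_group_add, t2_space}, 'w, 'm, 'f, 'i) vbundle \<Rightarrow>
   ('k, 'v, 'v, 'm, ('i \<times> 'v \<times> 'v) set, 'i) vbundle" where
  "tangent_bundle B =
     \<lparr>scV = scV B, scW = scV B, base = base B,
      total = topology (\<lambda>S. S \<subseteq> tvecs B \<and>
        (\<forall>i\<in>charts B. open {xv \<in> chart_range B i \<times> UNIV. tvec B i xv \<in> S})),
      proj = (\<lambda>z. THE p. \<exists>i x v. (i, x, v) \<in> z \<and> p \<in> dom B i \<and> chart B i p = x),
      charts = charts B, dom = dom B, chart = chart B,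
      bchart = (\<lambda>i z. THE xv. (i, xv) \<in> z)\<rparr>"


section \<open>The bundles \<open>T\<^sup>kF\<close> and \<open>A\<^sup>kF\<close>\<close>

text \<open>A multi-index $\alpha = (\alpha_0, \dots, \alpha_k)$ is given by $\alpha_0$ and by the set
  $\beta \subseteq \{1, \dots, k\}$ of the \<open>i \<ge> 1\<close> with $\alpha_i = 1$.  The expression
  $x + \sum_{\alpha \neq 0} \varepsilon^\alpha v_\alpha$ is encoded by the function \<open>u\<close> on sets
  \<open>\<beta>\<close> for which \<open>fst (u \<beta>) :: 'v\<close> and \<open>snd (u \<beta>) :: 'w\<close> are the coefficients of
  $\prod_{i\in\beta}\varepsilon_i$ and $\varepsilon_0 \prod_{i\in\beta}\varepsilon_i$; the base point \<open>x\<close>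
  is \<open>fst (u {})\<close>.\<close>

type_synonym ('v, 'w) multi = "nat set \<Rightarrow> 'v \<times> 'w"

definition multi_mod :: "('k, 'v::zero, 'w::zero, 'm, 'f, 'i) vbundle \<Rightarrow> nat \<Rightarrow> ('k, ('v, 'w) multi) tmodule" where
  "multi_mod B k = \<lparr>car = {u. \<forall>\<beta>. \<not> \<beta> \<subseteq> {1..k} \<longrightarrow> u \<beta> = 0}, scl = (\<lambda>t u \<beta>. scl (mF B) t (u \<beta>))\<rparr>"

definition multi_over :: "('k, 'v::zero, 'w::zero, 'm, 'f, 'i) vbundle \<Rightarrow> nat \<Rightarrow> 'v set \<Rightarrow> ('v, 'w) multi set" where
  "multi_over B k N = {u \<in> car (multi_mod B k). fst (u {}) \<in> N}"

text \<open>The tangent map $Tf(a + \varepsilon_n b) = f(a) + \varepsilon_n\, df(a)b$ with \<open>n = k + 1\<close>,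
  for \<open>f\<close> defined on \<open>X\<close>, where \<open>a\<close> and \<open>b\<close> do not involve $\varepsilon_n$.\<close>

definition T_map ::
  "('k::base_ring, 'v::{topological_ab_group_add, t2_space}, 'w::{topological_ab_group_add, t2_space},
    'm, 'f, 'i) vbundle \<Rightarrow> nat \<Rightarrow> ('v, 'w) multi set \<Rightarrow>
    (('v, 'w) multi \<Rightarrow> ('v, 'w) multi) \<Rightarrow> ('v, 'w) multi \<Rightarrow> ('v, 'w) multi" where
  "T_map B k X f u =
     (let n = Suc k;
          a = (\<lambda>\<beta>. if n \<in> \<beta> then 0 else u \<beta>);
          b = (\<lambda>\<beta>. if n \<in> \<beta> then 0 else u (insert n \<beta>))
      in (\<lambda>\<beta>. if n \<in> \<beta> then Df (multi_mod B k) (multi_mod B k) X f a b (\<beta> - {n}) else f a \<beta>))"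

text \<open>The transition maps of $T^kF$ and of $A^kF$.\<close>

primrec T_tr ::
  "('k::base_ring, 'v::{topological_ab_group_add, t2_space}, 'w::{topological_ab_group_add, t2_space},
    'm, 'f, 'i) vbundle \<Rightarrow> nat \<Rightarrow> 'i \<Rightarrow> 'i \<Rightarrow> ('v, 'w) multi \<Rightarrow> ('v, 'w) multi" where
  "T_tr B 0 i j = (\<lambda>u \<beta>. if \<beta> = {} then total_tr B i j (u {}) else 0)"
| "T_tr B (Suc k) i j = T_map B k (multi_over B k (overlap B i j)) (T_tr B k i j)"

definition A_tr ::
  "('k::base_ring, 'v::{topological_ab_group_add, t2_space}, 'w::{topological_ab_group_add, t2_space},
    'm, 'f, 'i) vbundle \<Rightarrow> 'i \<Rightarrow> 'i \<Rightarrow> ('v, 'w) multi \<Rightarrow> ('v, 'w) multi" where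
  "A_tr B i j u =
     (let x = fst (u {})
      in (\<lambda>\<beta>. (if \<beta> = {} then base_tr B i j x
               else Df (mV B) (mV B) (overlap B i j) (base_tr B i j) x (fst (u \<beta>)),
               snd (total_tr B i j (x, snd (u \<beta>))))))"

text \<open>A bundle over the base with transition maps \<open>tr i j\<close>, glued from its chart ranges: its points
  are the classes \<open>[i, u]\<close> of pairs of a chart and a point of the corresponding chart range.\<close>

type_synonym ('v, 'w, 'i) glued = "('i \<times> ('v, 'w) multi) set"

definition glue_pt :: "('k, 'v, 'w, 'm, 'f, 'i) vbundle \<Rightarrow> ('i \<Rightarrow> 'i \<Rightarrow> ('v, 'w) multi \<Rightarrow> ('v, 'w) multi) \<Rightarrow>
    'i \<Rightarrow> ('v, 'w) multi \<Rightarrow> ('v, 'w, 'i) glued" where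
  "glue_pt B tr i u = {(j, u'). j \<in> charts B \<and> fst (u {}) \<in> overlap B i j \<and> u' = tr i j u}"

definition glue :: "('k, 'v::zero, 'w::zero, 'm, 'f, 'i) vbundle \<Rightarrow>
    ('i \<Rightarrow> 'i \<Rightarrow> ('v, 'w) multi \<Rightarrow> ('v, 'w) multi) \<Rightarrow> nat \<Rightarrow> ('v, 'w, 'i) glued set" where
  "glue B tr k = {glue_pt B tr i u | i u. i \<in> charts B \<and> u \<in> multi_over B k (chart_range B i)}"

text \<open>The map to a glued bundle given in the chart \<open>i\<close> by \<open>h i\<close>.  If the local maps are compatible
  with the changes of charts, then all members of the union are equal.\<close>

definition induced_map :: "('k, 'v, 'w, 'm, 'f, 'i) vbundle \<Rightarrow> ('i \<Rightarrow> 'i \<Rightarrow> ('v, 'w) multi \<Rightarrow> ('v, 'w) multi) \<Rightarrow>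
    ('i \<Rightarrow> ('v, 'w) multi \<Rightarrow> ('v, 'w) multi) \<Rightarrow> ('v, 'w, 'i) glued \<Rightarrow> ('v, 'w, 'i) glued" where
  "induced_map B tr h z = (\<Union>(i, u)\<in>z. glue_pt B tr i (h i u))"

text \<open>A permutation \<open>\<sigma>\<close> acts by $\varepsilon_i \mapsto \varepsilon_{\sigma(i)}$ for \<open>i \<ge> 1\<close>.\<close>

definition perm_act :: "(nat \<Rightarrow> nat) \<Rightarrow> ('v, 'w) multi \<Rightarrow> ('v, 'w) multi" where
  "perm_act \<sigma> u = (\<lambda>\<beta>. u (inv \<sigma> ` \<beta>))"

definition fixed_pts :: "('k, 'v::zero, 'w::zero, 'm, 'f, 'i) vbundle \<Rightarrow>
    ('i \<Rightarrow> 'i \<Rightarrow> ('v, 'w) multi \<Rightarrow> ('v, 'w) multi) \<Rightarrow> nat \<Rightarrow> ('v, 'w, 'i) glued set" where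
  "fixed_pts B tr k =
     {z \<in> glue B tr k. \<forall>\<sigma>. \<sigma> permutes {1..k} \<longrightarrow> induced_map B tr (\<lambda>i. perm_act \<sigma>) z = z}"

definition T_bundle ::
  "('k::base_ring, 'v::{topological_ab_group_add, t2_space}, 'w::{topological_ab_group_add, t2_space},
    'm, 'f, 'i) vbundle \<Rightarrow> nat \<Rightarrow> ('v, 'w, 'i) glued set" where
  "T_bundle B k = glue B (T_tr B k) k"

definition A_bundle ::
  "('k::base_ring, 'v::{topological_ab_group_add, t2_space}, 'w::{topological_ab_group_add, t2_space},
    'm, 'f, 'i) vbundle \<Rightarrow> nat \<Rightarrow> ('v, 'w, 'i) glued set" where
  "A_bundle B k = glue B (A_tr B) k"

definition T_fixed ::
  "('k::base_ring, 'v::{topological_ab_group_add, t2_space}, 'w::{topological_ab_group_add, t2_space},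
    'm, 'f, 'i) vbundle \<Rightarrow> nat \<Rightarrow> ('v, 'w, 'i) glued set" where
  "T_fixed B k = fixed_pts B (T_tr B k) k"

definition A_fixed ::
  "('k::base_ring, 'v::{topological_ab_group_add, t2_space}, 'w::{topological_ab_group_add, t2_space},
    'm, 'f, 'i) vbundle \<Rightarrow> nat \<Rightarrow> ('v, 'w, 'i) glued set" where
  "A_fixed B k = fixed_pts B (A_tr B) k"

definition jet_bundle ::
  "('k::base_ring, 'v::{topological_ab_group_add, t2_space}, 'w::{topological_ab_group_add, t2_space},
    'm, 'f, 'i) vbundle \<Rightarrow> nat \<Rightarrow> ('v, 'w, 'i) glued set" where
  "jet_bundle B k = T_fixed B k"


section \<open>Linear structures on the fibers over the base\<close>

record ('k, 'p) fiber_linear =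
  fadd :: "'p \<Rightarrow> 'p \<Rightarrow> 'p"
  fscl :: "'k \<Rightarrow> 'p \<Rightarrow> 'p"

text \<open>The linear structure of a chart: all coefficients except the base point are added.  The first
  operation is only used for \<open>u\<close> and \<open>u'\<close> over the same base point.\<close>

definition chart_add :: "('v::ab_group_add, 'w::ab_group_add) multi \<Rightarrow> ('v, 'w) multi \<Rightarrow> ('v, 'w) multi" where
  "chart_add u u' = (u + u')({} := (fst (u {}), snd (u {}) + snd (u' {})))"

definition chart_scl ::
  "('k, 'v, 'w, 'm, 'f, 'i) vbundle \<Rightarrow> 'k \<Rightarrow> ('v, 'w) multi \<Rightarrow> ('v, 'w) multi" where
  "chart_scl B t u = (\<lambda>\<beta>. scl (mF B) t (u \<beta>))({} := (fst (u {}), scW B t (snd (u {}))))"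

definition A_linear ::
  "('k::base_ring, 'v::{topological_ab_group_add, t2_space}, 'w::{topological_ab_group_add, t2_space},
    'm, 'f, 'i) vbundle \<Rightarrow> ('k, ('v, 'w, 'i) glued) fiber_linear" where
  "A_linear B =
     \<lparr>fadd = (\<lambda>z z'. \<Union>{glue_pt B (A_tr B) i (chart_add u u') | i u u'.
                (i, u) \<in> z \<and> (i, u') \<in> z' \<and> fst (u {}) = fst (u' {})}),
      fscl = (\<lambda>t. induced_map B (A_tr B) (\<lambda>i. chart_scl B t))\<rparr>"


subsection \<open>Linear connections\<close>

text \<open>$x + \varepsilon_0 w + \varepsilon_1 v + \varepsilon_0\varepsilon_1 w' \mapsto
  x + \varepsilon_0 w + \varepsilon_1 v + \varepsilon_0\varepsilon_1 (w' + b_x(w, v))$\<close>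

definition shear :: "('v \<Rightarrow> 'w \<Rightarrow> 'v \<Rightarrow> 'w::plus) \<Rightarrow> ('v, 'w) multi \<Rightarrow> ('v, 'w) multi" where
  "shear b u = u({1} := (fst (u {1}), snd (u {1}) + b (fst (u {})) (snd (u {})) (fst (u {1}))))"

text \<open>In the last conjunct the linear structure of \<open>L\<close> is the push-forward of that of the chart.\<close>

definition is_christoffel ::
  "('k::base_ring, 'v::{topological_ab_group_add, t2_space}, 'w::{topological_ab_group_add, t2_space},
    'm, 'f, 'i) vbundle \<Rightarrow> ('k, ('v, 'w, 'i) glued) fiber_linear \<Rightarrow> 'i \<Rightarrow>
    ('v \<Rightarrow> 'w \<Rightarrow> 'v \<Rightarrow> 'w) \<Rightarrow> bool" where
  "is_christoffel B L i b \<longleftrightarrow>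
     (\<forall>x\<in>chart_range B i.
        (\<forall>v. module_hom (scW B) (scW B) (\<lambda>w. b x w v)) \<and>
        (\<forall>w. module_hom (scV B) (scW B) (\<lambda>v. b x w v))) \<and>
     smooth (prod_mod (mV B) (prod_mod (mW B) (mV B))) (mW B) (chart_range B i \<times> UNIV \<times> UNIV)
       (\<lambda>(x, w, v). b x w v) \<and>
     (let X = multi_over B 1 (chart_range B i);
          pt = (\<lambda>u. glue_pt B (T_tr B 1) i (shear b u))
      in (\<forall>u\<in>X. \<forall>u'\<in>X. fst (u {}) = fst (u' {}) \<longrightarrow> fadd L (pt u) (pt u') = pt (chart_add u u')) \<and>
         (\<forall>t. \<forall>u\<in>X. fscl L t (pt u) = pt (chart_scl B t u)))"

definition linear_connection ::
  "('k::base_ring, 'v::{topological_ab_group_add, t2_space}, 'w::{topological_ab_group_add, t2_space},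
    'm, 'f, 'i) vbundle \<Rightarrow> ('k, ('v, 'w, 'i) glued) fiber_linear \<Rightarrow> bool" where
  "linear_connection B L \<longleftrightarrow> (\<forall>i\<in>charts B. \<exists>b. is_christoffel B L i b)"

text \<open>A linear connection determines $b_x$ for \<open>x\<close> in the chart range, because
  $(w, 0, 0) + (0, v, 0) = (w, v, b_x(w, v))$ in the linear structure of \<open>L\<close>.\<close>

definition christoffel ::
  "('k::base_ring, 'v::{topological_ab_group_add, t2_space}, 'w::{topological_ab_group_add, t2_space},
    'm, 'f, 'i) vbundle \<Rightarrow> ('k, ('v, 'w, 'i) glued) fiber_linear \<Rightarrow> 'i \<Rightarrow>
    ('v \<Rightarrow> 'w \<Rightarrow> 'v \<Rightarrow> 'w)" where
  "christoffel B L i = (SOME b. is_christoffel B L i b)"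


subsection \<open>Derived connections\<close>

text \<open>The argument of \<open>T \<Phi>\<^sub>k\<close> in the recursion for \<open>\<Phi>\<^sub>n\<close>, \<open>n = k + 1\<close>: the coefficient of
  $\varepsilon^\alpha\varepsilon_n$ is corrected by $d^\alpha_x(v_\alpha, v_e)$ for $\alpha \neq 0$ not
  involving $\varepsilon_n$.\<close>

definition correct :: "('v \<Rightarrow> 'w \<Rightarrow> 'v \<Rightarrow> 'w::plus) \<Rightarrow> ('v \<Rightarrow> 'v \<Rightarrow> 'v \<Rightarrow> 'v::plus) \<Rightarrow> nat \<Rightarrow>
    ('v, 'w) multi \<Rightarrow> ('v, 'w) multi" where
  "correct b c n u =
     (let x = fst (u {}); ve = fst (u {n})
      in (\<lambda>\<beta>. if n \<in> \<beta>
              then (if \<beta> = {n} then ve else fst (u \<beta>) + c x (fst (u (\<beta> - {n}))) ve,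
                    snd (u \<beta>) + b x (snd (u (\<beta> - {n}))) ve)
              else u \<beta>))"

text \<open>The value at \<open>0\<close> is not used.\<close>

fun Phi_chart ::
  "('k::base_ring, 'v::{topological_ab_group_add, t2_space}, 'w::{topological_ab_group_add, t2_space},
    'm, 'f, 'i) vbundle \<Rightarrow> 'i \<Rightarrow> ('v \<Rightarrow> 'w \<Rightarrow> 'v \<Rightarrow> 'w) \<Rightarrow> ('v \<Rightarrow> 'v \<Rightarrow> 'v \<Rightarrow> 'v) \<Rightarrow> nat \<Rightarrow>
    ('v, 'w) multi \<Rightarrow> ('v, 'w) multi" where
  "Phi_chart B i b c 0 = id"
| "Phi_chart B i b c (Suc 0) = shear b"
| "Phi_chart B i b c (Suc (Suc k)) =
     T_map B (Suc k) (multi_over B (Suc k) (chart_range B i)) (Phi_chart B i b c (Suc k))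
       \<circ> correct b c (Suc (Suc k))"

definition Phi ::
  "('k::base_ring, 'v::{topological_ab_group_add, t2_space}, 'w::{topological_ab_group_add, t2_space},
    'm, 'f, 'i) vbundle \<Rightarrow> ('k, ('v, 'w, 'i) glued) fiber_linear \<Rightarrow>
    ('k, ('v, 'v, 'i) glued) fiber_linear \<Rightarrow> nat \<Rightarrow> ('v, 'w, 'i) glued \<Rightarrow> ('v, 'w, 'i) glued" where
  "Phi B L L' k =
     induced_map B (T_tr B k)
       (\<lambda>i. Phi_chart B i (christoffel B L i) (christoffel (tangent_bundle B) L' i) k)"

definition derived_connection ::
  "('k::base_ring, 'v::{topological_ab_group_add, t2_space}, 'w::{topological_ab_group_add, t2_space},
    'm, 'f, 'i) vbundle \<Rightarrow> ('k, ('v, 'w, 'i) glued) fiber_linear \<Rightarrow>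
    ('k, ('v, 'v, 'i) glued) fiber_linear \<Rightarrow> nat \<Rightarrow> ('k, ('v, 'w, 'i) glued) fiber_linear" where
  "derived_connection B L L' k =
     (let \<Phi> = Phi B L L' k; \<Psi> = inv_into (A_bundle B k) \<Phi>
      in \<lparr>fadd = (\<lambda>z z'. \<Phi> (fadd (A_linear B) (\<Psi> z) (\<Psi> z'))),
          fscl = (\<lambda>t z. \<Phi> (fscl (A_linear B) t (\<Psi> z)))\<rparr>)"

text \<open>\<open>J\<close> is a linear subbundle of $(T^kF, S)$: near every point of the base there is a
  fiberwise linear trivialization of $(T^kF, S)$ taking a product \<open>N \<times> Q\<close>, with \<open>Q\<close> a submodule
  of the typical fiber, onto the part of \<open>J\<close> over \<open>N\<close>.  In particular the fibers of \<open>J\<close> are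
  submodules.  In the bundle chart \<open>i\<close> the trivialization is the map \<open>\<psi>\<close>, with inverse \<open>\<psi>'\<close>; the
  typical fiber consists of the elements of \<open>multi_mod B k\<close> whose base point coefficient is 0.\<close>

definition linear_subbundle ::
  "('k::base_ring, 'v::{topological_ab_group_add, t2_space}, 'w::{topological_ab_group_add, t2_space},
    'm, 'f, 'i) vbundle \<Rightarrow> nat \<Rightarrow> ('k, ('v, 'w, 'i) glued) fiber_linear \<Rightarrow>
    ('v, 'w, 'i) glued set \<Rightarrow> bool" where
  "linear_subbundle B k S J \<longleftrightarrow>
     J \<subseteq> T_bundle B k \<and>
     (\<forall>p\<in>topspace (base B). \<exists>i\<in>charts B. p \<in> dom B i \<and>
       (\<exists>N \<psi> \<psi>' Q. open N \<and> chart B i p \<in> N \<and> N \<subseteq> chart_range B i \<and>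
         (let E = multi_mod B k; X = multi_over B k N; pt = (\<lambda>u. glue_pt B (T_tr B k) i (\<psi> u))
          in smooth E E X \<psi> \<and> smooth E E X \<psi>' \<and>
             (\<forall>u\<in>X. \<psi>' (\<psi> u) = u \<and> \<psi> (\<psi>' u) = u \<and> fst (\<psi> u {}) = fst (u {}) \<and> fst (\<psi>' u {}) = fst (u {})) \<and>
             (\<forall>u\<in>X. \<forall>u'\<in>X. fst (u {}) = fst (u' {}) \<longrightarrow> fadd S (pt u) (pt u') = pt (chart_add u u')) \<and>
             (\<forall>t. \<forall>u\<in>X. fscl S t (pt u) = pt (chart_scl B t u)) \<and>
             Q \<subseteq> multi_over B k {0} \<and> 0 \<in> Q \<and> (\<forall>q\<in>Q. \<forall>q'\<in>Q. q + q' \<in> Q) \<and> (\<forall>t. \<forall>q\<in>Q. scl E t q \<in> Q) \<and>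
             (\<forall>u\<in>X. pt u \<in> J \<longleftrightarrow> u({} := (0, snd (u {}))) \<in> Q))))"

definition weakly_symmetric ::
  "('k::base_ring, 'v::{topological_ab_group_add, t2_space}, 'w::{topological_ab_group_add, t2_space},
    'm, 'f, 'i) vbundle \<Rightarrow> ('k, ('v, 'w, 'i) glued) fiber_linear \<Rightarrow>
    ('k, ('v, 'v, 'i) glued) fiber_linear \<Rightarrow> nat \<Rightarrow> bool" where
  "weakly_symmetric B L L' k \<longleftrightarrow>
     linear_subbundle B k (derived_connection B L L' k) (jet_bundle B k)"

end

theory Submission
  imports Defs
begin

text \<open>Write the splitting map as $\Phi_{k+1} = T\Phi_k \circ K_{k+1}$, where $K_n$ (the constant \<open>correct\<close>)
adds $d^\alpha_x(v_\alpha, v_e)$ to the coefficients of $\varepsilon^\alpha\varepsilon_n$.  On the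
families supported in \<open>{1}\<close> this holds for \<open>k = 0\<close> as well, with $\Phi_0 = \mathrm{id}$
(\<open>Phi_Suc\<close>), so $\Phi_{k+2} = TT\Phi_k \circ TK_{k+1} \circ K_{k+2}$ for all \<open>k \<ge> 0\<close>.

A point of $T^kF$ or $A^kF$ over a chart is fixed by $\Sigma_k$ iff each of its coefficients depends only on
the number of units $\varepsilon_i$, \<open>i \<ge> 1\<close>, it belongs to (\<open>symmetric_upto\<close>).  Let \<open>m = k + 1\<close>,
\<open>n = k + 2\<close>.  A family $u = a + \varepsilon_n b$ is symmetric in \<open>n\<close> units iff \<open>a\<close> and \<open>b\<close> are symmetric
in \<open>m\<close> units and the coefficients of $\varepsilon^\alpha\varepsilon_m$ and
$\varepsilon^\alpha\varepsilon_n$ agree whenever $\alpha$ involves neither unit (\<open>sym_Suc_Suc\<close>).  By induction,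
$\Phi_n$ preserves both conditions.  For the first one: if \<open>f\<close> preserves symmetric families, then along a
symmetric direction it has symmetric difference quotients, hence a symmetric derivative (\<open>T_sym_parts\<close>).
For the second one: $TK_m \circ K_n$ changes the coefficients of $\varepsilon^\alpha\varepsilon_m$ and of
$\varepsilon^\alpha\varepsilon_n$ by the same expression (\<open>swap_T_correct_correct\<close>), and
$TT\Phi_k$ applies $d\Phi_k$ at the same point to both (\<open>TT_swap\<close>).  Changing the signs of the Christoffel
tensors inverts $K_n$, so $\Phi_n$ has the smooth inverse $\Psi_n = K_n^{-1} \circ T\Psi_{n-1}$, which
preserves symmetric families for the same reasons (\<open>inv_symmetric\<close>).  Hence in each chart a family is
symmetric iff its image under $\Phi_k$ is.

Two things make this global.  The Christoffel tensors transform in the expected way, because the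
sum of $x + \varepsilon_0 w$ and $x + \varepsilon_1 v + \varepsilon_0\varepsilon_1 w'$ can be computed in either
chart (\<open>christoffel_law\<close>); therefore $K_n$ intertwines the transition maps of $A^nF$ with their tangent
maps (\<open>correct_A_tr\<close>), and by induction $\Phi_k$ is compatible with changes of charts
(\<open>Phi_change_chart\<close>).  The transition maps of $T^kF$, being iterated tangent maps, preserve symmetric
families too (\<open>T_tr_symmetric\<close>), so the fixed points of $\Sigma_k$ can be recognized in any one chart
(\<open>fixed_pts_iff\<close>).  This gives $\Phi_k((A^kF)^{\Sigma_k}) = (T^kF)^{\Sigma_k}$
(\<open>Split_fixed_pts\<close>).  Moreover $\Phi_k$ in a chart is a linear trivialization of $(T^kF, L_k)$ which identifies
$J^kF$ with the submodule of symmetric families, so $J^kF$ is a linear subbundle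
(\<open>derived_linear_subbundle\<close>).

The calculus this rests on (composition of smooth maps, chain rule, linearity and locality of derivatives) is
derived from the definition of $C^j$ by means of difference quotients: composition is an induction on the
depth of the trees which encode the iterated domains, and all statements about derivatives come from the
density of the units at \<open>t = 0\<close>.\<close>

section \<open>Topological modules and continuous linear maps\<close>

text \<open>The Hausdorff property and the continuity of addition are part of the predicate, not of the sort of the
type; so it is inherited by products, function spaces and the tree modules.\<close>

definition tmod :: "('k::base_ring, 'a::{topological_space, ab_group_add}) tmodule \<Rightarrow> bool" where
  "tmod A \<longleftrightarrow> module (scl A) \<and> module.subspace (scl A) (car A) \<and>
     Hausdorff_space (euclidean :: 'a topology) \<and>
     continuous_on UNIV (\<lambda>(x::'a, y). x + y) \<and> continuous_on UNIV (\<lambda>(t, x). scl A t x)"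

lemma tmod_module: "tmod A \<Longrightarrow> module (scl A)"
  by (simp add: tmod_def)

lemma tmod_scl [simp]:
  assumes "tmod A"
  shows "scl A t (x + y) = scl A t x + scl A t y" "scl A t (x - y) = scl A t x - scl A t y"
    "scl A (s + t) x = scl A s x + scl A t x" "scl A s (scl A t x) = scl A (s * t) x"
    "scl A 1 x = x" "scl A 0 x = 0" "scl A t 0 = 0" "scl A t (- x) = - scl A t x"
  using tmod_module[OF assms]
  by (simp_all add: module.scale_right_distrib module.scale_right_diff_distrib
      module.scale_left_distrib module.scale_zero_left module.scale_zero_right
      module.scale_scale module.scale_one module.scale_minus_right)

lemma tmod_car:
  assumes "tmod A"
  shows "0 \<in> car A" "x \<in> car A \<Longrightarrow> y \<in> car A \<Longrightarrow> x + y \<in> car A" "x \<in> car A \<Longrightarrow> scl A t x \<in> car A"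
    "x \<in> car A \<Longrightarrow> y \<in> car A \<Longrightarrow> x - y \<in> car A"
  using assms module.subspace_0 module.subspace_add module.subspace_scale module.subspace_diff
  unfolding tmod_def by metis+

lemma tmod_continuous_add:
  fixes A :: "('k::base_ring, 'a::{topological_space, ab_group_add}) tmodule"
  assumes A: "tmod A" and f: "continuous_on S f" and g: "continuous_on S g"
  shows "continuous_on S (\<lambda>z. f z + g z :: 'a)"
proof -
  have "continuous_on UNIV (\<lambda>(x::'a, y). x + y)" using A by (simp add: tmod_def)
  from continuous_on_compose2[OF this continuous_on_Pair[OF f g]] show ?thesis by simp
qed

lemma tmod_continuous_scl:
  assumes A: "tmod A" and t: "continuous_on S t" and f: "continuous_on S f"
  shows "continuous_on S (\<lambda>z. scl A (t z) (f z))"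
proof -
  have "continuous_on UNIV (\<lambda>(t, x). scl A t x)" using A by (simp add: tmod_def)
  from continuous_on_compose2[OF this continuous_on_Pair[OF t f]] show ?thesis by simp
qed

lemma tmod_continuous_diff:
  fixes A :: "('k::base_ring, 'a::{topological_space, ab_group_add}) tmodule"
  assumes A: "tmod A" and f: "continuous_on S f" and g: "continuous_on S g"
  shows "continuous_on S (\<lambda>z. f z - g z :: 'a)"
proof -
  have "scl A (- 1) x = - x" for x
    using module.scale_minus_left[OF tmod_module[OF A], of 1 x] A by simp
  moreover have "continuous_on S (\<lambda>z. f z + scl A (- 1) (g z))"
    by (intro tmod_continuous_add[OF A] tmod_continuous_scl[OF A] f g continuous_on_const)
  ultimately show ?thesis by simp
qed

lemma tmod_full:
  fixes s :: "'k::base_ring \<Rightarrow> 'a::{topological_ab_group_add, t2_space} \<Rightarrow> 'a"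
  assumes "topological_module s" shows "tmod (full_mod s)"
proof -
  have "continuous_on UNIV (\<lambda>(x::'a, y). x + y)"
    unfolding split_beta' by (intro continuous_on_add continuous_on_fst continuous_on_snd continuous_on_id)
  moreover have "Hausdorff_space (euclidean :: 'a topology)"
    using hausdorff unfolding Hausdorff_space_def disjnt_def by auto
  moreover have "module s" "continuous_on UNIV (\<lambda>(t, x). s t x)"
    using assms by (auto simp: topological_module_def)
  ultimately show ?thesis
    by (simp add: tmod_def full_mod_def module.subspace_UNIV)
qed

lemma tmod_ring: "tmod (full_mod ((*) :: 'k::base_ring \<Rightarrow> _))"
proof -
  have "continuous_on UNIV (\<lambda>(x::'k, y). x + y)" "continuous_on UNIV (\<lambda>(x::'k, y). x * y)"
    unfolding split_beta'
    by (intro continuous_on_add continuous_on_mult' continuous_on_fst continuous_on_snd continuous_on_id)+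
  moreover have "Hausdorff_space (euclidean :: 'k topology)"
    using hausdorff unfolding Hausdorff_space_def disjnt_def by auto
  moreover have "module ((*) :: 'k \<Rightarrow> _)" by (simp add: module_def algebra_simps)
  ultimately show ?thesis
    by (simp add: tmod_def full_mod_def module.subspace_UNIV)
qed

text \<open>A family of continuous maps to a Hausdorff space separates the points it distinguishes; it is applied to
the coordinates of functions and to the projections of pairs.\<close>

lemma Hausdorff_separating:
  fixes f :: "'i \<Rightarrow> 'a::topological_space \<Rightarrow> 'b::topological_space"
  assumes "Hausdorff_space (euclidean :: 'b topology)" "\<And>i. continuous_on UNIV (f i)" "f i x \<noteq> f i y"
  shows "\<exists>U V. openin euclidean U \<and> openin euclidean V \<and> x \<in> U \<and> y \<in> V \<and> disjnt U V"
proof -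
  obtain U V where UV: "open U" "open V" "f i x \<in> U" "f i y \<in> V" "disjnt U V"
    using assms(1,3) unfolding Hausdorff_space_def by (metis open_openin UNIV_I topspace_euclidean)
  with assms(2) show ?thesis
    by (intro exI[of _ "f i -` U"] exI[of _ "f i -` V"]) (auto simp: disjnt_def open_vimage)
qed

lemma Hausdorff_fun:
  assumes "Hausdorff_space (euclidean :: 'b::topological_space topology)"
  shows "Hausdorff_space (euclidean :: ('a \<Rightarrow> 'b) topology)"
  unfolding Hausdorff_space_def
  using Hausdorff_separating[OF assms, of "\<lambda>i f. f i"] by (auto simp: fun_eq_iff)

lemma Hausdorff_prod:
  assumes a: "Hausdorff_space (euclidean :: 'a::topological_space topology)"
    and b: "Hausdorff_space (euclidean :: 'b::topological_space topology)"
  shows "Hausdorff_space (euclidean :: ('a \<times> 'b) topology)"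
  unfolding Hausdorff_space_def
proof (intro allI impI)
  fix x y :: "'a \<times> 'b" assume "x \<in> topspace euclidean \<and> y \<in> topspace euclidean \<and> x \<noteq> y"
  then have "fst x \<noteq> fst y \<or> snd x \<noteq> snd y" by (auto simp: prod_eq_iff)
  then show "\<exists>U V. openin euclidean U \<and> openin euclidean V \<and> x \<in> U \<and> y \<in> V \<and> disjnt U V"
    using Hausdorff_separating[OF a, of "\<lambda>i::unit. fst" "()" x y]
      Hausdorff_separating[OF b, of "\<lambda>i::unit. snd" "()" x y]
      continuous_on_fst[OF continuous_on_id] continuous_on_snd[OF continuous_on_id] by blast
qed

lemma tmod_prod:
  assumes A: "tmod A" and B: "tmod B" shows "tmod (prod_mod A B)"
proof -
  have m: "module (scl (prod_mod A B))"
    using A B by (auto simp: module_def prod_mod_def split_beta')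
  have "module.subspace (scl (prod_mod A B)) (car (prod_mod A B))"
    unfolding module.subspace_def[OF m] using tmod_car[OF A] tmod_car[OF B]
    by (auto simp: prod_mod_def zero_prod_def)
  moreover have "Hausdorff_space (euclidean :: ('b \<times> 'c) topology)"
    using A B unfolding tmod_def by (blast intro: Hausdorff_prod)
  moreover have "continuous_on UNIV (\<lambda>(x::'b \<times> 'c, y). x + y)"
    unfolding plus_prod_def split_beta'
    by (intro continuous_on_Pair tmod_continuous_add[OF A] tmod_continuous_add[OF B] continuous_intros)
  moreover have "continuous_on UNIV (\<lambda>(t, x). scl (prod_mod A B) t x)"
    unfolding prod_mod_def split_beta'
    by (simp, intro continuous_on_Pair tmod_continuous_scl[OF A] tmod_continuous_scl[OF B] continuous_intros)
  ultimately show ?thesis using m unfolding tmod_def by blast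
qed

lemma continuous_on_apply: "continuous_on S f \<Longrightarrow> continuous_on S (\<lambda>x. f x i)"
  by (rule continuous_on_product_then_coordinatewise)

definition tlin :: "('k::base_ring, 'a::{topological_space, ab_group_add}) tmodule \<Rightarrow>
    ('k, 'b::{topological_space, ab_group_add}) tmodule \<Rightarrow> ('a \<Rightarrow> 'b) \<Rightarrow> bool" where
  "tlin A B f \<longleftrightarrow> f ` car A \<subseteq> car B \<and> (\<forall>x\<in>car A. \<forall>y\<in>car A. f (x + y) = f x + f y) \<and>
     (\<forall>t. \<forall>x\<in>car A. f (scl A t x) = scl B t (f x)) \<and> continuous_on (car A) f"

lemma tlin_car: "tlin A B f \<Longrightarrow> x \<in> car A \<Longrightarrow> f x \<in> car B"
  and tlin_add: "tlin A B f \<Longrightarrow> x \<in> car A \<Longrightarrow> y \<in> car A \<Longrightarrow> f (x + y) = f x + f y"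
  and tlin_scl: "tlin A B f \<Longrightarrow> x \<in> car A \<Longrightarrow> f (scl A t x) = scl B t (f x)"
  and tlin_continuous: "tlin A B f \<Longrightarrow> continuous_on (car A) f"
  by (auto simp: tlin_def)

lemma tlin_diff:
  assumes "tmod A" "tlin A B f" "x \<in> car A" "y \<in> car A"
  shows "f (x - y) = f x - f y"
  using tlin_add[OF assms(2) tmod_car(4)[OF assms(1,3,4)] assms(4)] by simp

lemma tlin_compose:
  assumes "tlin A B f" "tlin B C g" shows "tlin A C (g \<circ> f)"
  using assms unfolding tlin_def
  by (auto simp: image_subset_iff intro!: continuous_on_compose2[of "car B" g "car A" f])

lemma tlin_id: "tlin A A (\<lambda>x. x)"
  by (simp add: tlin_def continuous_on_id)

lemma prod_mod_simps [simp]: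
  "car (prod_mod A B) = car A \<times> car B" "scl (prod_mod A B) t z = (scl A t (fst z), scl B t (snd z))"
  by (simp_all add: prod_mod_def split_beta)

lemma full_mod_simps [simp]: "car (full_mod s) = UNIV" "scl (full_mod s) = s"
  by (simp_all add: full_mod_def)

lemma tlin_Pair:
  assumes "tlin A B f" "tlin A C g" shows "tlin A (prod_mod B C) (\<lambda>x. (f x, g x))"
  using assms unfolding tlin_def by (auto intro: continuous_on_Pair)

lemma tlin_fst: "tlin (prod_mod A B) A fst"
  and tlin_snd: "tlin (prod_mod A B) B snd"
  by (auto simp: tlin_def intro!: continuous_intros)

lemma tlin_plus:
  assumes "tmod A" shows "tlin (prod_mod A A) A (\<lambda>z. fst z + snd z)"
  using assms unfolding tlin_def
  by (auto intro!: tmod_continuous_add[OF assms] continuous_intros tmod_car)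

lemma tlin_uminus:
  assumes "tmod A" shows "tlin A A (\<lambda>z. - z)"
proof -
  have "continuous_on (car A) (\<lambda>z. 0 - z)"
    by (intro tmod_continuous_diff[OF assms] continuous_on_const continuous_on_id)
  moreover have "- x \<in> car A" if "x \<in> car A" for x
    using tmod_car(4)[OF assms tmod_car(1)[OF assms] that] by simp
  ultimately show ?thesis using assms unfolding tlin_def by auto
qed

section \<open>Binary trees as iterated difference-quotient modules\<close>

text \<open>The common property of the modules obtained from \<open>leaf_mod\<close> by \<open>node_mod\<close>: scalars act on all labels
at once, which makes \<open>node\<close> and \<open>unnode\<close> linear.\<close>

definition tree_mod :: "('k::base_ring, ('a::{topological_space, ab_group_add}, 'k) tree) tmodule \<Rightarrow> bool" where
  "tree_mod X \<longleftrightarrow> tmod X \<and> (\<exists>s. scl X = (\<lambda>t z. ((\<lambda>p. s t (fst z p)), (\<lambda>p. t * snd z p))))"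

lemma tree_mod_tmod: "tree_mod X \<Longrightarrow> tmod X"
  by (simp add: tree_mod_def)

text \<open>The module $A \times A \times K$ in which the domain of $f^{[1]}$ lies.\<close>

definition dq_mod :: "('k::base_ring, 'a) tmodule \<Rightarrow> ('k, 'a \<times> 'a \<times> 'k) tmodule" where
  "dq_mod A = prod_mod A (prod_mod A (full_mod (*)))"

lemma tmod_dq: "tmod A \<Longrightarrow> tmod (dq_mod A)"
  unfolding dq_mod_def by (intro tmod_prod tmod_ring)

lemma dq_dom_car: "U \<subseteq> car A \<Longrightarrow> dq_dom A U \<subseteq> car (dq_mod A)"
  by (auto simp: dq_dom_def dq_mod_def)

lemma unnode_node [simp]: "unnode (node z) = z"
  by (cases z) (simp add: unnode_def node_def)

lemma unleaf_leaf [simp]: "unleaf (leaf a) = a"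
  by (simp add: unleaf_def leaf_def)

lemma continuous_label:
  "continuous_on S f \<Longrightarrow> continuous_on S (\<lambda>z. fst (f z) p)"
  "continuous_on S f \<Longrightarrow> continuous_on S (\<lambda>z. snd (f z) p)"
  by (rule continuous_on_apply, rule continuous_on_fst continuous_on_snd, assumption)+

lemma continuous_node: "continuous_on S (node :: _ \<Rightarrow> ('a::{topological_space,zero}, 'k::{topological_space,zero}) tree)"
proof -
  have x: "continuous_on S fst" "continuous_on S (\<lambda>z. fst (snd z))" "continuous_on S (\<lambda>z. snd (snd z))"
    for S :: "(('a, 'k) tree \<times> ('a, 'k) tree \<times> 'k) set"
    by (intro continuous_intros)+
  have "continuous_on S (\<lambda>z::('a, 'k) tree \<times> ('a, 'k) tree \<times> 'k.
     ((\<lambda>p. case p of [] \<Rightarrow> 0 | r # q \<Rightarrow> (if r then fst (fst (snd z)) q else fst (fst z) q)),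
      (\<lambda>p. case p of [] \<Rightarrow> snd (snd z) | r # q \<Rightarrow> (if r then snd (fst (snd z)) q else snd (fst z) q))))"
    (is "continuous_on S (\<lambda>z. (\<lambda>p. ?f z p, \<lambda>p. ?g z p))")
  proof (intro continuous_on_Pair continuous_on_coordinatewise_then_product)
    show "continuous_on S (\<lambda>z. ?f z p)" for p
      using continuous_label(1)[OF x(1), of S "tl p"] continuous_label(1)[OF x(2), of S "tl p"]
      by (cases p; cases "hd p") simp_all
    show "continuous_on S (\<lambda>z. ?g z p)" for p
      using continuous_label(2)[OF x(1), of S "tl p"] continuous_label(2)[OF x(2), of S "tl p"] x(3)
      by (cases p; cases "hd p") simp_all
  qed
  then show ?thesis by (simp add: node_def split_beta')
qed

lemma continuous_unnode: "continuous_on S (unnode :: ('a::{topological_space,zero}, 'k::{topological_space,zero}) tree \<Rightarrow> _)"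
  unfolding unnode_def
  by (intro continuous_on_Pair continuous_on_coordinatewise_then_product continuous_label continuous_on_id)

lemma continuous_leaf: "continuous_on S (leaf :: 'a::{topological_space,zero} \<Rightarrow> ('a, 'k::{topological_space,zero}) tree)"
  unfolding leaf_def
proof (intro continuous_on_Pair continuous_on_coordinatewise_then_product continuous_on_const)
  show "continuous_on S (\<lambda>x::'a. if p = [] then x else 0)" for p :: "bool list"
    by (cases "p = []") (simp_all add: continuous_on_id)
qed

lemma continuous_unleaf: "continuous_on S (unleaf :: ('a::{topological_space,zero}, 'k::{topological_space,zero}) tree \<Rightarrow> _)"
  unfolding unleaf_def by (intro continuous_label continuous_on_id)

lemma leaf_add: "leaf (a + b :: 'a::comm_monoid_add) = (leaf a + leaf b :: ('a, 'k::comm_monoid_add) tree)"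
  by (auto simp: leaf_def plus_prod_def)

lemma unnode_add: "unnode (z + w :: ('a::comm_monoid_add, 'k::comm_monoid_add) tree) = unnode z + unnode w"
  by (auto simp: unnode_def plus_prod_def)

lemma node_add: "node (z + w) = (node z + node w :: ('a::comm_monoid_add, 'k::comm_monoid_add) tree)"
  by (auto simp: node_def plus_prod_def split_beta' fun_eq_iff split: list.splits)

lemma tmod_leaf:
  fixes A :: "('k::base_ring, 'a::{topological_space, ab_group_add}) tmodule"
  assumes A: "tmod A" shows "tmod (leaf_mod A)"
proof -
  have m: "module (scl (leaf_mod A))"
    using A by (auto simp: module_def leaf_mod_def plus_prod_def algebra_simps)
  have sc: "scl (leaf_mod A) t (leaf a) = leaf (scl A t a)" for t a
    using A by (auto simp: leaf_def leaf_mod_def)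
  have z: "(0 :: ('a,'k) tree) = leaf 0" by (auto simp: leaf_def zero_prod_def fun_eq_iff)
  have "module.subspace (scl (leaf_mod A)) (car (leaf_mod A))"
    unfolding module.subspace_def[OF m] z using tmod_car[OF A] sc
    by (auto simp: leaf_mod_def leaf_add[symmetric])
  moreover have "Hausdorff_space (euclidean :: ('a, 'k) tree topology)"
    using A tmod_ring[where 'k='k] unfolding tmod_def by (blast intro: Hausdorff_fun Hausdorff_prod)
  moreover have "continuous_on UNIV (\<lambda>(x::('a, 'k) tree, y). x + y)"
    unfolding plus_prod_def split_beta' plus_fun_def
    by (intro continuous_on_Pair tmod_continuous_add[OF A] tmod_continuous_add[OF tmod_ring]
        continuous_on_coordinatewise_then_product continuous_label
        continuous_on_fst continuous_on_snd continuous_on_id)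
  moreover have "continuous_on UNIV (\<lambda>(t, x). scl (leaf_mod A) t x)"
    unfolding leaf_mod_def split_beta'
    by (simp, intro continuous_on_Pair tmod_continuous_scl[OF A] continuous_on_mult'
        continuous_on_coordinatewise_then_product continuous_label
        continuous_on_fst continuous_on_snd continuous_on_id)
  ultimately show ?thesis using m unfolding tmod_def by blast
qed

lemma tree_mod_leaf: "tmod A \<Longrightarrow> tree_mod (leaf_mod A)"
  using tmod_leaf[of A] unfolding tree_mod_def by (auto simp: leaf_mod_def)

lemma node_mod_simps [simp]: "car (node_mod X) = node ` (car X \<times> car X \<times> UNIV)" "scl (node_mod X) = scl X"
  by (simp_all add: node_mod_def)

lemma scl_node:
  assumes "tree_mod X" shows "scl X r (node z) = node (scl (dq_mod X) r z)"
proof -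
  obtain s where s: "scl X = (\<lambda>t z. ((\<lambda>p. s t (fst z p)), (\<lambda>p. t * snd z p)))"
    using assms by (auto simp: tree_mod_def)
  have "scl X r 0 = 0" by (rule tmod_scl(7)[OF tree_mod_tmod[OF assms]])
  then have "s r 0 = 0" by (auto simp: s zero_prod_def fun_eq_iff)
  then show ?thesis
    by (auto simp: s node_def dq_mod_def split_beta' fun_eq_iff split: list.splits)
qed

lemma scl_unnode:
  assumes "tree_mod X" shows "unnode (scl X r z) = scl (dq_mod X) r (unnode z)"
proof -
  obtain s where s: "scl X = (\<lambda>t z. ((\<lambda>p. s t (fst z p)), (\<lambda>p. t * snd z p)))"
    using assms by (auto simp: tree_mod_def)
  show ?thesis by (auto simp: s unnode_def dq_mod_def)
qed

lemma tree_mod_node: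
  assumes X: "tree_mod (X :: ('k::base_ring, ('a::{topological_space, ab_group_add}, 'k) tree) tmodule)"
  shows "tree_mod (node_mod X)"
proof -
  note T = tree_mod_tmod[OF X]
  have z: "(0 :: ('a, 'k) tree) = node (0, 0, 0)"
    by (auto simp: node_def zero_prod_def fun_eq_iff split: list.splits)
  have c: "car (node_mod X) = node ` car (dq_mod X)" by (simp add: dq_mod_def)
  have "(0 :: ('a, 'k) tree) = node 0" using z by (simp add: zero_prod_def)
  then have "0 \<in> car (node_mod X)"
    unfolding c using tmod_car(1)[OF tmod_dq[OF T]] by (rule image_eqI)
  moreover have "x + y \<in> car (node_mod X)" if "x \<in> car (node_mod X)" "y \<in> car (node_mod X)" for x y
    using that tmod_car(2)[OF tmod_dq[OF T]] unfolding c by (auto simp: node_add[symmetric])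
  moreover have "scl X t x \<in> car (node_mod X)" if "x \<in> car (node_mod X)" for t x
    using that tmod_car(3)[OF tmod_dq[OF T]] unfolding c by (auto simp: scl_node[OF X] simp del: prod_mod_simps)
  ultimately have "module.subspace (scl X) (car (node_mod X))"
    unfolding module.subspace_def[OF tmod_module[OF T]] by blast
  then show ?thesis using X unfolding tree_mod_def tmod_def by simp
qed

lemma tlin_node: "tree_mod X \<Longrightarrow> tlin (dq_mod X) (node_mod X) node"
  unfolding tlin_def by (auto simp: node_add scl_node continuous_node dq_mod_def)

lemma tlin_unnode: "tree_mod X \<Longrightarrow> tlin (node_mod X) (dq_mod X) unnode"
  unfolding tlin_def using scl_unnode[of X]
  by (auto simp: unnode_add continuous_unnode dq_mod_def)

lemma tlin_leaf: "tmod A \<Longrightarrow> tlin A (leaf_mod A) leaf"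
  unfolding tlin_def by (auto simp: leaf_add continuous_leaf leaf_mod_def) (auto simp: leaf_def)

lemma tlin_unleaf: "tmod A \<Longrightarrow> tlin (leaf_mod A) A unleaf"
  unfolding tlin_def by (auto simp: leaf_add[symmetric] continuous_unleaf leaf_mod_def) (auto simp: unleaf_def leaf_def)

section \<open>Closure properties of the classes of differentiable maps\<close>

lemma diff_quotD:
  assumes "diff_quot A B U f f1"
  shows "x \<in> U \<Longrightarrow> f x \<in> car B" "z \<in> dq_dom A U \<Longrightarrow> f1 z \<in> car B" "continuous_on (dq_dom A U) f1"
    "(x, v, t) \<in> dq_dom A U \<Longrightarrow> f (x + scl A t v) - f x = scl B t (f1 (x, v, t))"
  using assms unfolding diff_quot_def by auto

lemma dq_domI: "x \<in> U \<Longrightarrow> v \<in> car A \<Longrightarrow> x + scl A t v \<in> U \<Longrightarrow> (x, v, t) \<in> dq_dom A U"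
  by (simp add: dq_dom_def)

lemma dq_domD: "(x, v, t) \<in> dq_dom A U \<Longrightarrow> x \<in> U \<and> v \<in> car A \<and> x + scl A t v \<in> U"
  by (simp add: dq_dom_def)

lemma diff_quot_add:
  fixes f :: "'a::{topological_space, plus} \<Rightarrow> 'b::{topological_space, ab_group_add}"
  assumes "diff_quot A B U f f1" "(x, v, t) \<in> dq_dom A U"
  shows "f (x + scl A t v) = f x + scl B t (f1 (x, v, t))"
  using diff_quotD(4)[OF assms] by (simp add: algebra_simps)

lemma diff_quot_cong:
  assumes "diff_quot A B U f f1" "\<And>x. x \<in> U \<Longrightarrow> f x = g x"
  shows "diff_quot A B U g f1"
  using assms unfolding diff_quot_def dq_dom_def by auto

text \<open>Fix \<open>x \<in> U\<close>; then $f(y) = f(x) + f^{[1]}(x, y - x, 1)$ for all \<open>y \<in> U\<close>.\<close>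

lemma diff_quot_continuous:
  assumes A: "tmod A" and B: "tmod B" and U: "U \<subseteq> car A" and f: "diff_quot A B U f f1"
  shows "continuous_on U f"
proof (cases "U = {}")
  case False
  then obtain x where x: "x \<in> U" by auto
  have e: "x + scl A 1 (y - x) = y" for y using A by simp
  have d: "(x, y - x, 1) \<in> dq_dom A U" if "y \<in> U" for y
    using that x U tmod_car(4)[OF A] by (intro dq_domI) (auto simp: e)
  have "continuous_on U (\<lambda>y. f1 (x, y - x, 1))"
    by (rule continuous_on_compose2[OF diff_quotD(3)[OF f]])
      (auto intro!: d continuous_on_Pair continuous_on_const tmod_continuous_diff[OF A] continuous_on_id)
  then have "continuous_on U (\<lambda>y. f x + f1 (x, y - x, 1))"
    by (intro tmod_continuous_add[OF B] continuous_on_const)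
  moreover have "f x + f1 (x, y - x, 1) = f y" if "y \<in> U" for y
    using diff_quot_add[OF f d[OF that]] e[of y] B by simp
  ultimately show ?thesis by (simp cong: continuous_on_cong)
qed simp

text \<open>From $f(x + tv) = f(x) + t f^{[1]}(x,v,t)$ one gets
$(g \circ f)^{[1]}(x,v,t) = g^{[1]}(f(x), f^{[1]}(x,v,t), t)$.\<close>

lemma diff_quot_compose:
  assumes A: "tmod A" and B: "tmod B" and U: "U \<subseteq> car A" and f: "diff_quot A B U f f1"
    and g: "diff_quot B C U' g g1" and im: "f ` U \<subseteq> U'"
  shows "diff_quot A C U (g \<circ> f) (\<lambda>(x, v, t). g1 (f x, f1 (x, v, t), t))"
proof -
  have d: "(f x, f1 (x, v, t), t) \<in> dq_dom B U'" if "(x, v, t) \<in> dq_dom A U" for x v t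
    using dq_domD[OF that] im diff_quotD(2)[OF f that] diff_quot_add[OF f that]
    by (intro dq_domI) auto
  have "continuous_on (dq_dom A U) (\<lambda>z. g1 (f (fst z), f1 z, snd (snd z)))"
  proof (rule continuous_on_compose2[OF diff_quotD(3)[OF g]])
    show "continuous_on (dq_dom A U) (\<lambda>z. (f (fst z), f1 z, snd (snd z)))"
      by (intro continuous_on_Pair diff_quotD(3)[OF f]
          continuous_on_compose2[OF diff_quot_continuous[OF A B U f]] continuous_on_fst
          continuous_on_snd continuous_on_id) (auto simp: dq_dom_def)
    show "(\<lambda>z. (f (fst z), f1 z, snd (snd z))) ` dq_dom A U \<subseteq> dq_dom B U'"
      using d by auto
  qed
  moreover have "(g \<circ> f) (x + scl A t v) - (g \<circ> f) x = scl C t (g1 (f x, f1 (x, v, t), t))"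
    if "(x, v, t) \<in> dq_dom A U" for x v t
    using diff_quotD(4)[OF g d[OF that]] diff_quot_add[OF f that] by simp
  moreover have "(g \<circ> f) ` U \<subseteq> car C" using diff_quotD(1)[OF g] im by auto
  moreover have "g1 (f x, f1 (x, v, t), t) \<in> car C" if "(x, v, t) \<in> dq_dom A U" for x v t
    using diff_quotD(2)[OF g d[OF that]] .
  ultimately show ?thesis unfolding diff_quot_def by (auto simp: split_beta')
qed

lemma diff_quot_linear:
  assumes A: "tmod A" and f: "tlin A B f" and U: "U \<subseteq> car A"
  shows "diff_quot A B U f (\<lambda>(x, v, t). f v)"
proof -
  have "continuous_on (dq_dom A U) (\<lambda>z. f (fst (snd z)))"
    by (rule continuous_on_compose2[OF tlin_continuous[OF f]])
      (auto simp: dq_dom_def intro!: continuous_intros)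
  then show ?thesis
    using f U unfolding diff_quot_def tlin_def dq_dom_def
    by (auto simp: split_beta' tmod_car[OF A] subset_iff)
qed

lemma tree_class_C_SucI:
  assumes "diff_quot X B U f f1" "tree_class_C j (node_mod X) B (node ` dq_dom X U) g" "g = f1 \<circ> unnode"
  shows "tree_class_C (Suc j) X B U f"
  using assms by auto

lemma tree_class_C_cong:
  assumes "tree_class_C j X B U f" "\<And>x. x \<in> U \<Longrightarrow> f x = g x"
  shows "tree_class_C j X B U g"
proof (cases j)
  case 0 with assms show ?thesis by (auto cong: continuous_on_cong)
next
  case (Suc i)
  with assms(1) obtain f1 where "diff_quot X B U f f1"
    "tree_class_C i (node_mod X) B (node ` dq_dom X U) (f1 \<circ> unnode)" by auto
  then show ?thesis using diff_quot_cong[of X B U f f1 g] assms(2) Suc by auto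
qed

lemma tree_class_C_maps: "tree_class_C j X B U f \<Longrightarrow> x \<in> U \<Longrightarrow> f x \<in> car B"
  by (cases j) (auto simp: diff_quot_def)

lemma tlin_dq_map:
  assumes "tlin A B f" shows "tlin (dq_mod A) (dq_mod B) (\<lambda>(x, v, t). (f x, f v, t))"
proof -
  have "continuous_on (car (dq_mod A)) (\<lambda>z. (f (fst z), f (fst (snd z)), snd (snd z)))"
    by (intro continuous_on_Pair continuous_on_compose2[OF tlin_continuous[OF assms]]
        continuous_on_fst continuous_on_snd continuous_on_id) (auto simp: dq_mod_def)
  then show ?thesis
    using assms unfolding tlin_def by (auto simp: dq_mod_def split_beta')
qed

lemma dq_dom_node_car:
  fixes X :: "('k::base_ring, ('a::{topological_space, ab_group_add}, 'k) tree) tmodule"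
  shows "U \<subseteq> car X \<Longrightarrow> node ` dq_dom X U \<subseteq> car (node_mod X)"
  using dq_dom_car[of U X] by (auto simp: dq_mod_def)

text \<open>The difference quotient of $f \circ \phi$ is $f^{[1]} \circ (\phi \times \phi \times \mathrm{id})$, and
$\phi \times \phi \times \mathrm{id}$ is again linear, so the induction goes through for the linear maps
between trees over different modules.  Besides the change of variables this gives the restriction to
subsets.\<close>

lemma tree_class_C_precompose_linear:
  assumes "tree_mod X" "tree_mod Y" "tlin Y X \<phi>" "tree_class_C j X B U f" "U' \<subseteq> car Y" "\<phi> ` U' \<subseteq> U"
  shows "tree_class_C j Y B U' (f \<circ> \<phi>)"
  using assms
proof (induction j arbitrary: X Y U U' f \<phi>)
  case 0
  have "continuous_on U' (f \<circ> \<phi>)"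
    using 0(4) by (intro continuous_on_compose[OF continuous_on_subset[OF tlin_continuous[OF 0(3)] 0(5)]
        continuous_on_subset[OF _ 0(6)]]) simp
  moreover have "(f \<circ> \<phi>) ` U' \<subseteq> car B"
    using 0(4,6) by (auto simp: image_subset_iff)
  ultimately show ?case by simp
next
  case (Suc j)
  note TX = tree_mod_tmod[OF Suc.prems(1)] and TY = tree_mod_tmod[OF Suc.prems(2)]
  from Suc.prems(4) obtain f1 where f1: "diff_quot X B U f f1"
    "tree_class_C j (node_mod X) B (node ` dq_dom X U) (f1 \<circ> unnode)" by auto
  let ?\<psi> = "\<lambda>(x, v, t). (\<phi> x, \<phi> v, t)"
  let ?\<phi> = "node \<circ> (?\<psi> \<circ> unnode)"
  have "diff_quot Y B U' (f \<circ> \<phi>) (\<lambda>(x, v, t). f1 (\<phi> x, \<phi> v, t))"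
    using diff_quot_compose[OF TY TX Suc.prems(5) diff_quot_linear[OF TY Suc.prems(3,5)] f1(1) Suc.prems(6)]
    by simp
  moreover have "tree_class_C j (node_mod Y) B (node ` dq_dom Y U') ((f1 \<circ> unnode) \<circ> ?\<phi>)"
  proof (rule Suc.IH[OF tree_mod_node tree_mod_node _ f1(2)])
    show "tlin (node_mod Y) (node_mod X) ?\<phi>"
      by (rule tlin_compose[OF tlin_compose[OF tlin_unnode[OF Suc.prems(2)] tlin_dq_map[OF Suc.prems(3)]]
            tlin_node[OF Suc.prems(1)]])
    have ad: "\<phi> (x + scl Y t v) = \<phi> x + scl X t (\<phi> v)" if "x \<in> U'" "v \<in> car Y" for x v t
      using tlin_add[OF Suc.prems(3) subsetD[OF Suc.prems(5) that(1)] tmod_car(3)[OF TY that(2)]]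
        tlin_scl[OF Suc.prems(3) that(2)] by simp
    have "(\<phi> x, \<phi> v, t) \<in> dq_dom X U" if "(x, v, t) \<in> dq_dom Y U'" for x v t
    proof (rule dq_domI)
      note d = dq_domD[OF that]
      show "\<phi> x \<in> U" using d by (intro subsetD[OF Suc.prems(6)] imageI) simp
      show "\<phi> v \<in> car X" using d by (intro tlin_car[OF Suc.prems(3)]) simp
      have "\<phi> (x + scl Y t v) \<in> U" using d by (intro subsetD[OF Suc.prems(6)] imageI) simp
      then show "\<phi> x + scl X t (\<phi> v) \<in> U" using d ad[of x v t] by simp
    qed
    then have "?\<psi> ` dq_dom Y U' \<subseteq> dq_dom X U"
      by (intro image_subsetI) (simp only: split_beta prod.collapse)
    moreover have "?\<phi> ` node ` S = node ` ?\<psi> ` S" for S by (simp add: image_comp comp_def)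
    ultimately show "?\<phi> ` node ` dq_dom Y U' \<subseteq> node ` dq_dom X U" by (metis image_mono)
  qed (rule Suc.prems dq_dom_node_car)+
  moreover have "(f1 \<circ> unnode) \<circ> ?\<phi> = (\<lambda>(x, v, t). f1 (\<phi> x, \<phi> v, t)) \<circ> unnode"
    by (auto simp: fun_eq_iff split_beta')
  ultimately show ?case by (rule tree_class_C_SucI)
qed

lemma tree_class_C_postcompose_linear:
  assumes "tmod B" "tlin B C l" "tree_class_C j X B U f"
  shows "tree_class_C j X C U (l \<circ> f)"
  using assms(3)
proof (induction j arbitrary: X U f)
  case 0
  then show ?case using assms
    by (auto simp: tlin_def intro!: continuous_on_compose2[of "car B" l U f])
next
  case (Suc j)
  then obtain f1 where f1: "diff_quot X B U f f1"
    "tree_class_C j (node_mod X) B (node ` dq_dom X U) (f1 \<circ> unnode)" by auto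
  have "diff_quot X C U (l \<circ> f) (l \<circ> f1)"
    unfolding diff_quot_def
  proof (intro conjI)
    show "continuous_on (dq_dom X U) (l \<circ> f1)"
      using diff_quotD[OF f1(1)] assms(2)
      by (auto simp: tlin_def intro!: continuous_on_compose2[of "car B" l "dq_dom X U" f1])
    show "\<forall>(x, v, t)\<in>dq_dom X U. (l \<circ> f) (x + scl X t v) - (l \<circ> f) x = scl C t ((l \<circ> f1) (x, v, t))"
    proof safe
      fix x v t assume d: "(x, v, t) \<in> dq_dom X U"
      have "l (f (x + scl X t v)) - l (f x) = l (f (x + scl X t v) - f x)"
        using tlin_diff[OF assms(1,2)] diff_quotD(1)[OF f1(1)] dq_domD[OF d] by simp
      then show "(l \<circ> f) (x + scl X t v) - (l \<circ> f) x = scl C t ((l \<circ> f1) (x, v, t))"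
        using diff_quotD(4)[OF f1(1) d] tlin_scl[OF assms(2) diff_quotD(2)[OF f1(1) d]] by simp
    qed
  qed (use diff_quotD[OF f1(1)] tlin_car[OF assms(2)] in auto)
  moreover have "tree_class_C j (node_mod X) C (node ` dq_dom X U) ((l \<circ> f1) \<circ> unnode)"
    using Suc.IH[OF f1(2)] by (simp only: comp_assoc)
  ultimately show ?case by (rule tree_class_C_SucI) (simp_all only: comp_assoc)
qed

lemma tree_class_C_linear:
  assumes "tree_mod X" "tlin X B f" "U \<subseteq> car X" shows "tree_class_C j X B U f"
  using assms
proof (induction j arbitrary: X U f)
  case 0
  then show ?case by (auto simp: tlin_def elim: continuous_on_subset)
next
  case (Suc j)
  note T = tree_mod_tmod[OF Suc.prems(1)]
  have "diff_quot X B U f (\<lambda>(x, v, t). f v)" by (rule diff_quot_linear[OF T Suc.prems(2,3)])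
  moreover have "tree_class_C j (node_mod X) B (node ` dq_dom X U) (f \<circ> (fst \<circ> (snd \<circ> unnode)))"
  proof (rule Suc.IH)
    have "tlin (dq_mod X) (prod_mod X (full_mod (*))) snd" "tlin (prod_mod X (full_mod (*))) X fst"
      unfolding dq_mod_def by (rule tlin_snd tlin_fst)+
    then show "tlin (node_mod X) B (f \<circ> (fst \<circ> (snd \<circ> unnode)))"
      using tlin_compose[OF tlin_compose[OF tlin_compose[OF tlin_unnode[OF Suc.prems(1)]]] Suc.prems(2)]
      by blast
  qed (use Suc.prems tree_mod_node dq_dom_node_car in blast)+
  moreover have "f \<circ> (fst \<circ> (snd \<circ> unnode)) = (\<lambda>(x, v, t). f v) \<circ> unnode"
    by (auto simp: fun_eq_iff split_beta')
  ultimately show ?case by (rule tree_class_C_SucI)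
qed

lemma tree_class_C_Suc_imp:
  assumes "tree_mod X" "tmod B" "U \<subseteq> car X" "tree_class_C (Suc j) X B U f"
  shows "tree_class_C j X B U f"
  using assms
proof (induction j arbitrary: X U f)
  case 0
  then obtain f1 where f1: "diff_quot X B U f f1" by auto
  show ?case
    using diff_quot_continuous[OF tree_mod_tmod[OF 0(1)] 0(2,3) f1] f1 by (auto simp: diff_quot_def)
next
  case (Suc j)
  from Suc.prems(4) obtain f1 where f1: "diff_quot X B U f f1"
    "tree_class_C (Suc j) (node_mod X) B (node ` dq_dom X U) (f1 \<circ> unnode)"
    by (subst (asm) tree_class_C.simps(2)) blast
  then show ?case
    using tree_class_C_SucI[OF f1(1)
        Suc.IH[OF tree_mod_node[OF Suc.prems(1)] Suc.prems(2) dq_dom_node_car[OF Suc.prems(3)] f1(2)] refl]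
    by simp
qed

lemma tree_class_C_Pair:
  assumes "tree_class_C j X B U f" "tree_class_C j X C U g"
  shows "tree_class_C j X (prod_mod B C) U (\<lambda>x. (f x, g x))"
  using assms
proof (induction j arbitrary: X U f g)
  case 0
  then show ?case by (auto intro: continuous_on_Pair)
next
  case (Suc j)
  from Suc.prems obtain f1 g1 where f1: "diff_quot X B U f f1"
    "tree_class_C j (node_mod X) B (node ` dq_dom X U) (f1 \<circ> unnode)"
    and g1: "diff_quot X C U g g1"
    "tree_class_C j (node_mod X) C (node ` dq_dom X U) (g1 \<circ> unnode)"
    by auto
  have "diff_quot X (prod_mod B C) U (\<lambda>x. (f x, g x)) (\<lambda>z. (f1 z, g1 z))"
    using f1(1) g1(1) unfolding diff_quot_def by (auto intro: continuous_on_Pair)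
  moreover have "tree_class_C j (node_mod X) (prod_mod B C) (node ` dq_dom X U) ((\<lambda>z. (f1 z, g1 z)) \<circ> unnode)"
    using Suc.IH[OF f1(2) g1(2)] by (simp add: comp_def)
  ultimately show ?case by (rule tree_class_C_SucI) simp
qed

lemma multi_mod_simps [simp]:
  "car (multi_mod F k) = {u. \<forall>\<beta>. \<not> \<beta> \<subseteq> {1..k} \<longrightarrow> u \<beta> = 0}"
  "scl (multi_mod F k) = (\<lambda>t u \<beta>. scl (mF F) t (u \<beta>))"
  by (simp_all add: multi_mod_def)

lemma tree_class_C_multi:
  assumes T: "tmod (mF F)"
    and "\<And>\<beta>. \<beta> \<subseteq> {1..k} \<Longrightarrow> tree_class_C j X (mF F) U (\<lambda>z. f z \<beta>)"
    and "\<And>z \<beta>. z \<in> U \<Longrightarrow> \<not> \<beta> \<subseteq> {1..k} \<Longrightarrow> f z \<beta> = 0"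
  shows "tree_class_C j X (multi_mod F k) U f"
  using assms(2,3)
proof (induction j arbitrary: X U f)
  case 0
  have "continuous_on U (\<lambda>z. f z \<beta>)" for \<beta>
  proof (cases "\<beta> \<subseteq> {1..k}")
    case True
    then show ?thesis using 0(1) by simp
  next
    case False
    then show ?thesis
      using 0(2) by (intro continuous_on_eq[OF continuous_on_const[of U 0]]) auto
  qed
  then have "continuous_on U f" by (rule continuous_on_coordinatewise_then_product)
  moreover have "f ` U \<subseteq> car (multi_mod F k)" using 0(2) unfolding multi_mod_simps by blast
  ultimately show ?case by simp
next
  case (Suc j)
  have "\<forall>\<beta>. \<exists>g. \<beta> \<subseteq> {1..k} \<longrightarrow> diff_quot X (mF F) U (\<lambda>z. f z \<beta>) g \<and>
      tree_class_C j (node_mod X) (mF F) (node ` dq_dom X U) (g \<circ> unnode)"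
    using Suc.prems(1) by auto
  then obtain g where g: "\<And>\<beta>. \<beta> \<subseteq> {1..k} \<Longrightarrow> diff_quot X (mF F) U (\<lambda>z. f z \<beta>) (g \<beta>)"
     "\<And>\<beta>. \<beta> \<subseteq> {1..k} \<Longrightarrow> tree_class_C j (node_mod X) (mF F) (node ` dq_dom X U) (g \<beta> \<circ> unnode)"
    by metis
  define f1 where "f1 z = (\<lambda>\<beta>. if \<beta> \<subseteq> {1..k} then g \<beta> z else 0)" for z
  have "diff_quot X (multi_mod F k) U f f1"
    unfolding diff_quot_def
  proof (intro conjI)
    have "continuous_on (dq_dom X U) (\<lambda>z. f1 z \<beta>)" for \<beta>
      using diff_quotD(3)[OF g(1)] by (cases "\<beta> \<subseteq> {1..k}") (auto simp: f1_def)
    then show "continuous_on (dq_dom X U) f1" by (rule continuous_on_coordinatewise_then_product)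
    show "\<forall>(x, v, t)\<in>dq_dom X U. f (x + scl X t v) - f x = scl (multi_mod F k) t (f1 (x, v, t))"
    proof safe
      fix x v t assume d: "(x, v, t) \<in> dq_dom X U"
      have "f (x + scl X t v) \<beta> - f x \<beta> = scl (mF F) t (f1 (x, v, t) \<beta>)" for \<beta>
      proof (cases "\<beta> \<subseteq> {1..k}")
        case True
        then show ?thesis using diff_quotD(4)[OF g(1) d] by (simp add: f1_def)
      next
        case False
        then show ?thesis using Suc.prems(2) dq_domD[OF d] tmod_scl(7)[OF T, of t] unfolding f1_def by simp
      qed
      then show "f (x + scl X t v) - f x = scl (multi_mod F k) t (f1 (x, v, t))"
        by (auto simp: fun_eq_iff)
    qed
    show "f ` U \<subseteq> car (multi_mod F k)" using Suc.prems(2) unfolding multi_mod_simps by blast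
    show "f1 ` dq_dom X U \<subseteq> car (multi_mod F k)" by (rule image_subsetI) (simp add: f1_def)
  qed
  moreover have "tree_class_C j (node_mod X) (multi_mod F k) (node ` dq_dom X U) (f1 \<circ> unnode)"
  proof (rule Suc.IH)
    show "tree_class_C j (node_mod X) (mF F) (node ` dq_dom X U) (\<lambda>z. (f1 \<circ> unnode) z \<beta>)"
      if "\<beta> \<subseteq> {1..k}" for \<beta> using g(2)[OF that] that by (simp add: f1_def comp_def)
  qed (simp add: f1_def)
  ultimately show ?case by (rule tree_class_C_SucI) simp
qed

text \<open>By \<open>diff_quot_compose\<close>, $(g \circ f)^{[1]}$ is the composition of $g^{[1]}$ with the map
$(f \circ \mathrm{pr}_1, f^{[1]}, \mathrm{pr}_3)$, and both are $C^j$ if \<open>f\<close> and \<open>g\<close> are $C^{j+1}$.  The trees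
keep all domains in one type, which an induction on \<open>j\<close> requires.\<close>

lemma tree_class_C_compose:
  assumes "tree_mod X" "tree_mod Y" "U \<subseteq> car X" "tree_class_C j X Y U f" "tree_class_C j Y C U' g" "f ` U \<subseteq> U'"
  shows "tree_class_C j X C U (g \<circ> f)"
  using assms
proof (induction j arbitrary: X Y U U' f g)
  case 0
  then have "continuous_on U (g \<circ> f)"
    by (intro continuous_on_compose continuous_on_subset[of U' g "f ` U"]) simp_all
  moreover have "(g \<circ> f) ` U \<subseteq> car C" using 0(5,6) by (auto simp: image_subset_iff)
  ultimately show ?case by simp
next
  case (Suc j)
  note TX = tree_mod_tmod[OF Suc.prems(1)] and TY = tree_mod_tmod[OF Suc.prems(2)]
  note NX = tree_mod_node[OF Suc.prems(1)] and NY = tree_mod_node[OF Suc.prems(2)]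
  note TNX = tree_mod_tmod[OF NX]
  from Suc.prems obtain f1 g1 where f1: "diff_quot X Y U f f1"
    "tree_class_C j (node_mod X) Y (node ` dq_dom X U) (f1 \<circ> unnode)"
    and g1: "diff_quot Y C U' g g1"
    "tree_class_C j (node_mod Y) C (node ` dq_dom Y U') (g1 \<circ> unnode)"
    by auto
  let ?h = "\<lambda>(x, v, t). (f x, f1 (x, v, t), t)"
  let ?D = "node ` dq_dom X U"
  note D = dq_dom_node_car[OF Suc.prems(3)]
  have 1: "diff_quot X C U (g \<circ> f) (\<lambda>(x, v, t). g1 (f x, f1 (x, v, t), t))"
    by (rule diff_quot_compose[OF TX TY Suc.prems(3) f1(1) g1(1) Suc.prems(6)])
  have l: "tlin (node_mod X) X (fst \<circ> unnode)" "tlin (node_mod X) (full_mod (*)) (snd \<circ> (snd \<circ> unnode))"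
    using tlin_compose[OF tlin_unnode[OF Suc.prems(1)] tlin_fst[of X "prod_mod X (full_mod (*))", folded dq_mod_def]]
      tlin_compose[OF tlin_compose[OF tlin_unnode[OF Suc.prems(1)]
          tlin_snd[of X "prod_mod X (full_mod (*))", folded dq_mod_def]] tlin_snd]
    by (simp_all only: comp_assoc)
  have "tree_class_C j (node_mod X) Y ?D (f \<circ> (fst \<circ> unnode))"
    by (rule tree_class_C_precompose_linear[OF Suc.prems(1) NX l(1)
          tree_class_C_Suc_imp[OF Suc.prems(1) TY Suc.prems(3,4)] D])
      (auto simp: dq_dom_def)
  then have "tree_class_C j (node_mod X) (dq_mod Y) ?D
      (\<lambda>z. ((f \<circ> (fst \<circ> unnode)) z, (f1 \<circ> unnode) z, (snd \<circ> (snd \<circ> unnode)) z))"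
    unfolding dq_mod_def
    by (intro tree_class_C_Pair f1(2) tree_class_C_linear[OF NX l(2) D])
  then have "tree_class_C j (node_mod X) (node_mod Y) ?D
      (node \<circ> (\<lambda>z. ((f \<circ> (fst \<circ> unnode)) z, (f1 \<circ> unnode) z, (snd \<circ> (snd \<circ> unnode)) z)))"
    by (rule tree_class_C_postcompose_linear[OF tmod_dq[OF TY] tlin_node[OF Suc.prems(2)]])
  then have 2: "tree_class_C j (node_mod X) (node_mod Y) ?D (node \<circ> ?h \<circ> unnode)"
    by (rule tree_class_C_cong) (auto simp: split_beta')
  have "tree_class_C j (node_mod X) C ?D ((g1 \<circ> unnode) \<circ> (node \<circ> ?h \<circ> unnode))"
  proof (rule Suc.IH[OF NX NY D 2 g1(2)])
    have "?h z \<in> dq_dom Y U'" if "z \<in> dq_dom X U" for z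
      using that Suc.prems(6) diff_quotD(2)[OF f1(1) that] diff_quot_add[OF f1(1)]
      by (cases z) (auto simp: dq_dom_def simp flip: diff_quot_add[OF f1(1)])
    then show "(node \<circ> ?h \<circ> unnode) ` ?D \<subseteq> node ` dq_dom Y U'" by fastforce
  qed
  moreover have "(g1 \<circ> unnode) \<circ> (node \<circ> ?h \<circ> unnode) = (\<lambda>(x, v, t). g1 (f x, f1 (x, v, t), t)) \<circ> unnode"
    by (auto simp: fun_eq_iff split_beta')
  ultimately show ?case by (intro tree_class_C_SucI[OF 1])
qed

lemma class_C_cong:
  assumes "class_C j A B U f" "\<And>x. x \<in> U \<Longrightarrow> f x = g x"
  shows "class_C j A B U g"
  using assms(1) unfolding class_C_def by (rule tree_class_C_cong) (use assms(2) in auto)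

lemma leaf_image_car: "U \<subseteq> car A \<Longrightarrow> leaf ` U \<subseteq> car (leaf_mod A)"
  by (auto simp: leaf_mod_def)

lemma class_C_compose:
  fixes A :: "('k::base_ring, 'a::{topological_space, ab_group_add}) tmodule"
    and B :: "('k, 'b::{topological_space, ab_group_add}) tmodule"
  assumes A: "tmod A" and B: "tmod B" and U: "U \<subseteq> car A" and f: "class_C j A B U f"
    and g: "class_C j B C U' g" and im: "f ` U \<subseteq> U'"
  shows "class_C j A C U (\<lambda>x. g (f x))"
proof -
  have 1: "tree_class_C j (leaf_mod A) (leaf_mod B) (leaf ` U) (leaf \<circ> (f \<circ> unleaf))"
    by (rule tree_class_C_postcompose_linear[OF B tlin_leaf[OF B] f[unfolded class_C_def]])
  have 2: "((leaf :: 'b \<Rightarrow> ('b, 'k) tree) \<circ> (f \<circ> unleaf)) ` (leaf :: 'a \<Rightarrow> ('a, 'k) tree) ` U \<subseteq> leaf ` U'"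
    using im by (intro image_subsetI, elim imageE) auto
  show ?thesis
    using tree_class_C_compose[OF tree_mod_leaf[OF A] tree_mod_leaf[OF B] leaf_image_car[OF U] 1
      g[unfolded class_C_def] 2] unfolding class_C_def by (simp add: comp_def)
qed

lemma class_C_linear:
  assumes A: "tmod A" and f: "tlin A B f" and U: "U \<subseteq> car A" shows "class_C j A B U f"
  unfolding class_C_def
  by (intro tree_class_C_linear tree_mod_leaf A tlin_compose[OF tlin_unleaf[OF A] f] leaf_image_car U)

lemma class_C_Pair:
  assumes "class_C j A B U f" "class_C j A C U g"
  shows "class_C j A (prod_mod B C) U (\<lambda>x. (f x, g x))"
  using tree_class_C_Pair[OF assms[unfolded class_C_def]] unfolding class_C_def by (simp add: comp_def)

lemma class_C_multi:
  assumes "tmod (mF F)"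
    and "\<And>\<beta>. \<beta> \<subseteq> {1..k} \<Longrightarrow> class_C j A (mF F) U (\<lambda>z. f z \<beta>)"
    and "\<And>z \<beta>. z \<in> U \<Longrightarrow> \<not> \<beta> \<subseteq> {1..k} \<Longrightarrow> f z \<beta> = 0"
  shows "class_C j A (multi_mod F k) U f"
  unfolding class_C_def
proof (rule tree_class_C_multi[OF assms(1)])
  show "tree_class_C j (leaf_mod A) (mF F) (leaf ` U) (\<lambda>z. (f \<circ> unleaf) z \<beta>)" if "\<beta> \<subseteq> {1..k}" for \<beta>
    using assms(2)[OF that] unfolding class_C_def comp_def .
  show "(f \<circ> unleaf) z \<beta> = 0" if "z \<in> leaf ` U" "\<not> \<beta> \<subseteq> {1..k}" for z \<beta>
    using that(1) by (rule imageE) (use assms(3) that(2) in simp)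
qed

text \<open>The encodings $\mathrm{node}(\mathrm{leaf}\,x, \mathrm{leaf}\,v, t)$ and $\mathrm{leaf}(x,v,t)$ of a
point of $A^{[1]}$ correspond to each other under a linear homeomorphism.  Hence $f^{[1]}$ is $C^j$ as a map on the
product module, without reference to trees.\<close>

lemma class_C_SucD:
  assumes A: "tmod A" and U: "U \<subseteq> car A" and f: "class_C (Suc j) A B U f"
  shows "\<exists>f1. diff_quot A B U f f1 \<and> class_C j (dq_mod A) B (dq_dom A U) f1"
proof -
  note L = tree_mod_leaf[OF A] and lc = leaf_image_car[OF U]
  obtain f1 where f1: "diff_quot (leaf_mod A) B (leaf ` U) (f \<circ> unleaf) f1"
    "tree_class_C j (node_mod (leaf_mod A)) B (node ` dq_dom (leaf_mod A) (leaf ` U)) (f1 \<circ> unnode)"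
    using f unfolding class_C_def by auto
  let ?l = "\<lambda>(x, v, t). (leaf x, leaf v, t)"
  have 1: "diff_quot A B U f (f1 \<circ> ?l)"
    using diff_quot_compose[OF A tree_mod_tmod[OF L] U diff_quot_linear[OF A tlin_leaf[OF A] U] f1(1)]
    by (simp add: comp_def split_beta')
  let ?\<phi> = "node \<circ> (?l \<circ> unleaf)"
  have \<phi>: "tlin (leaf_mod (dq_mod A)) (node_mod (leaf_mod A)) ?\<phi>"
    by (rule tlin_compose[OF tlin_compose[OF tlin_unleaf[OF tmod_dq[OF A]] tlin_dq_map[OF tlin_leaf[OF A]]]
          tlin_node[OF L]])
  have la: "leaf (x + scl A t v) = leaf x + scl (leaf_mod A) t (leaf v)" if "v \<in> car A" for x v t
    using tlin_scl[OF tlin_leaf[OF A] that] by (simp add: leaf_add)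
  have "?l z \<in> dq_dom (leaf_mod A) (leaf ` U)" if "z \<in> dq_dom A U" for z
  proof -
    obtain x v t where z: "z = (x, v, t)" by (cases z)
    note d = dq_domD[OF that[unfolded z]]
    have "(leaf x, leaf v, t) \<in> dq_dom (leaf_mod A) (leaf ` U)"
      using d la[of v x t, symmetric] tlin_car[OF tlin_leaf[OF A]] by (intro dq_domI) simp_all
    then show ?thesis by (simp add: z)
  qed
  then have "?\<phi> ` leaf ` dq_dom A U \<subseteq> node ` dq_dom (leaf_mod A) (leaf ` U)"
    by (intro image_subsetI, elim imageE) simp
  then have "tree_class_C j (leaf_mod (dq_mod A)) B (leaf ` dq_dom A U) ((f1 \<circ> unnode) \<circ> ?\<phi>)"
    by (intro tree_class_C_precompose_linear[OF tree_mod_node[OF L] tree_mod_leaf[OF tmod_dq[OF A]] \<phi> f1(2)]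
        leaf_image_car dq_dom_car U)
  then have "class_C j (dq_mod A) B (dq_dom A U) (f1 \<circ> ?l)"
    unfolding class_C_def by (simp add: comp_def)
  with 1 show ?thesis by blast
qed

lemma smoothD: "smooth A B U f \<Longrightarrow> class_C j A B U f"
  by (simp add: smooth_def)

lemma smooth_maps: "smooth A B U f \<Longrightarrow> x \<in> U \<Longrightarrow> f x \<in> car B"
  using smoothD[of A B U f 0] tree_class_C_maps[of 0 "leaf_mod A" B "leaf ` U" "f \<circ> unleaf" "leaf x"]
  by (simp add: class_C_def)

lemma smooth_cong: "smooth A B U f \<Longrightarrow> (\<And>x. x \<in> U \<Longrightarrow> f x = g x) \<Longrightarrow> smooth A B U g"
  unfolding smooth_def by (blast intro: class_C_cong)

lemma smooth_compose:
  assumes "tmod A" "tmod B" "U \<subseteq> car A" "smooth A B U f" "smooth B C U' g" "f ` U \<subseteq> U'"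
  shows "smooth A C U (\<lambda>x. g (f x))"
  using class_C_compose[OF assms(1-3) smoothD[OF assms(4)] smoothD[OF assms(5)] assms(6)]
  by (simp add: smooth_def)

lemma smooth_linear: "tmod A \<Longrightarrow> tlin A B f \<Longrightarrow> U \<subseteq> car A \<Longrightarrow> smooth A B U f"
  by (simp add: smooth_def class_C_linear)

lemma smooth_Pair:
  "smooth A B U f \<Longrightarrow> smooth A C U g \<Longrightarrow> smooth A (prod_mod B C) U (\<lambda>x. (f x, g x))"
  by (simp add: smooth_def class_C_Pair)

lemma smooth_multi:
  assumes "tmod (mF F)"
    and "\<And>\<beta>. \<beta> \<subseteq> {1..k} \<Longrightarrow> smooth A (mF F) U (\<lambda>z. f z \<beta>)"
    and "\<And>z \<beta>. z \<in> U \<Longrightarrow> \<not> \<beta> \<subseteq> {1..k} \<Longrightarrow> f z \<beta> = 0"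
  shows "smooth A (multi_mod F k) U f"
  using class_C_multi[OF assms(1) smoothD[OF assms(2)] assms(3)] by (simp add: smooth_def)

lemma smooth_restrict:
  assumes "tmod A" "smooth A B U f" "U' \<subseteq> U" "U' \<subseteq> car A" shows "smooth A B U' f"
  using smooth_compose[OF assms(1,1,4) smooth_linear[OF assms(1) tlin_id assms(4)] assms(2)] assms(3) by simp

lemma smooth_compose_linear:
  assumes "tmod A" "tmod B" "U \<subseteq> car A" "smooth A B U f" "tlin B C g"
  shows "smooth A C U (\<lambda>x. g (f x))"
  using smooth_maps[OF assms(4)]
  by (intro smooth_compose[OF assms(1-4) smooth_linear[OF assms(2,5) order_refl]]) auto

lemma smooth_add:
  assumes "tmod A" "tmod B" "U \<subseteq> car A" "smooth A B U f" "smooth A B U g"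
  shows "smooth A B U (\<lambda>x. f x + g x)"
  using smooth_compose_linear[OF assms(1) tmod_prod[OF assms(2,2)] assms(3) smooth_Pair[OF assms(4,5)]
      tlin_plus[OF assms(2)]] by simp

section \<open>Derivatives\<close>

definition mod_open :: "('k, 'a::topological_space) tmodule \<Rightarrow> 'a set \<Rightarrow> bool" where
  "mod_open A U \<longleftrightarrow> openin (top_of_set (car A)) U"

lemma mod_open_subset: "mod_open A U \<Longrightarrow> U \<subseteq> car A"
  using openin_imp_subset by (auto simp: mod_open_def)

lemma mod_open_line:
  assumes A: "tmod A" and U: "mod_open A U" and x: "x \<in> car A" and v: "v \<in> car A"
  shows "open {t. x + scl A t v \<in> U}"
proof -
  obtain T where T: "open T" "U = car A \<inter> T" using U unfolding mod_open_def openin_open by auto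
  have "continuous_on UNIV (\<lambda>t. x + scl A t v)"
    by (intro tmod_continuous_add[OF A] tmod_continuous_scl[OF A] continuous_on_const continuous_on_id)
  then have "open ((\<lambda>t. x + scl A t v) -` T)" using T(1) by (simp add: open_vimage)
  also have "(\<lambda>t. x + scl A t v) -` T = {t. x + scl A t v \<in> U}"
    using tmod_car[OF A] x v by (auto simp: T(2))
  finally show ?thesis .
qed

text \<open>Every neighbourhood of \<open>0\<close> contains units, and two continuous maps into a Hausdorff space agree on a closed
set.\<close>

lemma eq_at_zero_of_units:
  fixes h h' :: "'k::base_ring \<Rightarrow> 'b::topological_space"
  assumes H: "Hausdorff_space (euclidean :: 'b topology)" and S: "open S" "0 \<in> S"
    and c: "continuous_on S h" "continuous_on S h'" and eq: "\<And>t. t \<in> S \<Longrightarrow> t dvd 1 \<Longrightarrow> h t = h' t"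
  shows "h 0 = h' 0"
proof (rule ccontr)
  assume "h 0 \<noteq> h' 0"
  then obtain U V where UV: "open U" "open V" "h 0 \<in> U" "h' 0 \<in> V" "disjnt U V"
    using H unfolding Hausdorff_space_def by (metis open_openin UNIV_I topspace_euclidean)
  have "open (h -` U \<inter> S)" "open (h' -` V \<inter> S)"
    using continuous_on_open_vimage[OF S(1)] c UV by blast+
  then have "open ((h -` U \<inter> S) \<inter> (h' -` V \<inter> S))" by (rule open_Int)
  moreover have "0 \<in> (h -` U \<inter> S) \<inter> (h' -` V \<inter> S)" using UV S by auto
  ultimately obtain u where "u \<in> (h -` U \<inter> S) \<inter> (h' -` V \<inter> S)" "u dvd 1"
    using units_meet_open by blast
  with eq UV show False by (auto simp: disjnt_iff)
qed

lemma unit_cancel: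
  assumes "tmod B" "t dvd 1" "scl B t x = scl B t y" shows "x = y"
proof -
  obtain s where s: "1 = t * s" using assms(2) by (rule dvdE)
  have "scl B s (scl B t x) = scl B s (scl B t y)" using assms(3) by simp
  then show ?thesis using assms(1) s by (simp add: mult.commute)
qed

text \<open>For units \<open>t\<close> the difference quotient is determined by the values of the map on the line through \<open>x\<close> in
the direction \<open>v\<close>; its value at \<open>t = 0\<close> follows by density.\<close>

lemma diff_quot_unique:
  assumes A: "tmod A" and B: "tmod B" and U: "mod_open A U" "mod_open A U'"
    and f: "diff_quot A B U f f1" "diff_quot A B U' g g1"
    and x: "x \<in> U" "x \<in> U'" and v: "v \<in> car A"
    and eq: "\<And>t. x + scl A t v \<in> U \<Longrightarrow> x + scl A t v \<in> U' \<Longrightarrow> f (x + scl A t v) = g (x + scl A t v)"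
  shows "f1 (x, v, 0) = g1 (x, v, 0)"
proof -
  let ?S = "{t. x + scl A t v \<in> U} \<inter> {t. x + scl A t v \<in> U'}"
  have xA: "x \<in> car A" using mod_open_subset[OF U(1)] x(1) by auto
  have d: "(x, v, t) \<in> dq_dom A U \<and> (x, v, t) \<in> dq_dom A U'" if "t \<in> ?S" for t
    using that x v by (auto intro: dq_domI)
  have c: "continuous_on ?S (\<lambda>t. f1 (x, v, t))" "continuous_on ?S (\<lambda>t. g1 (x, v, t))"
    by (rule continuous_on_compose2[OF diff_quotD(3)[OF f(1)]],
        intro continuous_on_Pair continuous_on_const continuous_on_id, use d in blast)
      (rule continuous_on_compose2[OF diff_quotD(3)[OF f(2)]],
        intro continuous_on_Pair continuous_on_const continuous_on_id, use d in blast)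
  show ?thesis
  proof (rule eq_at_zero_of_units[OF _ _ _ c])
    show "open ?S" by (intro open_Int mod_open_line A U xA v)
    show "0 \<in> ?S" using x A by simp
    show "f1 (x, v, t) = g1 (x, v, t)" if t: "t \<in> ?S" "t dvd 1" for t
    proof (rule unit_cancel[OF B t(2)])
      have "f x = g x" using eq[of 0] x A by simp
      then show "scl B t (f1 (x, v, t)) = scl B t (g1 (x, v, t))"
        using diff_quotD(4)[OF f(1), of x v t] diff_quotD(4)[OF f(2), of x v t] d[OF t(1)] eq[of t] t(1)
        by simp
    qed
  qed (use B in \<open>simp add: tmod_def\<close>)
qed

lemma Df_eq:
  assumes "tmod A" "tmod B" "mod_open A U" "diff_quot A B U f f1" "x \<in> U" "v \<in> car A"
  shows "Df A B U f x v = f1 (x, v, 0)"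
  unfolding Df_def
  by (rule the_equality) (use assms diff_quot_unique[OF assms(1-3,3)] in blast)+

text \<open>The class $C^1$, stated without the encoding by trees.\<close>

definition diffable where "diffable A B U f \<longleftrightarrow> (\<exists>f1. diff_quot A B U f f1)"

lemma smooth_diffable:
  assumes "tmod A" "U \<subseteq> car A" "smooth A B U f" shows "diffable A B U f"
  using class_C_SucD[OF assms(1,2) smoothD[OF assms(3)]] by (auto simp: diffable_def)

lemma Df_car:
  assumes "tmod A" "tmod B" "mod_open A U" "diffable A B U f" "x \<in> U" "v \<in> car A"
  shows "Df A B U f x v \<in> car B"
proof -
  obtain f1 where f1: "diff_quot A B U f f1" using assms(4) by (auto simp: diffable_def)
  have "(x, v, 0) \<in> dq_dom A U" using assms by (intro dq_domI) simp_all
  then show ?thesis using Df_eq[OF assms(1-3) f1 assms(5,6)] diff_quotD(2)[OF f1] by simp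
qed

text \<open>Derivatives in the direction \<open>v\<close> only depend on the restriction to the line through \<open>x\<close> in
  the direction \<open>v\<close>.\<close>

lemma Df_line_cong:
  assumes "tmod A" "tmod B" "mod_open A U" "mod_open A U'" "diffable A B U f" "diffable A B U' g"
    "x \<in> U" "x \<in> U'" "v \<in> car A"
    "\<And>t. x + scl A t v \<in> U \<Longrightarrow> x + scl A t v \<in> U' \<Longrightarrow> f (x + scl A t v) = g (x + scl A t v)"
  shows "Df A B U f x v = Df A B U' g x v"
proof -
  obtain f1 g1 where f1: "diff_quot A B U f f1" and g1: "diff_quot A B U' g g1"
    using assms(5,6) by (auto simp: diffable_def)
  then have "f1 (x, v, 0) = g1 (x, v, 0)"
    by (rule diff_quot_unique[OF assms(1-4)]) (use assms(7-10) in auto)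
  then show ?thesis
    using Df_eq[OF assms(1-3) f1 assms(7,9)] Df_eq[OF assms(1,2,4) g1 assms(8,9)] by simp
qed

lemma Df_linear:
  assumes "tmod A" "tmod B" "mod_open A U" "tlin A B f" "x \<in> U" "v \<in> car A"
  shows "Df A B U f x v = f v"
  using Df_eq[OF assms(1-3) diff_quot_linear[OF assms(1,4) mod_open_subset[OF assms(3)]] assms(5,6)] by simp

lemma Df_compose:
  assumes A: "tmod A" and B: "tmod B" and C: "tmod C" and U: "mod_open A U" "mod_open B U'"
    and f: "diffable A B U f" and g: "diffable B C U' g" and im: "f ` U \<subseteq> U'"
    and x: "x \<in> U" "v \<in> car A"
  shows "Df A C U (\<lambda>x. g (f x)) x v = Df B C U' g (f x) (Df A B U f x v)"
proof -
  obtain f1 g1 where f1: "diff_quot A B U f f1" and g1: "diff_quot B C U' g g1"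
    using f g by (auto simp: diffable_def)
  have "diff_quot A C U (\<lambda>x. g (f x)) (\<lambda>(x, v, t). g1 (f x, f1 (x, v, t), t))"
    using diff_quot_compose[OF A B mod_open_subset[OF U(1)] f1 g1 im] by (simp add: comp_def)
  from Df_eq[OF A C U(1) this x] Df_eq[OF A B U(1) f1 x] Df_eq[OF B C U(2) g1, of "f x" "f1 (x, v, 0)"]
  show ?thesis using im x Df_car[OF A B U(1) f x] by (auto simp: image_subset_iff)
qed

lemma diffable_compose:
  assumes "tmod A" "tmod B" "U \<subseteq> car A" "diffable A B U f" "diffable B C U' g" "f ` U \<subseteq> U'"
  shows "diffable A C U (\<lambda>x. g (f x))"
  using diff_quot_compose[OF assms(1-3) _ _ assms(6)] assms(4,5)
  unfolding diffable_def comp_def by blast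

lemma diffable_linear: "tmod A \<Longrightarrow> tlin A B f \<Longrightarrow> U \<subseteq> car A \<Longrightarrow> diffable A B U f"
  using diff_quot_linear unfolding diffable_def by blast

lemma mod_open_car: "mod_open A (car A)"
  by (simp add: mod_open_def)

lemma Df_compose_linear:
  assumes "tmod A" "tmod B" "tmod C" "mod_open A U" "diffable A B U f" "tlin B C l" "x \<in> U" "v \<in> car A"
  shows "Df A C U (\<lambda>x. l (f x)) x v = l (Df A B U f x v)"
proof -
  have "f ` U \<subseteq> car B" using assms(5) by (auto simp: diffable_def diff_quot_def)
  then show ?thesis
    using Df_compose[OF assms(1-4) mod_open_car assms(5) diffable_linear[OF assms(2,6) order_refl] _ assms(7,8)]
      Df_linear[OF assms(2,3) mod_open_car assms(6)] Df_car[OF assms(1,2,4,5,7,8)] assms(7) by auto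
qed

lemma Df_Pair:
  assumes A: "tmod A" and B: "tmod B" and C: "tmod C" and U: "mod_open A U"
    and f: "diffable A B U f" and g: "diffable A C U g" and x: "x \<in> U" "v \<in> car A"
  shows "Df A (prod_mod B C) U (\<lambda>x. (f x, g x)) x v = (Df A B U f x v, Df A C U g x v)"
proof -
  obtain f1 g1 where f1: "diff_quot A B U f f1" and g1: "diff_quot A C U g g1"
    using f g by (auto simp: diffable_def)
  have "diff_quot A (prod_mod B C) U (\<lambda>x. (f x, g x)) (\<lambda>z. (f1 z, g1 z))"
    using f1 g1 unfolding diff_quot_def by (auto intro: continuous_on_Pair)
  from Df_eq[OF A tmod_prod[OF B C] U this x] Df_eq[OF A B U f1 x] Df_eq[OF A C U g1 x]
  show ?thesis by simp
qed

lemma smooth_Df: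
  assumes A: "tmod A" and B: "tmod B" and U: "mod_open A U" and f: "smooth A B U f"
  shows "smooth (prod_mod A A) B (U \<times> car A) (\<lambda>(x, v). Df A B U f x v)"
  unfolding smooth_def
proof
  fix j
  note UA = mod_open_subset[OF U]
  obtain f1 where f1: "diff_quot A B U f f1" "class_C j (dq_mod A) B (dq_dom A U) f1"
    using class_C_SucD[OF A UA smoothD[OF f]] by blast
  have "tlin (prod_mod A A) (dq_mod A) (\<lambda>z. (fst z, snd z, 0))"
    unfolding tlin_def by (auto simp: dq_mod_def intro!: continuous_intros)
  then have "class_C j (prod_mod A A) (dq_mod A) (U \<times> car A) (\<lambda>z. (fst z, snd z, 0))"
    using UA by (intro class_C_linear tmod_prod A) auto
  from class_C_compose[OF tmod_prod[OF A A] tmod_dq[OF A] _ this f1(2)]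
  have "class_C j (prod_mod A A) B (U \<times> car A) (\<lambda>z. f1 (fst z, snd z, 0))"
    using UA A by (force intro!: dq_domI)
  then show "class_C j (prod_mod A A) B (U \<times> car A) (\<lambda>(x, v). Df A B U f x v)"
    by (rule class_C_cong) (auto simp: Df_eq[OF A B U f1(1)])
qed

text \<open>For units \<open>t\<close> the identity $f^{[1]}(x, v + w, t) = f^{[1]}(x, v, t) + f^{[1]}(x + tv, w, t)$ holds
because the increments add up.\<close>

lemma Df_add:
  assumes A: "tmod A" and B: "tmod B" and U: "mod_open A U" and f: "diffable A B U f"
    and x: "x \<in> U" and v: "v \<in> car A" and w: "w \<in> car A"
  shows "Df A B U f x (v + w) = Df A B U f x v + Df A B U f x w"
proof -
  obtain f1 where f1: "diff_quot A B U f f1" using f by (auto simp: diffable_def)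
  have xA: "x \<in> car A" using mod_open_subset[OF U] x by auto
  note vw = tmod_car(2)[OF A v w]
  let ?S = "{t. x + scl A t v \<in> U} \<inter> {t. x + scl A t (v + w) \<in> U}"
  have e: "x + scl A t v + scl A t w = x + scl A t (v + w)" for t using A by (simp add: add.assoc)
  have d: "(x, v, t) \<in> dq_dom A U" "(x, v + w, t) \<in> dq_dom A U" "(x + scl A t v, w, t) \<in> dq_dom A U"
    if "t \<in> ?S" for t
    using that x v w vw by (auto intro!: dq_domI simp: e simp del: tmod_scl)
  have "f1 (x, v + w, 0) = f1 (x, v, 0) + f1 (x + scl A 0 v, w, 0)"
  proof (rule eq_at_zero_of_units[where S = ?S and h = "\<lambda>t. f1 (x, v + w, t)" and
        h' = "\<lambda>t. f1 (x, v, t) + f1 (x + scl A t v, w, t)"])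
    show "open ?S" by (intro open_Int mod_open_line A U xA v vw)
    show "0 \<in> ?S" using x A by simp
    show "continuous_on ?S (\<lambda>t. f1 (x, v + w, t))"
      by (rule continuous_on_compose2[OF diff_quotD(3)[OF f1]],
          intro continuous_on_Pair continuous_on_const continuous_on_id, use d in blast)
    show "continuous_on ?S (\<lambda>t. f1 (x, v, t) + f1 (x + scl A t v, w, t))"
      by (intro tmod_continuous_add[OF B] continuous_on_compose2[OF diff_quotD(3)[OF f1]]
            continuous_on_Pair continuous_on_const continuous_on_id tmod_continuous_add[OF A]
            tmod_continuous_scl[OF A]) (use d in blast)+
    show "f1 (x, v + w, t) = f1 (x, v, t) + f1 (x + scl A t v, w, t)" if t: "t \<in> ?S" "t dvd 1" for t
    proof (rule unit_cancel[OF B t(2)])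
      have "scl B t (f1 (x, v, t)) + scl B t (f1 (x + scl A t v, w, t)) =
          (f (x + scl A t v) - f x) + (f (x + scl A t v + scl A t w) - f (x + scl A t v))"
        using d[OF t(1)] diff_quotD(4)[OF f1] by simp
      also have "\<dots> = f (x + scl A t (v + w)) - f x" by (simp only: e) simp
      also have "\<dots> = scl B t (f1 (x, v + w, t))" by (rule diff_quotD(4)[OF f1 d(2)[OF t(1)]])
      finally show "scl B t (f1 (x, v + w, t)) = scl B t (f1 (x, v, t) + f1 (x + scl A t v, w, t))"
        using B by simp
    qed
  qed (use B in \<open>simp add: tmod_def\<close>)
  then show ?thesis
    using Df_eq[OF A B U f1 x] v w vw A by simp
qed

text \<open>For units \<open>t\<close> one has $f^{[1]}(x, rv, t) = r f^{[1]}(x, v, tr)$.\<close>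

lemma Df_scl:
  assumes A: "tmod A" and B: "tmod B" and U: "mod_open A U" and f: "diffable A B U f"
    and x: "x \<in> U" and v: "v \<in> car A"
  shows "Df A B U f x (scl A r v) = scl B r (Df A B U f x v)"
proof -
  obtain f1 where f1: "diff_quot A B U f f1" using f by (auto simp: diffable_def)
  have xA: "x \<in> car A" using mod_open_subset[OF U] x by auto
  note rv = tmod_car(3)[OF A v, of r]
  let ?S = "{t. x + scl A t (scl A r v) \<in> U}"
  have d: "(x, scl A r v, t) \<in> dq_dom A U" "(x, v, t * r) \<in> dq_dom A U" if "t \<in> ?S" for t
    using that x v rv A by (auto intro!: dq_domI)
  have "f1 (x, scl A r v, 0) = scl B r (f1 (x, v, 0 * r))"
  proof (rule eq_at_zero_of_units[where S = ?S and h = "\<lambda>t. f1 (x, scl A r v, t)" and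
        h' = "\<lambda>t. scl B r (f1 (x, v, t * r))"])
    show "open ?S" by (intro mod_open_line A U xA rv)
    show "0 \<in> ?S" using x A by simp
    show "continuous_on ?S (\<lambda>t. f1 (x, scl A r v, t))"
      by (rule continuous_on_compose2[OF diff_quotD(3)[OF f1]],
          intro continuous_on_Pair continuous_on_const continuous_on_id, use d in blast)
    show "continuous_on ?S (\<lambda>t. scl B r (f1 (x, v, t * r)))"
      by (intro tmod_continuous_scl[OF B] continuous_on_compose2[OF diff_quotD(3)[OF f1]]
            continuous_on_Pair continuous_on_const continuous_on_id continuous_on_mult') (use d in blast)+
    show "f1 (x, scl A r v, t) = scl B r (f1 (x, v, t * r))" if t: "t \<in> ?S" "t dvd 1" for t
    proof (rule unit_cancel[OF B t(2)])
      have "scl B t (f1 (x, scl A r v, t)) = f (x + scl A t (scl A r v)) - f x"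
        using diff_quotD(4)[OF f1 d(1)[OF t(1)]] by simp
      also have "\<dots> = scl B (t * r) (f1 (x, v, t * r))"
        using diff_quotD(4)[OF f1 d(2)[OF t(1)]] A by simp
      finally show "scl B t (f1 (x, scl A r v, t)) = scl B t (scl B r (f1 (x, v, t * r)))"
        using B by simp
    qed
  qed (use B in \<open>simp add: tmod_def\<close>)
  then show ?thesis
    using Df_eq[OF A B U f1 x] v rv A by simp
qed

lemma Df_module_hom:
  assumes A: "tmod A" and B: "tmod B" and c: "car A = UNIV"
    and U: "mod_open A U" and f: "diffable A B U f" and x: "x \<in> U"
  shows "module_hom (scl A) (scl B) (\<lambda>v. Df A B U f x v)"
  unfolding module_hom_def module_hom_axioms_def
  using tmod_module[OF A] tmod_module[OF B] Df_add[OF A B U f x] Df_scl[OF A B U f x] c by auto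

section \<open>The modules of multi-indexed families and the tangent functor\<close>

lemma tmod_multi:
  fixes F :: "('k::base_ring, 'v::{topological_space, ab_group_add}, 'w::{topological_space, ab_group_add}, 'm, 'f, 'i) vbundle"
  assumes T: "tmod (mF F)" shows "tmod (multi_mod F k)"
proof -
  have m: "module (scl (multi_mod F k))"
    using T by (auto simp: module_def fun_eq_iff simp del: prod_mod_simps)
  have "module.subspace (scl (multi_mod F k)) (car (multi_mod F k))"
    unfolding module.subspace_def[OF m] using tmod_scl(7)[OF T] by (auto simp del: prod_mod_simps)
  moreover have "Hausdorff_space (euclidean :: ('v, 'w) multi topology)"
    using T unfolding tmod_def by (blast intro: Hausdorff_fun)
  moreover have "continuous_on UNIV (\<lambda>(x::('v, 'w) multi, y). x + y)"
    unfolding split_beta' plus_fun_def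
    by (intro continuous_on_coordinatewise_then_product tmod_continuous_add[OF T]
        continuous_on_product_then_coordinatewise[OF continuous_on_fst[OF continuous_on_id]]
        continuous_on_product_then_coordinatewise[OF continuous_on_snd[OF continuous_on_id]])
  moreover have "continuous_on UNIV (\<lambda>(t, x). scl (multi_mod F k) t x)"
    unfolding split_beta' multi_mod_simps
    by (intro continuous_on_coordinatewise_then_product tmod_continuous_scl[OF T] continuous_on_fst continuous_on_id
        continuous_on_product_then_coordinatewise[OF continuous_on_snd[OF continuous_on_id]])
  ultimately show ?thesis using m unfolding tmod_def by blast
qed

text \<open>\<open>lo n u\<close> and \<open>hi n u\<close> are the families \<open>a\<close> and \<open>b\<close>, not involving $\varepsilon_n$, with
  $u = a + \varepsilon_n b$, and \<open>join n a b\<close> is $a + \varepsilon_n b$.\<close>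

definition lo :: "nat \<Rightarrow> (nat set \<Rightarrow> 'a::zero) \<Rightarrow> nat set \<Rightarrow> 'a" where
  "lo n u = (\<lambda>\<beta>. if n \<in> \<beta> then 0 else u \<beta>)"

definition hi :: "nat \<Rightarrow> (nat set \<Rightarrow> 'a::zero) \<Rightarrow> nat set \<Rightarrow> 'a" where
  "hi n u = (\<lambda>\<beta>. if n \<in> \<beta> then 0 else u (insert n \<beta>))"

definition join :: "nat \<Rightarrow> (nat set \<Rightarrow> 'a) \<Rightarrow> (nat set \<Rightarrow> 'a) \<Rightarrow> nat set \<Rightarrow> 'a" where
  "join n a b = (\<lambda>\<beta>. if n \<in> \<beta> then b (\<beta> - {n}) else a \<beta>)"

text \<open>For families supported in \<open>{1..k}\<close> this is invariance under the group $\Sigma_k$, see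
\<open>perm_act_fixed_iff\<close>.\<close>

definition symmetric_upto :: "nat \<Rightarrow> (nat set \<Rightarrow> 'a) \<Rightarrow> bool" where
  "symmetric_upto k u \<longleftrightarrow> (\<forall>\<beta> \<beta>'. \<beta> \<subseteq> {1..k} \<longrightarrow> \<beta>' \<subseteq> {1..k} \<longrightarrow> card \<beta> = card \<beta>' \<longrightarrow> u \<beta> = u \<beta>')"

text \<open>The coefficients of $\varepsilon^\alpha\varepsilon_{k+1}$ and $\varepsilon^\alpha\varepsilon_{k+2}$ agree for all
$\alpha$ involving neither unit, i.e. the family is invariant under the exchange of
$\varepsilon_{k+1}$ and $\varepsilon_{k+2}$.\<close>

abbreviation swap_fixed :: "nat \<Rightarrow> (nat set \<Rightarrow> 'a::zero) \<Rightarrow> bool" where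
  "swap_fixed k u \<equiv> hi (Suc k) (lo (Suc (Suc k)) u) = lo (Suc k) (hi (Suc (Suc k)) u)"

lemma T_map_join:
  "T_map B k U f u = join (Suc k) (f (lo (Suc k) u))
     (Df (multi_mod B k) (multi_mod B k) U f (lo (Suc k) u) (hi (Suc k) u))"
  by (simp add: T_map_def join_def lo_def hi_def Let_def)

lemma subset_Suc_interval: "\<beta> \<subseteq> {1..Suc k} \<Longrightarrow> Suc k \<notin> \<beta> \<Longrightarrow> \<beta> \<subseteq> {1..k}"
  by (metis atLeastAtMostSuc_conv insert_absorb subset_insert le_Suc_eq le0 One_nat_def Suc_le_mono)

lemma symD: "symmetric_upto k u \<Longrightarrow> \<beta> \<subseteq> {1..k} \<Longrightarrow> \<beta>' \<subseteq> {1..k} \<Longrightarrow> card \<beta> = card \<beta>' \<Longrightarrow> u \<beta> = u \<beta>'"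
  unfolding symmetric_upto_def by blast

lemma sym_small: "k \<le> 1 \<Longrightarrow> symmetric_upto k u"
proof -
  assume "k \<le> 1"
  then have sub: "{1..k} \<subseteq> {1}" by auto
  show ?thesis unfolding symmetric_upto_def
  proof (intro allI impI)
    fix \<beta> \<beta>' assume "\<beta> \<subseteq> {1..k}" "\<beta>' \<subseteq> {1..k}" and c: "card \<beta> = card \<beta>'"
    with sub have "\<beta> = {} \<or> \<beta> = {1}" "\<beta>' = {} \<or> \<beta>' = {1}" by (meson subset_singletonD subset_trans)+
    with c show "u \<beta> = u \<beta>'" by auto
  qed
qed

text \<open>The condition on \<open>lo n u\<close> and \<open>hi n u\<close> is symmetry in the first \<open>k + 1\<close> units, the last one is
  invariance under the exchange of the last two units.  The latter compares only coefficients which contain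
  exactly one of the two units: the others are carried to themselves by the exchange.\<close>

lemma sym_Suc_Suc:
  fixes u :: "nat set \<Rightarrow> 'a::zero" and k :: nat
  defines "m \<equiv> Suc k" and "n \<equiv> Suc (Suc k)"
  assumes z: "\<And>\<beta>. \<not> \<beta> \<subseteq> {1..n} \<Longrightarrow> u \<beta> = 0"
  shows "symmetric_upto n u \<longleftrightarrow> symmetric_upto m (lo n u) \<and> symmetric_upto m (hi n u) \<and> hi m (lo n u) = lo m (hi n u)"
proof
  have sub: "\<beta> \<subseteq> {1..n} \<and> insert n \<beta> \<subseteq> {1..n} \<and> n \<notin> \<beta> \<and> finite \<beta>" if "\<beta> \<subseteq> {1..m}" for \<beta>
    using that finite_subset[OF that] by (auto simp: m_def n_def subset_iff)
  assume s: "symmetric_upto n u"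
  have "symmetric_upto m (lo n u)" unfolding symmetric_upto_def
  proof (intro allI impI)
    fix \<beta> \<beta>' assume "\<beta> \<subseteq> {1..m}" "\<beta>' \<subseteq> {1..m}" "card \<beta> = card \<beta>'"
    then show "lo n u \<beta> = lo n u \<beta>'" using sub symD[OF s, of \<beta> \<beta>'] by (simp add: lo_def)
  qed
  moreover have "symmetric_upto m (hi n u)" unfolding symmetric_upto_def
  proof (intro allI impI)
    fix \<beta> \<beta>' assume "\<beta> \<subseteq> {1..m}" "\<beta>' \<subseteq> {1..m}" "card \<beta> = card \<beta>'"
    then show "hi n u \<beta> = hi n u \<beta>'" using sub symD[OF s, of "insert n \<beta>" "insert n \<beta>'"] by (simp add: hi_def)
  qed
  moreover have "hi m (lo n u) \<beta> = lo m (hi n u) \<beta>" for \<beta>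
  proof (cases "m \<in> \<beta> \<or> n \<in> \<beta> \<or> \<not> \<beta> \<subseteq> {1..n}")
    case True
    then have "m \<in> \<beta> \<or> n \<in> \<beta> \<or> (\<not> insert m \<beta> \<subseteq> {1..n} \<and> \<not> insert n \<beta> \<subseteq> {1..n})" by auto
    then show ?thesis using z[of "insert m \<beta>"] z[of "insert n \<beta>"]
      by (elim disjE) (simp_all add: lo_def hi_def)
  next
    case False
    then have "\<beta> \<subseteq> {1..n}" "insert m \<beta> \<subseteq> {1..n}" "insert n \<beta> \<subseteq> {1..n}" by (auto simp: m_def n_def)
    then show ?thesis using False symD[OF s, of "insert m \<beta>" "insert n \<beta>"] finite_subset[of \<beta> "{1..n}"]
      by (auto simp: lo_def hi_def m_def n_def)
  qed
  ultimately show "symmetric_upto m (lo n u) \<and> symmetric_upto m (hi n u) \<and> hi m (lo n u) = lo m (hi n u)" by blast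
next
  assume A: "symmetric_upto m (lo n u) \<and> symmetric_upto m (hi n u) \<and> hi m (lo n u) = lo m (hi n u)"
  have lo': "u \<beta> = u \<beta>'" if "\<beta> \<subseteq> {1..m}" "\<beta>' \<subseteq> {1..m}" "card \<beta> = card \<beta>'" for \<beta> \<beta>'
  proof -
    have "n \<notin> \<beta>" "n \<notin> \<beta>'" using that(1,2) by (auto simp: m_def n_def)
    then show ?thesis using symD[of m "lo n u" \<beta> \<beta>'] A that by (simp add: lo_def)
  qed
  have hi': "u (insert n \<beta>) = u (insert n \<beta>')" if "\<beta> \<subseteq> {1..m}" "\<beta>' \<subseteq> {1..m}" "card \<beta> = card \<beta>'" for \<beta> \<beta>'
  proof -
    have "n \<notin> \<beta>" "n \<notin> \<beta>'" using that(1,2) by (auto simp: m_def n_def)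
    then show ?thesis using symD[of m "hi n u" \<beta> \<beta>'] A that by (auto simp: hi_def)
  qed
  have sw: "u (insert m \<beta>) = u (insert n \<beta>)" if "\<beta> \<subseteq> {1..k}" for \<beta>
  proof -
    have "m \<notin> \<beta>" "n \<notin> \<beta>" using that by (auto simp: m_def n_def)
    then show ?thesis using fun_cong[OF conjunct2[OF conjunct2[OF A]], of \<beta>]
      by (simp add: lo_def hi_def m_def n_def)
  qed
  \<comment> \<open>A set with \<open>n\<close> can be exchanged for one of the same size without \<open>n\<close>, unless it is all of \<open>{1..n}\<close>:
      after exchanging the rest with a subset of \<open>{1..k}\<close>, the unit \<open>n\<close> is replaced by \<open>m\<close>.\<close>
  have ex: "\<exists>\<gamma>. \<gamma> \<subseteq> {1..m} \<and> card \<gamma> = card \<beta> \<and> u \<beta> = u \<gamma>" if \<beta>: "\<beta> \<subseteq> {1..n}" "card \<beta> < n" for \<beta>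
  proof (cases "n \<in> \<beta>")
    case False
    then show ?thesis using subset_Suc_interval[of \<beta> m] \<beta> by (auto simp: m_def n_def)
  next
    case True
    have fin: "finite \<beta>" using \<beta>(1) finite_subset by blast
    define \<gamma> where "\<gamma> = \<beta> - {n}"
    have \<gamma>: "\<gamma> \<subseteq> {1..m}" "\<beta> = insert n \<gamma>" "n \<notin> \<gamma>"
      using subset_Suc_interval[of "\<beta> - {n}" m] \<beta>(1) True by (auto simp: \<gamma>_def m_def n_def)
    then have c: "card \<beta> = Suc (card \<gamma>)" using fin by simp
    then have "card \<gamma> \<le> card {1..k}" using \<beta>(2) by (simp add: n_def)
    then obtain \<delta> where \<delta>: "\<delta> \<subseteq> {1..k}" "card \<delta> = card \<gamma>"
      using obtain_subset_with_card_n by metis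
    have "\<delta> \<subseteq> {1..m}" "m \<notin> \<delta>" "finite \<delta>" using \<delta>(1) finite_subset[OF \<delta>(1)] by (auto simp: m_def)
    then have "insert m \<delta> \<subseteq> {1..m}" "card (insert m \<delta>) = card \<beta>" using c \<delta>(2) by (auto simp: m_def)
    moreover have "u \<beta> = u (insert m \<delta>)"
      using hi'[OF \<gamma>(1) \<open>\<delta> \<subseteq> {1..m}\<close>] \<delta> sw \<gamma>(2) by simp
    ultimately show ?thesis by blast
  qed
  show "symmetric_upto n u" unfolding symmetric_upto_def
  proof (intro allI impI)
    fix \<beta> \<beta>' assume \<beta>: "\<beta> \<subseteq> {1..n}" "\<beta>' \<subseteq> {1..n}" "card \<beta> = card \<beta>'"
    show "u \<beta> = u \<beta>'"
    proof (cases "card \<beta> < n")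
      case True
      then show ?thesis using ex[of \<beta>] ex[of \<beta>'] lo' \<beta> by metis
    next
      case False
      then have "\<beta> = {1..n}" "\<beta>' = {1..n}"
        using \<beta> card_mono[of "{1..n}"] card_subset_eq[of "{1..n}"] by (simp_all add: le_antisym)
      then show ?thesis by simp
    qed
  qed
qed

locale typical_fiber =
  fixes B :: "('k::base_ring, 'v::{topological_ab_group_add, t2_space},
      'w::{topological_ab_group_add, t2_space}, 'm, 'f, 'i) vbundle"
  assumes topological_V: "topological_module (scV B)" and topological_W: "topological_module (scW B)"
begin

abbreviation "E k \<equiv> multi_mod B k"
abbreviation "X k N \<equiv> multi_over B k N"

lemma tmod_V: "tmod (mV B)" and tmod_W: "tmod (mW B)"
  by (rule tmod_full topological_V topological_W)+

lemma tmod_F: "tmod (mF B)"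
  by (rule tmod_prod[OF tmod_V tmod_W])

lemma tmod_E: "tmod (E k)"
  by (rule tmod_multi[OF tmod_F])

lemma scl_F_zero: "scl (mF B) t 0 = 0"
  by (rule tmod_scl(7)[OF tmod_F])

lemma E_iff: "u \<in> car (E k) \<longleftrightarrow> (\<forall>\<beta>. \<not> \<beta> \<subseteq> {1..k} \<longrightarrow> u \<beta> = 0)"
  by simp

lemma EI: "(\<And>\<beta>. \<not> \<beta> \<subseteq> {1..k} \<Longrightarrow> u \<beta> = 0) \<Longrightarrow> u \<in> car (E k)"
  by simp

lemma E_zero: "u \<in> car (E k) \<Longrightarrow> \<not> \<beta> \<subseteq> {1..k} \<Longrightarrow> u \<beta> = 0"
  by simp

lemma X_iff: "u \<in> X k N \<longleftrightarrow> u \<in> car (E k) \<and> fst (u {}) \<in> N"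
  by (simp add: multi_over_def)

lemma X_car: "X k N \<subseteq> car (E k)"
  using X_iff by blast

lemma tlin_eval: "tlin (E k) (mF B) (\<lambda>u. u \<beta>)"
  unfolding tlin_def by (auto intro: continuous_on_apply continuous_on_id)

lemma tlin_multi:
  assumes f: "\<And>\<beta>. \<beta> \<subseteq> {1..k} \<Longrightarrow> tlin A (mF B) (\<lambda>z. f z \<beta>)"
    and z: "\<And>\<beta> z. z \<in> car A \<Longrightarrow> \<not> \<beta> \<subseteq> {1..k} \<Longrightarrow> f z \<beta> = 0" and A: "tmod A"
  shows "tlin A (E k) f"
proof -
  have 1: "f (x + y) \<beta> = f x \<beta> + f y \<beta>" if "x \<in> car A" "y \<in> car A" for x y \<beta>
    using that tlin_add[OF f] z tmod_car(2)[OF A] by (cases "\<beta> \<subseteq> {1..k}") auto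
  have 2: "f (scl A t x) \<beta> = scl (mF B) t (f x \<beta>)" if "x \<in> car A" for t x \<beta>
    using that tlin_scl[OF f] z scl_F_zero[of t] tmod_car(3)[OF A] by (cases "\<beta> \<subseteq> {1..k}") auto
  have 3: "continuous_on (car A) (\<lambda>z. f z \<beta>)" for \<beta>
  proof (cases "\<beta> \<subseteq> {1..k}")
    case True
    then show ?thesis by (rule tlin_continuous[OF f])
  next
    case False
    then show ?thesis by (intro continuous_on_eq[OF continuous_on_const[of _ 0]]) (simp add: z)
  qed
  show ?thesis unfolding tlin_def
  proof (intro conjI ballI allI)
    show "f ` car A \<subseteq> car (E k)" using z by (intro image_subsetI EI) blast
    show "continuous_on (car A) f" by (rule continuous_on_coordinatewise_then_product) (rule 3)
  qed (auto simp: 1 2 fun_eq_iff simp del: prod_mod_simps)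
qed

lemma lo_zero: "u \<in> car (E (Suc k)) \<Longrightarrow> \<not> \<beta> \<subseteq> {1..k} \<Longrightarrow> lo (Suc k) u \<beta> = 0"
  using subset_Suc_interval[of \<beta> k] by (auto simp: lo_def)

lemma hi_zero: "u \<in> car (E (Suc k)) \<Longrightarrow> \<not> \<beta> \<subseteq> {1..k} \<Longrightarrow> hi (Suc k) u \<beta> = 0"
  using subset_Suc_interval[of \<beta> k] E_zero[of u "Suc k" "insert (Suc k) \<beta>"]
  unfolding hi_def by (metis insert_subset)

lemma tlin_lo: "tlin (E (Suc k)) (E k) (lo (Suc k))"
proof (rule tlin_multi[OF _ lo_zero tmod_E])
  fix \<beta> assume "\<beta> \<subseteq> {1..k}"
  then have "Suc k \<notin> \<beta>" by auto
  then show "tlin (E (Suc k)) (mF B) (\<lambda>u. lo (Suc k) u \<beta>)" using tlin_eval by (simp add: lo_def)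
qed

lemma tlin_hi: "tlin (E (Suc k)) (E k) (hi (Suc k))"
proof (rule tlin_multi[OF _ hi_zero tmod_E])
  fix \<beta> assume "\<beta> \<subseteq> {1..k}"
  then have "Suc k \<notin> \<beta>" by auto
  then show "tlin (E (Suc k)) (mF B) (\<lambda>u. hi (Suc k) u \<beta>)" using tlin_eval by (simp add: hi_def)
qed

lemma lo_car: "u \<in> car (E (Suc k)) \<Longrightarrow> lo (Suc k) u \<in> car (E k)"
  and hi_car: "u \<in> car (E (Suc k)) \<Longrightarrow> hi (Suc k) u \<in> car (E k)"
  by (rule tlin_car[OF tlin_lo] tlin_car[OF tlin_hi], assumption)+

lemma lo_X: "u \<in> X (Suc k) N \<Longrightarrow> lo (Suc k) u \<in> X k N"
  unfolding X_iff using lo_car by (simp add: lo_def)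

lemma join_car:
  assumes "a \<in> car (E k)" "b \<in> car (E k)" shows "join (Suc k) a b \<in> car (E (Suc k))"
proof (rule EI)
  fix \<beta> :: "nat set" assume "\<not> \<beta> \<subseteq> {1..Suc k}"
  then have "\<not> \<beta> \<subseteq> {1..k}" "\<not> \<beta> - {Suc k} \<subseteq> {1..k}" by (auto simp: subset_iff le_Suc_eq)
  then show "join (Suc k) a b \<beta> = 0" using assms by (simp add: join_def)
qed

lemma join_empty [simp]: "join n a b {} = a {}"
  by (simp add: join_def)

lemma lo_join: "a \<in> car (E k) \<Longrightarrow> lo (Suc k) (join (Suc k) a b) = a"
proof
  fix \<beta> assume a: "a \<in> car (E k)"
  show "lo (Suc k) (join (Suc k) a b) \<beta> = a \<beta>"
  proof (cases "Suc k \<in> \<beta>")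
    case True
    then have "\<not> \<beta> \<subseteq> {1..k}" by auto
    with True show ?thesis using E_zero[OF a] by (simp add: lo_def)
  qed (simp add: lo_def join_def)
qed

lemma hi_join: "b \<in> car (E k) \<Longrightarrow> hi (Suc k) (join (Suc k) a b) = b"
proof
  fix \<beta> assume b: "b \<in> car (E k)"
  show "hi (Suc k) (join (Suc k) a b) \<beta> = b \<beta>"
  proof (cases "Suc k \<in> \<beta>")
    case True
    then have "\<not> \<beta> \<subseteq> {1..k}" by auto
    with True show ?thesis using E_zero[OF b] by (simp add: hi_def)
  qed (simp add: hi_def join_def)
qed

lemma join_lo_hi: "join n (lo n u) (hi n u) = (u :: nat set \<Rightarrow> 'a::zero)"
  by (auto simp: join_def lo_def hi_def fun_eq_iff insert_absorb)

lemma tlin_join: "tlin (prod_mod (E k) (E k)) (E (Suc k)) (\<lambda>z. join (Suc k) (fst z) (snd z))"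
proof (rule tlin_multi[OF _ _ tmod_prod[OF tmod_E tmod_E]])
  fix \<beta> :: "nat set"
  show "tlin (prod_mod (E k) (E k)) (mF B) (\<lambda>z. join (Suc k) (fst z) (snd z) \<beta>)"
    using tlin_compose[OF tlin_fst tlin_eval] tlin_compose[OF tlin_snd tlin_eval]
    by (cases "Suc k \<in> \<beta>") (simp_all add: join_def comp_def)
  show "join (Suc k) (fst z) (snd z) \<beta> = 0"
    if "z \<in> car (prod_mod (E k) (E k))" "\<not> \<beta> \<subseteq> {1..Suc k}" for z
  proof -
    have "fst z \<in> car (E k)" "snd z \<in> car (E k)" using that(1) unfolding prod_mod_simps by auto
    from E_zero[OF join_car[OF this] that(2)] show ?thesis .
  qed
qed

lemma mod_open_X:
  assumes "open N" shows "mod_open (E k) (X k N)"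
proof -
  have "open ((\<lambda>u::('v, 'w) multi. fst (u {})) -` N)"
    by (rule open_vimage[OF assms continuous_on_fst[OF continuous_on_apply[OF continuous_on_id]]])
  moreover have "X k N = car (E k) \<inter> (\<lambda>u. fst (u {})) -` N"
    unfolding multi_over_def by auto
  ultimately show ?thesis unfolding mod_open_def openin_open by blast
qed

lemma X_mono: "N \<subseteq> N' \<Longrightarrow> X k N \<subseteq> X k N'"
  by (auto simp: multi_over_def)

lemma smooth_XD:
  assumes "smooth (E k) A (X k N) f"
  shows "diffable (E k) A (X k N) f"
  by (rule smooth_diffable[OF tmod_E X_car assms])

lemma Df_E_car:
  assumes "open N" "smooth (E k) (E l) (X k N) f" "a \<in> X k N" "b \<in> car (E k)"
  shows "Df (E k) (E l) (X k N) f a b \<in> car (E l)"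
  by (rule Df_car[OF tmod_E tmod_E mod_open_X[OF assms(1)] smooth_XD[OF assms(2)] assms(3,4)])

abbreviation "T k N f \<equiv> T_map B k (X k N) f"

lemma
  assumes "open N" "smooth (E k) (E k) (X k N) f" "u \<in> X (Suc k) N"
  shows T_car: "T k N f u \<in> car (E (Suc k))"
    and lo_T: "lo (Suc k) (T k N f u) = f (lo (Suc k) u)"
    and hi_T: "hi (Suc k) (T k N f u) = Df (E k) (E k) (X k N) f (lo (Suc k) u) (hi (Suc k) u)"
proof -
  have "u \<in> car (E (Suc k))" using assms(3) X_iff by blast
  note lh = lo_X[OF assms(3)] hi_car[OF this]
  note c = smooth_maps[OF assms(2) lh(1)] Df_E_car[OF assms(1,2) lh]
  show "T k N f u \<in> car (E (Suc k))" unfolding T_map_join by (rule join_car[OF c])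
  show "lo (Suc k) (T k N f u) = f (lo (Suc k) u)" unfolding T_map_join by (rule lo_join[OF c(1)])
  show "hi (Suc k) (T k N f u) = Df (E k) (E k) (X k N) f (lo (Suc k) u) (hi (Suc k) u)"
    unfolding T_map_join by (rule hi_join[OF c(2)])
qed

lemma T_empty: "T k N f u {} = f (lo (Suc k) u) {}"
  by (simp add: T_map_join)

lemma lo_empty [simp]: "lo (Suc k) u {} = u {}"
  by (simp add: lo_def)

lemma T_maps:
  assumes "open N" "smooth (E k) (E k) (X k N) f" "f ` X k N \<subseteq> X k N'" "u \<in> X (Suc k) N"
  shows "T k N f u \<in> X (Suc k) N'"
proof -
  have "f (lo (Suc k) u) \<in> X k N'" using assms(3) lo_X[OF assms(4)] by blast
  then show ?thesis unfolding X_iff using T_car[OF assms(1,2,4)] by (simp only: T_empty)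
qed

text \<open>Up to the linear identification of $a + \varepsilon b$ with \<open>(a, b)\<close>, the tangent map is
\<open>(a, b) \<mapsto> (f a, df(a) b)\<close>.\<close>

lemma T_smooth:
  assumes N: "open N" and f: "smooth (E k) (E k) (X k N) f"
  shows "smooth (E (Suc k)) (E (Suc k)) (X (Suc k) N) (T k N f)"
proof -
  let ?A = "E (Suc k)" and ?Y = "X (Suc k) N"
  note lin = smooth_linear[OF tmod_E tlin_lo X_car] smooth_linear[OF tmod_E tlin_hi X_car]
  have 1: "smooth ?A (E k) ?Y (\<lambda>u. f (lo (Suc k) u))"
    by (rule smooth_compose[OF tmod_E tmod_E X_car lin(1) f]) (use lo_X in blast)
  have "smooth ?A (E k) ?Y (\<lambda>u. (\<lambda>(x, v). Df (E k) (E k) (X k N) f x v) (lo (Suc k) u, hi (Suc k) u))"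
    by (rule smooth_compose[OF tmod_E tmod_prod[OF tmod_E tmod_E] X_car smooth_Pair[OF lin]
          smooth_Df[OF tmod_E tmod_E mod_open_X[OF N] f]])
      (use lo_X hi_car X_car in blast)
  then have 2: "smooth ?A (E k) ?Y (\<lambda>u. Df (E k) (E k) (X k N) f (lo (Suc k) u) (hi (Suc k) u))"
    by simp
  show ?thesis
    using smooth_compose_linear[OF tmod_E tmod_prod[OF tmod_E tmod_E] X_car smooth_Pair[OF 1 2] tlin_join]
    by (simp add: T_map_join[abs_def])
qed

text \<open>The chain rule.\<close>

lemma T_compose:
  assumes N: "open N" "open N'" and f: "smooth (E k) (E k) (X k N) f" and g: "smooth (E k) (E k) (X k N') g"
    and im: "f ` X k N \<subseteq> X k N'" and u: "u \<in> X (Suc k) N"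
  shows "T k N (\<lambda>u. g (f u)) u = T k N' g (T k N f u)"
proof -
  have "u \<in> car (E (Suc k))" using u X_iff by blast
  note lh = lo_X[OF u] hi_car[OF this]
  show ?thesis
    unfolding T_map_join[of _ _ _ "\<lambda>u. g (f u)"] T_map_join[of _ _ _ g] lo_T[OF N(1) f u] hi_T[OF N(1) f u]
    using Df_compose[OF tmod_E tmod_E tmod_E mod_open_X[OF N(1)] mod_open_X[OF N(2)] smooth_XD[OF f]
        smooth_XD[OF g] im lh] by simp
qed

lemma T_cong:
  assumes N: "open N" "open N'" "N \<subseteq> N'" and g: "smooth (E k) (E k) (X k N') g"
    and eq: "\<And>u. u \<in> X k N \<Longrightarrow> f u = g u" and u: "u \<in> X (Suc k) N"
  shows "T k N f u = T k N' g u"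
proof -
  have "u \<in> car (E (Suc k))" using u X_iff by blast
  note lh = lo_X[OF u] hi_car[OF this]
  have "smooth (E k) (E k) (X k N) g" by (rule smooth_restrict[OF tmod_E g X_mono[OF N(3)] X_car])
  then have f: "smooth (E k) (E k) (X k N) f" by (rule smooth_cong) (simp add: eq)
  have "Df (E k) (E k) (X k N) f (lo (Suc k) u) (hi (Suc k) u) =
      Df (E k) (E k) (X k N') g (lo (Suc k) u) (hi (Suc k) u)"
    by (rule Df_line_cong[OF tmod_E tmod_E mod_open_X[OF N(1)] mod_open_X[OF N(2)] smooth_XD[OF f]
          smooth_XD[OF g] lh(1) subsetD[OF X_mono[OF N(3)] lh(1)] lh(2)]) (rule eq)
  then show ?thesis unfolding T_map_join using eq[OF lh(1)] by simp
qed

lemma T_id: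
  assumes N: "open N" and f: "\<And>u. u \<in> X k N \<Longrightarrow> f u = u" and u: "u \<in> X (Suc k) N"
  shows "T k N f u = u"
proof -
  have s: "smooth (E k) (E k) (X k N) (\<lambda>u. u)" by (rule smooth_linear[OF tmod_E tlin_id X_car])
  have "u \<in> car (E (Suc k))" using u X_iff by blast
  note lh = lo_X[OF u] hi_car[OF this]
  have "T k N f u = T k N (\<lambda>u. u) u"
    by (rule T_cong[OF N N order_refl s _ u]) (rule f)
  also have "\<dots> = join (Suc k) (lo (Suc k) u) (hi (Suc k) u)"
    unfolding T_map_join by (simp add: Df_linear[OF tmod_E tmod_E mod_open_X[OF N] tlin_id lh])
  finally show ?thesis by (simp add: join_lo_hi)
qed

lemma Df_coordinate:
  assumes "open N" "smooth (E k) (E l) (X k N) f" "a \<in> X k N" "b \<in> car (E k)"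
  shows "Df (E k) (E l) (X k N) f a b \<beta> = Df (E k) (mF B) (X k N) (\<lambda>u. f u \<beta>) a b"
  by (rule Df_compose_linear[OF tmod_E tmod_E tmod_F mod_open_X[OF assms(1)] smooth_XD[OF assms(2)]
        tlin_eval assms(3,4), symmetric])

lemma smooth_coordinate:
  assumes "smooth (E k) (E l) (X k N) f"
  shows "smooth (E k) (mF B) (X k N) (\<lambda>u. f u \<beta>)"
  by (rule smooth_compose_linear[OF tmod_E tmod_E X_car assms tlin_eval])

subsection \<open>Symmetric families under the tangent functor\<close>

lemma sym_line: "symmetric_upto k a \<Longrightarrow> symmetric_upto k b \<Longrightarrow> symmetric_upto k (a + scl (E k) t b)"
  unfolding symmetric_upto_def multi_mod_simps plus_fun_def
  by (intro allI impI arg_cong2[of _ _ _ _ "(+)"] arg_cong[of _ _ "scl (mF B) t"]) blast+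

text \<open>A map preserving symmetric families has, in symmetric directions, symmetric difference quotients,
  hence symmetric derivatives.\<close>

lemma T_sym_parts:
  assumes N: "open N" and f: "smooth (E k) (E k) (X k N) f"
    and s: "\<And>u. u \<in> X k N \<Longrightarrow> symmetric_upto k u \<Longrightarrow> symmetric_upto k (f u)"
    and u: "u \<in> X (Suc k) N" "symmetric_upto k (lo (Suc k) u)" "symmetric_upto k (hi (Suc k) u)"
  shows "symmetric_upto k (lo (Suc k) (T k N f u))" "symmetric_upto k (hi (Suc k) (T k N f u))"
proof -
  have "u \<in> car (E (Suc k))" using u X_iff by blast
  note lh = lo_X[OF u(1)] hi_car[OF this]
  show "symmetric_upto k (lo (Suc k) (T k N f u))" unfolding lo_T[OF N f u(1)] by (rule s[OF lh(1) u(2)])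
  show "symmetric_upto k (hi (Suc k) (T k N f u))" unfolding hi_T[OF N f u(1)] symmetric_upto_def
  proof (intro allI impI)
    fix \<beta> \<beta>' assume b: "\<beta> \<subseteq> {1..k}" "\<beta>' \<subseteq> {1..k}" "card \<beta> = card \<beta>'"
    note c = smooth_XD[OF smooth_coordinate[OF f]]
    show "Df (E k) (E k) (X k N) f (lo (Suc k) u) (hi (Suc k) u) \<beta> =
        Df (E k) (E k) (X k N) f (lo (Suc k) u) (hi (Suc k) u) \<beta>'"
      unfolding Df_coordinate[OF N f lh]
    proof (rule Df_line_cong[OF tmod_E tmod_F mod_open_X[OF N] mod_open_X[OF N] c c lh(1,1,2)])
      fix t assume "lo (Suc k) u + scl (E k) t (hi (Suc k) u) \<in> X k N"
      from symD[OF s[OF this sym_line[OF u(2,3)]] b]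
      show "f (lo (Suc k) u + scl (E k) t (hi (Suc k) u)) \<beta> = f (lo (Suc k) u + scl (E k) t (hi (Suc k) u)) \<beta>'" .
    qed
  qed
qed

text \<open>Let $w = p + \varepsilon_m q + \varepsilon_n r + \varepsilon_m\varepsilon_n s$.  The
  coefficients of $\varepsilon_m$ and of $\varepsilon_n$ in \<open>TTf(w)\<close> are $df(p)q$ and $df(p)r$, so they
  agree if \<open>q = r\<close>.\<close>

lemma TT_swap:
  assumes N: "open N" and f: "smooth (E k) (E k) (X k N) f" and w: "w \<in> X (Suc (Suc k)) N"
    and sw: "swap_fixed k w"
  shows "swap_fixed k (T (Suc k) N (T k N f) w)"
proof -
  note Tf = T_smooth[OF N f]
  have wE: "w \<in> car (E (Suc (Suc k)))" using w X_iff by blast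
  note lh = lo_X[OF w] hi_car[OF wE]
  have 1: "hi (Suc k) (lo (Suc (Suc k)) (T (Suc k) N (T k N f) w)) = Df (E k) (E k) (X k N) f (lo (Suc k) (lo (Suc (Suc k)) w)) (hi (Suc k) (lo (Suc (Suc k)) w))"
    using lo_T[OF N Tf, of w] w hi_T[OF N f lh(1)]
    by simp
  have "lo (Suc k) (hi (Suc (Suc k)) (T (Suc k) N (T k N f) w)) = lo (Suc k) (Df (E (Suc k)) (E (Suc k)) (X (Suc k) N) (T k N f) (lo (Suc (Suc k)) w) (hi (Suc (Suc k)) w))"
    using hi_T[OF N Tf, of w] w by simp
  also have "\<dots> = Df (E (Suc k)) (E k) (X (Suc k) N) (\<lambda>u. lo (Suc k) (T k N f u)) (lo (Suc (Suc k)) w) (hi (Suc (Suc k)) w)"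
    using Df_compose_linear[OF tmod_E tmod_E tmod_E mod_open_X[OF N] smooth_XD[OF Tf] tlin_lo[of k] lh]
    by simp
  also have "\<dots> = Df (E (Suc k)) (E k) (X (Suc k) N) (\<lambda>u. f (lo (Suc k) u)) (lo (Suc (Suc k)) w) (hi (Suc (Suc k)) w)"
  proof (rule Df_line_cong[OF tmod_E tmod_E mod_open_X[OF N] mod_open_X[OF N] _ _ lh(1,1,2)])
    show "diffable (E (Suc k)) (E k) (X (Suc k) N) (\<lambda>u. lo (Suc k) (T k N f u))"
      by (rule smooth_XD[OF smooth_compose_linear[OF tmod_E tmod_E X_car Tf tlin_lo[of k]]])
    show "diffable (E (Suc k)) (E k) (X (Suc k) N) (\<lambda>u. f (lo (Suc k) u))"
      by (rule smooth_XD[OF smooth_compose[OF tmod_E tmod_E X_car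
              smooth_linear[OF tmod_E tlin_lo[of k] X_car] f]])
        (use lo_X in blast)
  qed (use lo_T[OF N f] in blast)
  also have "\<dots> = Df (E k) (E k) (X k N) f (lo (Suc k) (lo (Suc (Suc k)) w)) (lo (Suc k) (hi (Suc (Suc k)) w))"
    using Df_compose[OF tmod_E tmod_E tmod_E mod_open_X[OF N] mod_open_X[OF N]
        diffable_linear[OF tmod_E tlin_lo[of k] X_car] smooth_XD[OF f] _ lh]
      Df_linear[OF tmod_E tmod_E mod_open_X[OF N] tlin_lo[of k] lh] lo_X[of _ k N]
    by (auto simp: image_subset_iff simp del: multi_mod_simps)
  finally show ?thesis using sw 1 by simp
qed

lemma sym_iff_parts:
  assumes "u \<in> car (E (Suc (Suc k)))"
  shows "symmetric_upto (Suc (Suc k)) u \<longleftrightarrow> symmetric_upto (Suc k) (lo (Suc (Suc k)) u) \<and> symmetric_upto (Suc k) (hi (Suc (Suc k)) u) \<and>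
     swap_fixed k u"
  by (rule sym_Suc_Suc) (rule E_zero[OF assms])

lemma TT_sym:
  assumes N: "open N" and f: "smooth (E k) (E k) (X k N) f"
    and s: "\<And>u. u \<in> X (Suc k) N \<Longrightarrow> symmetric_upto (Suc k) u \<Longrightarrow> symmetric_upto (Suc k) (T k N f u)"
    and w: "w \<in> X (Suc (Suc k)) N" "symmetric_upto (Suc (Suc k)) w"
  shows "symmetric_upto (Suc (Suc k)) (T (Suc k) N (T k N f) w)"
proof -
  note Tf = T_smooth[OF N f]
  have wE: "w \<in> car (E (Suc (Suc k)))" using w X_iff by blast
  note p = w(2)[unfolded sym_iff_parts[OF wE]]
  show ?thesis
    unfolding sym_iff_parts[OF T_car[OF N Tf w(1)]]
    using T_sym_parts[OF N Tf s w(1)] TT_swap[OF N f w(1)] p by blast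
qed

end

section \<open>Permutations of the infinitesimal units\<close>

text \<open>Bijections between the two sets and between their complements are put together.\<close>

lemma extend_to_permutation:
  assumes S: "finite S" and \<beta>: "\<beta> \<subseteq> S" "\<beta>' \<subseteq> S" "card \<beta> = card \<beta>'"
  shows "\<exists>\<sigma>. \<sigma> permutes S \<and> \<sigma> ` \<beta> = \<beta>'"
proof -
  have fin: "finite \<beta>" "finite \<beta>'" using S \<beta> finite_subset by blast+
  obtain f where f: "bij_betw f \<beta> \<beta>'" using finite_same_card_bij[OF fin \<beta>(3)] by blast
  have "card (S - \<beta>) = card (S - \<beta>')" using S \<beta> fin by (simp add: card_Diff_subset)
  then obtain g where g: "bij_betw g (S - \<beta>) (S - \<beta>')"
    using finite_same_card_bij[of "S - \<beta>" "S - \<beta>'"] S by blast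
  define \<sigma> where "\<sigma> x = (if x \<in> \<beta> then f x else if x \<in> S then g x else x)" for x
  have "bij_betw \<sigma> \<beta> \<beta>'" using f by (rule bij_betw_cong[THEN iffD1, rotated]) (simp add: \<sigma>_def)
  moreover have "bij_betw \<sigma> (S - \<beta>) (S - \<beta>')"
    using g by (rule bij_betw_cong[THEN iffD1, rotated]) (simp add: \<sigma>_def)
  ultimately have "bij_betw \<sigma> (\<beta> \<union> (S - \<beta>)) (\<beta>' \<union> (S - \<beta>'))" by (rule bij_betw_combine) blast
  then have "bij_betw \<sigma> S S" using \<beta> by (simp add: Un_absorb1)
  then have "\<sigma> permutes S" by (rule bij_imp_permutes) (use \<beta> in \<open>auto simp: \<sigma>_def\<close>)
  moreover have "\<sigma> ` \<beta> = \<beta>'" using \<open>bij_betw \<sigma> \<beta> \<beta>'\<close> by (rule bij_betw_imp_surj_on)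
  ultimately show ?thesis by blast
qed

lemma permutes_image_subset: "\<sigma> permutes S \<Longrightarrow> inv \<sigma> ` \<beta> \<subseteq> S \<longleftrightarrow> \<beta> \<subseteq> S"
  using permutes_in_image[OF permutes_inv, of \<sigma> S] by (auto simp: image_subset_iff)

lemma card_permutes_image: "\<sigma> permutes S \<Longrightarrow> card (inv \<sigma> ` \<beta>) = card \<beta>"
  by (intro card_image inj_on_subset[OF permutes_inj[OF permutes_inv]]) auto

context typical_fiber
begin

lemma perm_act_fixed_iff:
  assumes u: "u \<in> car (E k)"
  shows "(\<forall>\<sigma>. \<sigma> permutes {1..k} \<longrightarrow> perm_act \<sigma> u = u) \<longleftrightarrow> symmetric_upto k u"
proof
  assume s: "symmetric_upto k u"
  show "\<forall>\<sigma>. \<sigma> permutes {1..k} \<longrightarrow> perm_act \<sigma> u = u"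
  proof (intro allI impI ext)
    fix \<sigma> \<beta> assume \<sigma>: "\<sigma> permutes {1..k}"
    note i = permutes_image_subset[OF \<sigma>, of \<beta>] card_permutes_image[OF \<sigma>, of \<beta>]
    show "perm_act \<sigma> u \<beta> = u \<beta>"
    proof (cases "\<beta> \<subseteq> {1..k}")
      case True
      then show ?thesis using symD[OF s _ True i(2)] i(1) unfolding perm_act_def by blast
    next
      case False
      then show ?thesis using E_zero[OF u] i(1) unfolding perm_act_def by metis
    qed
  qed
next
  assume p: "\<forall>\<sigma>. \<sigma> permutes {1..k} \<longrightarrow> perm_act \<sigma> u = u"
  show "symmetric_upto k u" unfolding symmetric_upto_def
  proof (intro allI impI)
    fix \<beta> \<beta>' assume "\<beta> \<subseteq> {1..k}" "\<beta>' \<subseteq> {1..k}" "card \<beta> = card \<beta>'"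
    then obtain \<sigma> where \<sigma>: "\<sigma> permutes {1..k}" "\<sigma> ` \<beta> = \<beta>'"
      using extend_to_permutation[of "{1..k}"] by blast
    then have "inv (inv \<sigma>) = \<sigma>" using inv_inv_eq[OF permutes_bij[OF \<sigma>(1)]] by simp
    then have "perm_act (inv \<sigma>) u \<beta> = u \<beta>'" using \<sigma> by (simp add: perm_act_def)
    then show "u \<beta> = u \<beta>'" using p permutes_inv[OF \<sigma>(1)] by metis
  qed
qed

lemma perm_act_X:
  assumes "u \<in> X k N" "\<sigma> permutes {1..k}" shows "perm_act \<sigma> u \<in> X k N"
proof -
  have "u \<in> car (E k)" using assms(1) X_iff by blast
  then have "perm_act \<sigma> u \<in> car (E k)"
    using permutes_image_subset[OF assms(2)] by (intro EI) (simp add: perm_act_def)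
  then show ?thesis using assms(1) unfolding X_iff by (simp add: perm_act_def)
qed

end

section \<open>Bundles given by their transition maps\<close>

text \<open>The properties of the transition maps of a vector bundle which the construction of the bundles
  \<open>T\<^sup>kF\<close> and \<open>A\<^sup>kF\<close> depends on.  They hold for a vector bundle and for the tangent bundle of its base.\<close>

locale transition_system = typical_fiber B
  for B :: "('k::base_ring, 'v::{topological_ab_group_add, t2_space},
      'w::{topological_ab_group_add, t2_space}, 'm, 'f, 'i) vbundle" +
  assumes open_overlap: "i \<in> charts B \<Longrightarrow> j \<in> charts B \<Longrightarrow> open (overlap B i j)"
    and smooth_base: "i \<in> charts B \<Longrightarrow> j \<in> charts B \<Longrightarrow> smooth (mV B) (mV B) (overlap B i j) (base_tr B i j)"
    and smooth_total: "i \<in> charts B \<Longrightarrow> j \<in> charts B \<Longrightarrow>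
      smooth (mF B) (mF B) (overlap B i j \<times> UNIV) (total_tr B i j)"
    and fst_total: "i \<in> charts B \<Longrightarrow> j \<in> charts B \<Longrightarrow> x \<in> overlap B i j \<Longrightarrow>
      fst (total_tr B i j (x, w)) = base_tr B i j x"
    and linear_total: "i \<in> charts B \<Longrightarrow> j \<in> charts B \<Longrightarrow> x \<in> overlap B i j \<Longrightarrow>
      module_hom (scW B) (scW B) (\<lambda>w. snd (total_tr B i j (x, w)))"
    and base_refl: "i \<in> charts B \<Longrightarrow> x \<in> overlap B i i \<Longrightarrow> base_tr B i i x = x"
    and total_refl: "i \<in> charts B \<Longrightarrow> x \<in> overlap B i i \<Longrightarrow> total_tr B i i (x, w) = (x, w)"
    and overlap_base: "i \<in> charts B \<Longrightarrow> j \<in> charts B \<Longrightarrow> l \<in> charts B \<Longrightarrow> x \<in> overlap B i j \<Longrightarrow>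
      base_tr B i j x \<in> overlap B j l \<longleftrightarrow> x \<in> overlap B i l"
    and base_cocycle: "i \<in> charts B \<Longrightarrow> j \<in> charts B \<Longrightarrow> l \<in> charts B \<Longrightarrow> x \<in> overlap B i j \<Longrightarrow>
      x \<in> overlap B i l \<Longrightarrow> base_tr B j l (base_tr B i j x) = base_tr B i l x"
    and total_cocycle: "i \<in> charts B \<Longrightarrow> j \<in> charts B \<Longrightarrow> l \<in> charts B \<Longrightarrow> x \<in> overlap B i j \<Longrightarrow>
      x \<in> overlap B i l \<Longrightarrow> total_tr B j l (total_tr B i j (x, w)) = total_tr B i l (x, w)"
begin

lemma overlap_self: "overlap B i i = chart_range B i"
  by (simp add: overlap_def chart_range_def)

lemma overlap_subset: "overlap B i j \<subseteq> chart_range B i"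
  by (auto simp: overlap_def chart_range_def)

lemma open_chart_range: "i \<in> charts B \<Longrightarrow> open (chart_range B i)"
  using open_overlap[of i i] by (simp add: overlap_self)

text \<open>The maps \<open>tr i j\<close> cover the transition maps of the base and satisfy the cocycle identities, so that the points
of the bundle glued from them are represented uniquely in each chart around their base point.\<close>

definition cocycle :: "nat \<Rightarrow> ('i \<Rightarrow> 'i \<Rightarrow> ('v, 'w) multi \<Rightarrow> ('v, 'w) multi) \<Rightarrow> bool" where
  "cocycle k tr \<longleftrightarrow> (\<forall>i\<in>charts B. \<forall>j\<in>charts B. \<forall>u\<in>X k (overlap B i j).
     tr i j u \<in> car (E k) \<and> fst (tr i j u {}) = base_tr B i j (fst (u {})) \<and> (i = j \<longrightarrow> tr i j u = u) \<and>
     (\<forall>l\<in>charts B. fst (u {}) \<in> overlap B i l \<longrightarrow> tr j l (tr i j u) = tr i l u))"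

lemma cocycleD:
  assumes "cocycle k tr" "i \<in> charts B" "j \<in> charts B" "u \<in> X k (overlap B i j)"
  shows "tr i j u \<in> car (E k)" "fst (tr i j u {}) = base_tr B i j (fst (u {}))" "i = j \<Longrightarrow> tr i j u = u"
    "l \<in> charts B \<Longrightarrow> fst (u {}) \<in> overlap B i l \<Longrightarrow> tr j l (tr i j u) = tr i l u"
  using assms unfolding cocycle_def by blast+

lemma cocycle_maps:
  assumes "cocycle k tr" "i \<in> charts B" "j \<in> charts B" "l \<in> charts B" "u \<in> X k (overlap B i j)"
    "fst (u {}) \<in> overlap B i l"
  shows "tr i j u \<in> X k (overlap B j l)"
  using cocycleD(1,2)[OF assms(1-3,5)] overlap_base[OF assms(2-4)] assms(5,6) unfolding X_iff by simp

lemma X_chart_range: "u \<in> X k (overlap B i j) \<Longrightarrow> u \<in> X k (chart_range B i)"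
  using X_mono[OF overlap_subset] by blast

lemma glue_pt_change_chart:
  assumes tr: "cocycle k tr" and i: "i \<in> charts B" and j: "j \<in> charts B" and u: "u \<in> X k (overlap B i j)"
  shows "glue_pt B tr j (tr i j u) = glue_pt B tr i u"
proof -
  have x: "fst (u {}) \<in> overlap B i j" using u unfolding X_iff by simp
  show ?thesis
    unfolding glue_pt_def
    using overlap_base[OF i j _ x] cocycleD(4)[OF tr i j u] cocycleD(2)[OF tr i j u] by auto
qed

lemma glue_pt_self:
  assumes "cocycle k tr" "i \<in> charts B" "u \<in> X k (chart_range B i)"
  shows "(i, u) \<in> glue_pt B tr i u"
  using cocycleD(3)[OF assms(1,2,2), of u] assms(2,3) overlap_self X_iff unfolding glue_pt_def by auto

lemma glue_pt_same_chart:
  assumes "cocycle k tr" "i \<in> charts B" "u \<in> X k (chart_range B i)" "(i, u') \<in> glue_pt B tr i u"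
  shows "u' = u"
  using cocycleD(3)[OF assms(1,2,2), of u] assms(3,4) overlap_self unfolding glue_pt_def by auto

lemma glue_pt_inj:
  assumes "cocycle k tr" "i \<in> charts B" "u \<in> X k (chart_range B i)" "u' \<in> X k (chart_range B i)"
    "glue_pt B tr i u = glue_pt B tr i u'"
  shows "u = u'"
  using glue_pt_self[OF assms(1-3)] glue_pt_same_chart[OF assms(1,2,4)] assms(5) by simp

lemma glue_pt_member:
  assumes tr: "cocycle k tr" and i: "i \<in> charts B" and u: "u \<in> X k (chart_range B i)"
    and m: "(j, u') \<in> glue_pt B tr i u"
  shows "j \<in> charts B" "u \<in> X k (overlap B i j)" "u' = tr i j u" "u' \<in> X k (chart_range B j)"
    "glue_pt B tr j u' = glue_pt B tr i u"
proof -
  show j: "j \<in> charts B" and u': "u' = tr i j u" using m by (auto simp: glue_pt_def)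
  have "fst (u {}) \<in> overlap B i j" using m by (auto simp: glue_pt_def)
  then show ov: "u \<in> X k (overlap B i j)" using u unfolding X_iff by simp
  have "fst (u {}) \<in> overlap B i i" using u unfolding X_iff overlap_self by simp
  then show "u' \<in> X k (chart_range B j)"
    using X_chart_range[OF cocycle_maps[OF tr i j i ov]] u' by simp
  show "glue_pt B tr j u' = glue_pt B tr i u"
    unfolding u' by (rule glue_pt_change_chart[OF tr i j ov])
qed

lemma glueI: "i \<in> charts B \<Longrightarrow> u \<in> X k (chart_range B i) \<Longrightarrow> glue_pt B tr i u \<in> glue B tr k"
  unfolding glue_def by blast

lemma glueE:
  assumes "z \<in> glue B tr k"
  obtains i u where "i \<in> charts B" "u \<in> X k (chart_range B i)" "z = glue_pt B tr i u"
  using assms unfolding glue_def by blast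

lemma induced_map_glue_pt:
  assumes tr: "cocycle k tr" "cocycle k tr'"
    and h: "\<And>i u. i \<in> charts B \<Longrightarrow> u \<in> X k (chart_range B i) \<Longrightarrow> h i u \<in> car (E k) \<and> fst (h i u {}) = fst (u {})"
    and compat: "\<And>i j u. i \<in> charts B \<Longrightarrow> j \<in> charts B \<Longrightarrow> u \<in> X k (overlap B i j) \<Longrightarrow> h j (tr i j u) = tr' i j (h i u)"
    and i: "i \<in> charts B" and u: "u \<in> X k (chart_range B i)"
  shows "induced_map B tr' h (glue_pt B tr i u) = glue_pt B tr' i (h i u)"
proof -
  have "glue_pt B tr' j (h j u') = glue_pt B tr' i (h i u)" if m: "(j, u') \<in> glue_pt B tr i u" for j u'
  proof -
    note d = glue_pt_member[OF tr(1) i u m]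
    have "h i u \<in> X k (overlap B i j)" using h[OF i u] d(2) unfolding X_iff by simp
    from glue_pt_change_chart[OF tr(2) i d(1) this] show ?thesis
      unfolding d(3) compat[OF i d(1,2)] .
  qed
  then show ?thesis
    unfolding induced_map_def using glue_pt_self[OF tr(1) i u] by fast
qed

text \<open>A point \<open>[i, u]\<close> is represented in the chart \<open>j\<close> by \<open>tr i j u\<close>.  If transition maps preserve
  symmetric families, all representatives of a point with symmetric \<open>u\<close> are symmetric, so the action, computed in
  whichever chart, fixes the point.  Conversely the chart \<open>i\<close> alone shows that \<open>u\<close> is invariant.\<close>

lemma fixed_pts_iff:
  assumes tr: "cocycle k tr"
    and s: "\<And>i j u. i \<in> charts B \<Longrightarrow> j \<in> charts B \<Longrightarrow> u \<in> X k (overlap B i j) \<Longrightarrow> symmetric_upto k u \<Longrightarrow>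
      symmetric_upto k (tr i j u)"
    and i: "i \<in> charts B" and u: "u \<in> X k (chart_range B i)"
  shows "glue_pt B tr i u \<in> fixed_pts B tr k \<longleftrightarrow> symmetric_upto k u"
proof
  assume f: "glue_pt B tr i u \<in> fixed_pts B tr k"
  have "perm_act \<sigma> u = u" if \<sigma>: "\<sigma> permutes {1..k}" for \<sigma>
  proof -
    have "(i, perm_act \<sigma> u) \<in> glue_pt B tr i (perm_act \<sigma> u)"
      by (rule glue_pt_self[OF tr i perm_act_X[OF u \<sigma>]])
    then have "(i, perm_act \<sigma> u) \<in> induced_map B tr (\<lambda>i. perm_act \<sigma>) (glue_pt B tr i u)"
      unfolding induced_map_def using glue_pt_self[OF tr i u] by blast
    then have "(i, perm_act \<sigma> u) \<in> glue_pt B tr i u"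
      using f \<sigma> unfolding fixed_pts_def by simp
    then show ?thesis by (rule glue_pt_same_chart[OF tr i u])
  qed
  moreover have "u \<in> car (E k)" using u X_iff by blast
  ultimately show "symmetric_upto k u" using perm_act_fixed_iff by blast
next
  assume su: "symmetric_upto k u"
  have "induced_map B tr (\<lambda>i. perm_act \<sigma>) (glue_pt B tr i u) = glue_pt B tr i u"
    if \<sigma>: "\<sigma> permutes {1..k}" for \<sigma>
  proof -
    have "glue_pt B tr j (perm_act \<sigma> u') = glue_pt B tr i u" if m: "(j, u') \<in> glue_pt B tr i u" for j u'
    proof -
      note d = glue_pt_member[OF tr i u m]
      have "u' \<in> car (E k)" "symmetric_upto k u'" using d(4) X_iff s[OF i d(1,2) su] d(3) by blast+
      then have "perm_act \<sigma> u' = u'" using perm_act_fixed_iff \<sigma> by blast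
      then show ?thesis using d(5) by simp
    qed
    then show ?thesis unfolding induced_map_def using glue_pt_self[OF tr i u] by fast
  qed
  then show "glue_pt B tr i u \<in> fixed_pts B tr k"
    unfolding fixed_pts_def using glueI[OF i u] by blast
qed

subsection \<open>The transition maps of \<open>A\<^sup>kF\<close>\<close>

text \<open>The derivative of a transition map of the base, i.e. the transition map of the tangent bundle on fibers; \<open>fib\<close>
below is that of the bundle itself.\<close>

definition dbase :: "'i \<Rightarrow> 'i \<Rightarrow> 'v \<Rightarrow> 'v \<Rightarrow> 'v" where
  "dbase i j x v = Df (mV B) (mV B) (overlap B i j) (base_tr B i j) x v"

definition fib :: "'i \<Rightarrow> 'i \<Rightarrow> 'v \<Rightarrow> 'w \<Rightarrow> 'w" where
  "fib i j x w = snd (total_tr B i j (x, w))"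

lemma total_split:
  "i \<in> charts B \<Longrightarrow> j \<in> charts B \<Longrightarrow> x \<in> overlap B i j \<Longrightarrow> total_tr B i j (x, w) = (base_tr B i j x, fib i j x w)"
  using fst_total[of i j x w] by (auto simp: fib_def prod_eq_iff)

lemma mod_open_V: "open N \<Longrightarrow> mod_open (mV B) N"
  by (simp add: mod_open_def)

lemma mod_open_F: "open N \<Longrightarrow> mod_open (mF B) (N \<times> UNIV)"
  by (simp add: mod_open_def open_Times)

lemma base_diffable:
  assumes "i \<in> charts B" "j \<in> charts B"
  shows "diffable (mV B) (mV B) (overlap B i j) (base_tr B i j)"
  by (rule smooth_diffable[OF tmod_V _ smooth_base[OF assms]]) simp

lemma total_diffable:
  assumes "i \<in> charts B" "j \<in> charts B"
  shows "diffable (mF B) (mF B) (overlap B i j \<times> UNIV) (total_tr B i j)"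
  by (rule smooth_diffable[OF tmod_F _ smooth_total[OF assms]]) simp

lemma dbase_hom:
  assumes "i \<in> charts B" "j \<in> charts B" "x \<in> overlap B i j"
  shows "module_hom (scV B) (scV B) (dbase i j x)"
  using Df_module_hom[OF tmod_V tmod_V _ mod_open_V[OF open_overlap[OF assms(1,2)]] base_diffable[OF assms(1,2)] assms(3)]
  by (simp add: dbase_def[abs_def])

lemma fib_hom:
  assumes "i \<in> charts B" "j \<in> charts B" "x \<in> overlap B i j"
  shows "module_hom (scW B) (scW B) (fib i j x)"
  using linear_total[OF assms] by (simp add: fib_def[abs_def])

lemma dbase_refl:
  assumes i: "i \<in> charts B" and x: "x \<in> overlap B i i"
  shows "dbase i i x v = v"
proof -
  note o = mod_open_V[OF open_overlap[OF i i]]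
  have "dbase i i x v = Df (mV B) (mV B) (overlap B i i) (\<lambda>x. x) x v"
    unfolding dbase_def
    by (rule Df_line_cong[OF tmod_V tmod_V o o base_diffable[OF i i] diffable_linear[OF tmod_V tlin_id] x x])
      (use base_refl[OF i] in auto)
  also have "\<dots> = v" using Df_linear[OF tmod_V tmod_V o tlin_id x] by simp
  finally show ?thesis .
qed

text \<open>The chain rule on the set where all three charts are defined.\<close>

lemma dbase_cocycle:
  assumes i: "i \<in> charts B" and j: "j \<in> charts B" and l: "l \<in> charts B"
    and x: "x \<in> overlap B i j" "x \<in> overlap B i l"
  shows "dbase j l (base_tr B i j x) (dbase i j x v) = dbase i l x v"
proof -
  let ?N = "overlap B i j \<inter> overlap B i l"
  have o: "open ?N" by (intro open_Int open_overlap i j l)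
  have s: "smooth (mV B) (mV B) ?N (base_tr B i j)"
    by (rule smooth_restrict[OF tmod_V smooth_base[OF i j]]) auto
  have d: "diffable (mV B) (mV B) ?N (base_tr B i j)" by (rule smooth_diffable[OF tmod_V _ s]) simp
  have im: "base_tr B i j ` ?N \<subseteq> overlap B j l" using overlap_base[OF i j l] by auto
  have "dbase i j x v = Df (mV B) (mV B) ?N (base_tr B i j) x v"
    unfolding dbase_def
    by (rule Df_line_cong[OF tmod_V tmod_V mod_open_V[OF open_overlap[OF i j]] mod_open_V[OF o]
          base_diffable[OF i j] d]) (use x in auto)
  then have "dbase j l (base_tr B i j x) (dbase i j x v) =
      Df (mV B) (mV B) ?N (\<lambda>x. base_tr B j l (base_tr B i j x)) x v"
    using Df_compose[OF tmod_V tmod_V tmod_V mod_open_V[OF o] mod_open_V[OF open_overlap[OF j l]] d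
        base_diffable[OF j l] im, of x v] x
    by (simp add: dbase_def)
  also have "\<dots> = dbase i l x v"
    unfolding dbase_def
    by (rule Df_line_cong[OF tmod_V tmod_V mod_open_V[OF o] mod_open_V[OF open_overlap[OF i l]]
          diffable_compose[OF tmod_V tmod_V _ d base_diffable[OF j l] im] base_diffable[OF i l]])
      (use x base_cocycle[OF i j l] in auto)
  finally show ?thesis .
qed

lemma fib_cocycle:
  assumes "i \<in> charts B" "j \<in> charts B" "l \<in> charts B" "x \<in> overlap B i j" "x \<in> overlap B i l"
  shows "fib j l (base_tr B i j x) (fib i j x w) = fib i l x w"
  using total_cocycle[OF assms, of w]
  unfolding total_split[OF assms(1,2,4)] total_split[OF assms(1,3,5)] fib_def[of j l] by simp

abbreviation "mVV \<equiv> prod_mod (mV B) (mV B)"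

text \<open>The transition map of the tangent bundle of the base in its bundle charts.\<close>

definition tangent_tr :: "'i \<Rightarrow> 'i \<Rightarrow> 'v \<times> 'v \<Rightarrow> 'v \<times> 'v" where
  "tangent_tr i j = (\<lambda>(x, v). (base_tr B i j x, dbase i j x v))"

lemma tangent_tr_smooth:
  assumes i: "i \<in> charts B" and j: "j \<in> charts B"
  shows "smooth mVV mVV (overlap B i j \<times> UNIV) (tangent_tr i j)"
proof -
  let ?A = "mVV" and ?U = "overlap B i j \<times> UNIV"
  note A = tmod_prod[OF tmod_V tmod_V]
  have "smooth ?A (mV B) ?U (\<lambda>z. base_tr B i j (fst z))"
    by (rule smooth_compose[OF A tmod_V _ smooth_linear[OF A tlin_fst] smooth_base[OF i j]]) auto
  moreover have "smooth ?A (mV B) ?U (\<lambda>(x, v). dbase i j x v)"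
    using smooth_Df[OF tmod_V tmod_V mod_open_V[OF open_overlap[OF i j]] smooth_base[OF i j]]
    by (simp add: dbase_def)
  ultimately have "smooth ?A ?A ?U (\<lambda>z. (base_tr B i j (fst z), (\<lambda>(x, v). dbase i j x v) z))"
    by (rule smooth_Pair)
  then show ?thesis by (simp add: tangent_tr_def split_beta')
qed

lemma tangent_tr_diffable:
  assumes "i \<in> charts B" "j \<in> charts B"
  shows "diffable mVV mVV (overlap B i j \<times> UNIV) (tangent_tr i j)"
  by (rule smooth_diffable[OF tmod_prod[OF tmod_V tmod_V] _ tangent_tr_smooth[OF assms]]) simp

lemma A_tr_apply:
  "A_tr B i j u \<beta> = (if \<beta> = {} then base_tr B i j (fst (u {})) else dbase i j (fst (u {})) (fst (u \<beta>)),
     fib i j (fst (u {})) (snd (u \<beta>)))"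
  by (simp add: A_tr_def Let_def dbase_def fib_def)

lemma A_tr_E:
  assumes "i \<in> charts B" "j \<in> charts B" "u \<in> X k (overlap B i j)"
  shows "A_tr B i j u \<in> car (E k)"
proof (rule EI)
  fix \<beta> :: "nat set" assume b: "\<not> \<beta> \<subseteq> {1..k}"
  have x: "fst (u {}) \<in> overlap B i j" and "u \<in> car (E k)" using assms(3) X_iff by blast+
  then have "u \<beta> = 0" "\<beta> \<noteq> {}" using E_zero[OF _ b] b by auto
  then show "A_tr B i j u \<beta> = 0"
    using module_hom.zero[OF dbase_hom[OF assms(1,2) x]] module_hom.zero[OF fib_hom[OF assms(1,2) x]]
    by (simp add: A_tr_apply zero_prod_def)
qed

lemma A_tr_cocycle: "cocycle k (A_tr B)"
  unfolding cocycle_def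
proof (intro ballI conjI impI)
  fix i j u assume i: "i \<in> charts B" and j: "j \<in> charts B" and u: "u \<in> X k (overlap B i j)"
  have x: "fst (u {}) \<in> overlap B i j" using u X_iff by blast
  show "A_tr B i j u \<in> car (E k)" by (rule A_tr_E[OF i j u])
  show "fst (A_tr B i j u {}) = base_tr B i j (fst (u {}))" by (simp add: A_tr_apply)
  show "A_tr B i j u = u" if "i = j"
    using x dbase_refl[OF i] base_refl[OF i] total_refl[OF i] that
    by (auto simp: A_tr_apply fun_eq_iff prod_eq_iff fib_def)
  fix l assume l: "l \<in> charts B" and xl: "fst (u {}) \<in> overlap B i l"
  show "A_tr B j l (A_tr B i j u) = A_tr B i l u"
    using dbase_cocycle[OF i j l x xl] fib_cocycle[OF i j l x xl] base_cocycle[OF i j l x xl]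
    by (auto simp: A_tr_apply fun_eq_iff)
qed

lemma A_tr_symmetric: "symmetric_upto k u \<Longrightarrow> symmetric_upto k (A_tr B i j u)"
proof -
  assume s: "symmetric_upto k u"
  have "A_tr B i j u \<beta> = A_tr B i j u \<beta>'" if b: "\<beta> \<subseteq> {1..k}" "\<beta>' \<subseteq> {1..k}" "card \<beta> = card \<beta>'" for \<beta> \<beta>'
  proof -
    have "finite \<beta>" "finite \<beta>'" using b finite_subset[OF _ finite_atLeastAtMost] by blast+
    then have "(\<beta> = {}) = (\<beta>' = {})" using b(3) card_0_eq[of \<beta>] card_0_eq[of \<beta>'] by simp
    moreover have "u \<beta> = u \<beta>'" by (rule symD[OF s b])
    ultimately show ?thesis unfolding A_tr_apply by (simp only:)
  qed
  then show ?thesis unfolding symmetric_upto_def by blast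
qed

lemma A_tr_chart_add:
  assumes i: "i \<in> charts B" and j: "j \<in> charts B" and x: "fst (u {}) \<in> overlap B i j" "fst (u {}) = fst (u' {})"
  shows "A_tr B i j (chart_add u u') = chart_add (A_tr B i j u) (A_tr B i j u')"
  using module_hom.add[OF dbase_hom[OF i j x(1)]] module_hom.add[OF fib_hom[OF i j x(1)]] x(2)
  by (auto simp: A_tr_apply chart_add_def fun_eq_iff prod_eq_iff)

lemma A_tr_chart_scl:
  assumes i: "i \<in> charts B" and j: "j \<in> charts B" and x: "fst (u {}) \<in> overlap B i j"
  shows "A_tr B i j (chart_scl B t u) = chart_scl B t (A_tr B i j u)"
  using module_hom.scale[OF dbase_hom[OF i j x(1)]] module_hom.scale[OF fib_hom[OF i j x(1)]]
  by (auto simp: A_tr_apply chart_scl_def fun_eq_iff prod_eq_iff)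

subsection \<open>The transition maps of \<open>T\<^sup>kF\<close>\<close>

lemma smooth_base_coordinate: "smooth (E k) (mF B) (X k N) (\<lambda>u. u \<beta>)"
  by (rule smooth_linear[OF tmod_E tlin_eval X_car])

lemma T_tr_props:
  assumes i: "i \<in> charts B" and j: "j \<in> charts B"
  shows "smooth (E k) (E k) (X k (overlap B i j)) (T_tr B k i j) \<and>
     (\<forall>u \<in> X k (overlap B i j). fst (T_tr B k i j u {}) = base_tr B i j (fst (u {})))"
proof (induction k)
  case 0
  have "smooth (E 0) (mF B) (X 0 (overlap B i j)) (\<lambda>u. total_tr B i j (u {}))"
    by (rule smooth_compose[OF tmod_E tmod_F X_car smooth_base_coordinate smooth_total[OF i j]])
      (intro image_subsetI, simp add: multi_over_def mem_Times_iff)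
  then have "smooth (E 0) (E 0) (X 0 (overlap B i j)) (T_tr B 0 i j)"
    by (intro smooth_multi[OF tmod_F]) auto
  moreover have "fst (T_tr B 0 i j u {}) = base_tr B i j (fst (u {}))" if "u \<in> X 0 (overlap B i j)" for u
    using fst_total[OF i j, of "fst (u {})" "snd (u {})"] that X_iff by simp
  ultimately show ?case by blast
next
  case (Suc k)
  have "fst (T_tr B (Suc k) i j u {}) = base_tr B i j (fst (u {}))" if "u \<in> X (Suc k) (overlap B i j)" for u
    using Suc lo_X[OF that] by (simp add: T_empty)
  then show ?case using T_smooth[OF open_overlap[OF i j]] Suc by simp
qed

lemma T_tr_smooth:
  assumes "i \<in> charts B" "j \<in> charts B"
  shows "smooth (E k) (E k) (X k (overlap B i j)) (T_tr B k i j)"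
  using T_tr_props[OF assms] by blast

lemma T_tr_base:
  assumes "i \<in> charts B" "j \<in> charts B" "u \<in> X k (overlap B i j)"
  shows "fst (T_tr B k i j u {}) = base_tr B i j (fst (u {}))"
  using T_tr_props[OF assms(1,2)] assms(3) by blast

lemma T_tr_maps:
  assumes "i \<in> charts B" "j \<in> charts B" "l \<in> charts B" "u \<in> X k (overlap B i j)" "fst (u {}) \<in> overlap B i l"
  shows "T_tr B k i j u \<in> X k (overlap B j l)"
  using T_tr_base[OF assms(1,2,4)] smooth_maps[OF T_tr_smooth[OF assms(1,2)] assms(4)]
    overlap_base[OF assms(1-3)] assms(4,5) unfolding X_iff by simp

lemma T_tr_refl:
  assumes i: "i \<in> charts B" and u: "u \<in> X k (overlap B i i)"
  shows "T_tr B k i i u = u"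
  using u
proof (induction k arbitrary: u)
  case 0
  have x: "fst (u {}) \<in> overlap B i i" and uE: "u \<in> car (E 0)" using 0 X_iff by blast+
  show ?case
    using total_refl[OF i x, of "snd (u {})"] E_zero[OF uE] by (auto simp: fun_eq_iff)
next
  case (Suc k)
  show ?case using T_id[OF open_overlap[OF i i] Suc.IH Suc.prems] by simp
qed

text \<open>The functor \<open>T\<close> carries the cocycle identity for \<open>T\<^sup>kF\<close> to the one for the next bundle.\<close>

lemma T_tr_trans:
  assumes i: "i \<in> charts B" and j: "j \<in> charts B" and l: "l \<in> charts B"
    and u: "u \<in> X k (overlap B i j)" "fst (u {}) \<in> overlap B i l"
  shows "T_tr B k j l (T_tr B k i j u) = T_tr B k i l u"
  using u
proof (induction k arbitrary: u)
  case 0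
  have x: "fst (u {}) \<in> overlap B i j" using 0 X_iff by blast
  show ?case
    using total_cocycle[OF i j l x 0(2), of "snd (u {})"] by (auto simp: fun_eq_iff)
next
  case (Suc k)
  let ?N = "overlap B i j \<inter> overlap B i l"
  have o: "open ?N" by (intro open_Int open_overlap i j l)
  have uN: "u \<in> X (Suc k) ?N" using Suc.prems unfolding X_iff by simp
  have s: "smooth (E k) (E k) (X k ?N) (T_tr B k i j)"
    by (rule smooth_restrict[OF tmod_E T_tr_smooth[OF i j] X_mono X_car]) simp
  have im: "T_tr B k i j ` X k ?N \<subseteq> X k (overlap B j l)"
  proof (rule image_subsetI)
    fix v assume "v \<in> X k ?N"
    then have "v \<in> X k (overlap B i j)" "fst (v {}) \<in> overlap B i l" unfolding X_iff by auto
    then show "T_tr B k i j v \<in> X k (overlap B j l)" by (rule T_tr_maps[OF i j l])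
  qed
  have "T_tr B (Suc k) j l (T_tr B (Suc k) i j u) =
      T k (overlap B j l) (T_tr B k j l) (T k (overlap B i j) (T_tr B k i j) u)" by simp
  also have "T k (overlap B i j) (T_tr B k i j) u = T k ?N (T_tr B k i j) u"
    by (rule T_cong[OF o open_overlap[OF i j] _ T_tr_smooth[OF i j] refl uN, symmetric]) simp
  also have "T k (overlap B j l) (T_tr B k j l) \<dots> = T k ?N (\<lambda>u. T_tr B k j l (T_tr B k i j u)) u"
    by (rule T_compose[OF o open_overlap[OF j l] s T_tr_smooth[OF j l] im uN, symmetric])
  also have "\<dots> = T k (overlap B i l) (T_tr B k i l) u"
  proof (rule T_cong[OF o open_overlap[OF i l] _ T_tr_smooth[OF i l] _ uN])
    fix v assume "v \<in> X k ?N"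
    then have "v \<in> X k (overlap B i j)" "fst (v {}) \<in> overlap B i l" unfolding X_iff by auto
    then show "T_tr B k j l (T_tr B k i j v) = T_tr B k i l v" by (rule Suc.IH)
  qed simp
  finally show ?case by simp
qed

lemma T_tr_cocycle: "cocycle k (T_tr B k)"
  unfolding cocycle_def
proof (intro ballI conjI impI)
  fix i j u assume i: "i \<in> charts B" and j: "j \<in> charts B" and u: "u \<in> X k (overlap B i j)"
  show "T_tr B k i j u \<in> car (E k)" by (rule smooth_maps[OF T_tr_smooth[OF i j] u])
  show "fst (T_tr B k i j u {}) = base_tr B i j (fst (u {}))" by (rule T_tr_base[OF i j u])
  show "T_tr B k i j u = u" if "i = j" using T_tr_refl[OF i] u that by simp
  fix l assume "l \<in> charts B" "fst (u {}) \<in> overlap B i l"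
  then show "T_tr B k j l (T_tr B k i j u) = T_tr B k i l u" using T_tr_trans[OF i j _ u] by blast
qed

text \<open>With at most one unit every family is symmetric, which starts the induction; from then on the transition map is
\<open>TTf\<close> for the transition map \<open>f\<close> of an earlier bundle.\<close>

lemma T_tr_symmetric:
  assumes i: "i \<in> charts B" and j: "j \<in> charts B"
  shows "u \<in> X k (overlap B i j) \<Longrightarrow> symmetric_upto k u \<Longrightarrow> symmetric_upto k (T_tr B k i j u)"
proof (induction k arbitrary: u)
  case 0
  show ?case by (rule sym_small) simp
next
  case (Suc k)
  show ?case
  proof (cases k)
    case 0
    then show ?thesis by (intro sym_small) simp
  next
    case (Suc l)
    have "symmetric_upto (Suc (Suc l)) (T (Suc l) (overlap B i j) (T l (overlap B i j) (T_tr B l i j)) u)"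
      by (rule TT_sym[OF open_overlap[OF i j] T_tr_smooth[OF i j]])
        (use Suc.prems Suc.IH Suc in \<open>simp_all del: multi_mod_simps\<close>)
    then show ?thesis unfolding Suc by simp
  qed
qed

end

section \<open>Vector bundles and tangent bundles as transition systems\<close>

context
  fixes F :: "('k::base_ring, 'v::{topological_ab_group_add, t2_space},
      'w::{topological_ab_group_add, t2_space}, 'm, 'f, 'i) vbundle"
  assumes F: "vector_bundle F"
begin

lemma vb_dom_subset: "i \<in> charts F \<Longrightarrow> dom F i \<subseteq> topspace (base F)"
  using F unfolding vector_bundle_def by blast

lemma vb_topological: "topological_module (scV F)" "topological_module (scW F)"
  using F unfolding vector_bundle_def by blast+

lemma vb_chart:
  assumes "i \<in> charts F"
  shows "openin (base F) (dom F i)" "open (chart_range F i)"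
    "homeomorphic_map (subtopology (base F) (dom F i)) (top_of_set (chart_range F i)) (chart F i)"
    "homeomorphic_map (subtopology (total F) (bdom F i)) (top_of_set (chart_range F i \<times> UNIV)) (bchart F i)"
    "z \<in> bdom F i \<Longrightarrow> fst (bchart F i z) = chart F i (proj F z)"
  using F assms unfolding vector_bundle_def by blast+

lemma vb_tr:
  assumes "i \<in> charts F" "j \<in> charts F"
  shows "smooth (mV F) (mV F) (overlap F i j) (base_tr F i j)"
    "smooth (mF F) (mF F) (overlap F i j \<times> UNIV) (total_tr F i j)"
    "x \<in> overlap F i j \<Longrightarrow> module_hom (scW F) (scW F) (\<lambda>w. snd (total_tr F i j (x, w)))"
  using F assms unfolding vector_bundle_def by blast+

lemma chart_inj: "i \<in> charts F \<Longrightarrow> inj_on (chart F i) (dom F i)"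
  using homeomorphic_imp_injective_map[OF vb_chart(3), of i] vb_dom_subset[of i]
  by (simp add: Int_absorb1)

lemma bdom_subset: "bdom F i \<subseteq> topspace (total F)"
  by (auto simp: bdom_def)

lemma bchart_inj: "i \<in> charts F \<Longrightarrow> inj_on (bchart F i) (bdom F i)"
  using homeomorphic_imp_injective_map[OF vb_chart(4), of i] bdom_subset[of i]
  by (simp add: Int_absorb1)

lemma bchart_image: "i \<in> charts F \<Longrightarrow> bchart F i ` bdom F i = chart_range F i \<times> UNIV"
  using homeomorphic_imp_surjective_map[OF vb_chart(4), of i] bdom_subset[of i]
  by (simp add: Int_absorb1)

lemma base_tr_chart: "i \<in> charts F \<Longrightarrow> p \<in> dom F i \<Longrightarrow> base_tr F i j (chart F i p) = chart F j p"
  using inv_into_f_f[OF chart_inj] by (simp add: base_tr_def)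

lemma total_tr_bchart: "i \<in> charts F \<Longrightarrow> z \<in> bdom F i \<Longrightarrow> total_tr F i j (bchart F i z) = bchart F j z"
  using inv_into_f_f[OF bchart_inj] by (simp add: total_tr_def)

lemma overlapE:
  assumes "x \<in> overlap F i j" obtains p where "p \<in> dom F i" "p \<in> dom F j" "x = chart F i p"
  using assms unfolding overlap_def by blast

lemma overlap_chart: "i \<in> charts F \<Longrightarrow> p \<in> dom F i \<Longrightarrow> chart F i p \<in> overlap F i j \<longleftrightarrow> p \<in> dom F j"
  using chart_inj[of i] unfolding overlap_def inj_on_def by blast

lemma chart_pointE:
  assumes i: "i \<in> charts F" and x: "x \<in> chart_range F i"
  obtains z where "z \<in> bdom F i" "bchart F i z = (x, w)" "chart F i (proj F z) = x"
proof -
  have "(x, w) \<in> bchart F i ` bdom F i" using bchart_image[OF i] x by simp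
  then obtain z where z: "z \<in> bdom F i" "bchart F i z = (x, w)" by (metis imageE)
  then show thesis using that vb_chart(5)[OF i z(1)] by simp
qed

lemma overlap_open:
  assumes i: "i \<in> charts F" and j: "j \<in> charts F" shows "open (overlap F i j)"
proof -
  have "openin (subtopology (base F) (dom F i)) (dom F i \<inter> dom F j)"
    using vb_chart(1)[OF i] vb_chart(1)[OF j] by (simp add: openin_open_subtopology openin_Int)
  then have "openin (top_of_set (chart_range F i)) (overlap F i j)"
    using homeomorphic_imp_open_map[OF vb_chart(3)[OF i]] unfolding open_map_def overlap_def by blast
  then show ?thesis using vb_chart(2)[OF i] openin_open_trans by blast
qed

lemma overlap_subset_range: "overlap F i j \<subseteq> chart_range F i"
  by (auto simp: overlap_def chart_range_def)

lemma bundle_pointE: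
  assumes i: "i \<in> charts F" and x: "x \<in> overlap F i j"
  obtains z where "z \<in> bdom F i" "z \<in> bdom F j" "bchart F i z = (x, w)" "chart F i (proj F z) = x"
proof -
  from x obtain p where p: "p \<in> dom F i" "p \<in> dom F j" "x = chart F i p" by (rule overlapE)
  obtain z where z: "z \<in> bdom F i" "bchart F i z = (x, w)" "chart F i (proj F z) = x"
    using chart_pointE[OF i, of x w] x overlap_subset_range by blast
  then have "proj F z = p" using chart_inj[OF i] p unfolding bdom_def inj_on_def by blast
  then have "z \<in> bdom F j" using z p by (auto simp: bdom_def)
  with z that show thesis by blast
qed

lemma base_tr_refl: "i \<in> charts F \<Longrightarrow> x \<in> overlap F i i \<Longrightarrow> base_tr F i i x = x"
  by (erule overlapE) (simp add: base_tr_chart)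

lemma overlap_base_tr:
  assumes "i \<in> charts F" "j \<in> charts F" "x \<in> overlap F i j"
  shows "base_tr F i j x \<in> overlap F j l \<longleftrightarrow> x \<in> overlap F i l"
  using assms(3) by (rule overlapE) (use assms(1,2) in \<open>simp add: base_tr_chart overlap_chart\<close>)

lemma base_tr_trans:
  assumes "i \<in> charts F" "j \<in> charts F" "x \<in> overlap F i j"
  shows "base_tr F j l (base_tr F i j x) = base_tr F i l x"
  using assms(3) by (rule overlapE) (use assms(1,2) in \<open>simp add: base_tr_chart\<close>)

lemma vector_bundle_transition_system: "transition_system F"
proof (intro transition_system.intro typical_fiber.intro transition_system_axioms.intro)
  show "topological_module (scV F)" "topological_module (scW F)" by (fact vb_topological)+
  fix i j l x w assume i: "i \<in> charts F" and j: "j \<in> charts F"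
  show "open (overlap F i j)" by (rule overlap_open[OF i j])
  show "smooth (mV F) (mV F) (overlap F i j) (base_tr F i j)"
    "smooth (mF F) (mF F) (overlap F i j \<times> UNIV) (total_tr F i j)" by (fact vb_tr(1,2)[OF i j])+
  show "module_hom (scW F) (scW F) (\<lambda>w. snd (total_tr F i j (x, w)))" if "x \<in> overlap F i j"
    by (rule vb_tr(3)[OF i j that])
  show "base_tr F i i x = x" if "x \<in> overlap F i i" by (rule base_tr_refl[OF i that])
  show "base_tr F i j x \<in> overlap F j l \<longleftrightarrow> x \<in> overlap F i l" if "x \<in> overlap F i j"
    by (rule overlap_base_tr[OF i j that])
  show "base_tr F j l (base_tr F i j x) = base_tr F i l x" if "x \<in> overlap F i j"
    by (rule base_tr_trans[OF i j that])
  show "fst (total_tr F i j (x, w)) = base_tr F i j x" if x: "x \<in> overlap F i j"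
  proof -
    obtain z where z: "z \<in> bdom F i" "z \<in> bdom F j" "bchart F i z = (x, w)" "chart F i (proj F z) = x"
      by (rule bundle_pointE[OF i x])
    then show ?thesis
      using total_tr_bchart[OF i z(1), of j] vb_chart(5)[OF j z(2)] base_tr_chart[OF i, of "proj F z" j]
      by (auto simp: bdom_def)
  qed
  show "total_tr F i i (x, w) = (x, w)" if x: "x \<in> overlap F i i"
  proof -
    obtain z where z: "z \<in> bdom F i" "z \<in> bdom F i" "bchart F i z = (x, w)" "chart F i (proj F z) = x"
      by (rule bundle_pointE[OF i x])
    then show ?thesis using total_tr_bchart[OF i z(1), of i] by simp
  qed
  show "total_tr F j l (total_tr F i j (x, w)) = total_tr F i l (x, w)" if x: "x \<in> overlap F i j"
  proof -
    obtain z where z: "z \<in> bdom F i" "z \<in> bdom F j" "bchart F i z = (x, w)" "chart F i (proj F z) = x"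
      by (rule bundle_pointE[OF i x])
    then show ?thesis using total_tr_bchart[OF i z(1)] total_tr_bchart[OF j z(2)] by metis
  qed
qed

interpretation ts: transition_system F
  by (rule vector_bundle_transition_system)

subsection \<open>The tangent bundle\<close>

abbreviation "TM \<equiv> tangent_bundle F"

lemma TM_simps:
  "scV TM = scV F" "scW TM = scV F" "charts TM = charts F" "dom TM = dom F" "chart TM = chart F"
  "bchart TM = (\<lambda>i z. THE xv. (i, xv) \<in> z)"
  "overlap TM = overlap F" "chart_range TM = chart_range F" "base_tr TM = base_tr F"
  by (simp_all add: tangent_bundle_def overlap_def chart_range_def base_tr_def fun_eq_iff)

lemma mem_tvec:
  "(j, y, v') \<in> tvec F i (x, v) \<longleftrightarrow> j \<in> charts F \<and> x \<in> overlap F i j \<and> y = base_tr F i j x \<and> v' = ts.dbase i j x v"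
  by (simp add: tvec_def ts.dbase_def)

lemma bchart_tvec:
  assumes "j \<in> charts F" "x \<in> overlap F i j"
  shows "bchart TM j (tvec F i (x, v)) = (base_tr F i j x, ts.dbase i j x v)"
  unfolding TM_simps using assms by (intro the_equality) (auto simp: mem_tvec)

lemma tvec_change_chart:
  assumes i: "i \<in> charts F" and j: "j \<in> charts F" and x: "x \<in> overlap F i j"
  shows "tvec F j (base_tr F i j x, ts.dbase i j x v) = tvec F i (x, v)"
proof -
  have "(l, y, v') \<in> tvec F j (base_tr F i j x, ts.dbase i j x v) \<longleftrightarrow> (l, y, v') \<in> tvec F i (x, v)" for l y v'
    unfolding mem_tvec
    using overlap_base_tr[OF i j x] base_tr_trans[OF i j x] ts.dbase_cocycle[OF i j _ x] by auto
  then show ?thesis by auto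
qed

lemma proj_tvec:
  assumes i: "i \<in> charts F" and p: "p \<in> dom F i"
  shows "proj TM (tvec F i (chart F i p, v)) = p"
proof -
  have "q = p" if m: "(j, y, v') \<in> tvec F i (chart F i p, v)" and q: "q \<in> dom F j" "chart F j q = y" for j y v' q
  proof -
    have j: "j \<in> charts F" and "chart F i p \<in> overlap F i j" and y: "y = base_tr F i j (chart F i p)"
      using m unfolding mem_tvec by auto
    then have "p \<in> dom F j" using overlap_chart[OF i p] by simp
    then show ?thesis using chart_inj[OF j] q y base_tr_chart[OF i p] unfolding inj_on_def by simp
  qed
  moreover have "(i, chart F i p, v) \<in> tvec F i (chart F i p, v)"
  proof -
    have "chart F i p \<in> overlap F i i" using overlap_chart[OF i p] p by simp
    then show ?thesis unfolding mem_tvec using i base_tr_refl ts.dbase_refl by simp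
  qed
  ultimately show ?thesis
    unfolding tangent_bundle_def using p by (simp, intro the_equality) blast+
qed

text \<open>The family in the definition of the tangent bundle is a topology, and the set of all tangent vectors
belongs to it.\<close>

lemma topspace_TM: "topspace (total TM) = tvecs F"
proof -
  let ?P = "\<lambda>S. S \<subseteq> tvecs F \<and> (\<forall>i\<in>charts F. open {xv \<in> chart_range F i \<times> UNIV. tvec F i xv \<in> S})"
  have "istopology ?P"
    unfolding istopology_def
  proof (intro conjI allI impI)
    fix S S' assume "?P S" "?P S'"
    then show "S \<inter> S' \<subseteq> tvecs F" by blast
    have e: "{xv \<in> chart_range F i \<times> UNIV. tvec F i xv \<in> S \<inter> S'} =
       {xv \<in> chart_range F i \<times> UNIV. tvec F i xv \<in> S} \<inter> {xv \<in> chart_range F i \<times> UNIV. tvec F i xv \<in> S'}" for i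
      by blast
    show "\<forall>i\<in>charts F. open {xv \<in> chart_range F i \<times> UNIV. tvec F i xv \<in> S \<inter> S'}"
      unfolding e using \<open>?P S\<close> \<open>?P S'\<close> by (blast intro: open_Int)
  next
    fix K assume K: "\<forall>S\<in>K. ?P S"
    then show "\<Union> K \<subseteq> tvecs F" by blast
    have e: "{xv \<in> chart_range F i \<times> UNIV. tvec F i xv \<in> \<Union> K} =
       (\<Union>S\<in>K. {xv \<in> chart_range F i \<times> UNIV. tvec F i xv \<in> S})" for i
      by blast
    show "\<forall>i\<in>charts F. open {xv \<in> chart_range F i \<times> UNIV. tvec F i xv \<in> \<Union> K}"
      unfolding e using K by (blast intro: open_UN)
  qed
  then have o: "openin (total TM) = ?P"
    unfolding tangent_bundle_def by (simp add: topology_inverse')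
  have "{xv \<in> chart_range F i \<times> UNIV. tvec F i xv \<in> tvecs F} = chart_range F i \<times> UNIV" if "i \<in> charts F" for i
    using that by (auto simp: tvecs_def)
  then have "?P (tvecs F)" using vb_chart(2) by (auto intro: open_Times)
  then show ?thesis unfolding topspace_def o by blast
qed

lemma tvec_bdom:
  assumes i: "i \<in> charts F" and x: "x \<in> overlap F i j"
  shows "tvec F i (x, v) \<in> bdom TM j"
proof -
  from x obtain p where p: "p \<in> dom F i" "p \<in> dom F j" "x = chart F i p" by (rule overlapE)
  have "tvec F i (x, v) \<in> tvecs F"
    using i x overlap_subset_range unfolding tvecs_def by blast
  then show ?thesis
    unfolding bdom_def topspace_TM using proj_tvec[OF i p(1)] p by (simp add: TM_simps)
qed

lemma bdom_TM:
  assumes i: "i \<in> charts F" and z: "z \<in> bdom TM i"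
  obtains x v where "x \<in> chart_range F i" "z = tvec F i (x, v)"
proof -
  obtain j x v where j: "j \<in> charts F" "x \<in> chart_range F j" "z = tvec F j (x, v)"
    using z unfolding bdom_def topspace_TM tvecs_def by blast
  then obtain p where p: "p \<in> dom F j" "x = chart F j p" by (auto simp: chart_range_def)
  have "p \<in> dom F i" using z j p proj_tvec[OF j(1) p(1)] by (simp add: bdom_def TM_simps)
  then have x: "x \<in> overlap F j i" using p by (auto simp: overlap_def)
  have "base_tr F j i x \<in> chart_range F i"
    using overlap_base_tr[OF j(1) i x, of j] overlap_subset_range j(2)
    by (auto simp: overlap_def chart_range_def)
  then show thesis using that tvec_change_chart[OF j(1) i x] j(3) by metis
qed

text \<open>A tangent vector at a point of \<open>dom F i\<close> has exactly one representative in the chart \<open>i\<close>, so the bundle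
charts of the tangent bundle are injective and their changes can be read off the representatives.\<close>

lemma total_tr_TM:
  assumes i: "i \<in> charts F" and j: "j \<in> charts F" and x: "x \<in> overlap F i j"
  shows "total_tr TM i j (x, v) = (base_tr F i j x, ts.dbase i j x v)"
proof -
  have self: "y \<in> overlap F i i" if "y \<in> chart_range F i" for y
    using that by (simp add: ts.overlap_self)
  have b: "bchart TM i (tvec F i (y, v)) = (y, v)" if "y \<in> chart_range F i" for y v
    using bchart_tvec[OF i self[OF that]] base_tr_refl[OF i self[OF that]] ts.dbase_refl[OF i self[OF that]] by simp
  have "inj_on (bchart TM i) (bdom TM i)"
  proof (rule inj_onI)
    fix z z' assume z: "z \<in> bdom TM i" "z' \<in> bdom TM i" "bchart TM i z = bchart TM i z'"
    obtain y v where 1: "y \<in> chart_range F i" "z = tvec F i (y, v)" by (rule bdom_TM[OF i z(1)])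
    obtain y' v' where 2: "y' \<in> chart_range F i" "z' = tvec F i (y', v')" by (rule bdom_TM[OF i z(2)])
    show "z = z'" using z(3) b 1 2 by simp
  qed
  have xr: "x \<in> chart_range F i" using x overlap_subset_range by blast
  have "inv_into (bdom TM i) (bchart TM i) (bchart TM i (tvec F i (x, v))) = tvec F i (x, v)"
    by (rule inv_into_f_f[OF \<open>inj_on _ _\<close> tvec_bdom[OF i self[OF xr]]])
  then show ?thesis
    using bchart_tvec[OF j x] by (simp add: total_tr_def b[OF xr])
qed

lemma tangent_transition_system: "transition_system TM"
proof (intro transition_system.intro typical_fiber.intro transition_system_axioms.intro)
  show "topological_module (scV TM)" "topological_module (scW TM)"
    unfolding TM_simps by (rule vb_topological(1))+
  fix i j l x w assume i: "i \<in> charts TM" and j: "j \<in> charts TM"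
  note i' = i[unfolded TM_simps] and j' = j[unfolded TM_simps]
  show "open (overlap TM i j)" unfolding TM_simps by (rule overlap_open[OF i' j'])
  show "smooth (mV TM) (mV TM) (overlap TM i j) (base_tr TM i j)"
    unfolding TM_simps by (rule vb_tr(1)[OF i' j'])
  show "smooth (mF TM) (mF TM) (overlap TM i j \<times> UNIV) (total_tr TM i j)"
    unfolding TM_simps
    by (rule smooth_cong[OF ts.tangent_tr_smooth[OF i' j']]) (auto simp: total_tr_TM[OF i' j'] ts.tangent_tr_def)
  show "fst (total_tr TM i j (x, w)) = base_tr TM i j x" if "x \<in> overlap TM i j"
    using total_tr_TM[OF i' j'] that unfolding TM_simps by simp
  show "module_hom (scW TM) (scW TM) (\<lambda>w. snd (total_tr TM i j (x, w)))" if "x \<in> overlap TM i j"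
    using ts.dbase_hom[OF i' j'] total_tr_TM[OF i' j'] that unfolding TM_simps by simp
  show "base_tr TM i i x = x" if "x \<in> overlap TM i i"
    using base_tr_refl[OF i'] that unfolding TM_simps by simp
  show "total_tr TM i i (x, w) = (x, w)" if "x \<in> overlap TM i i"
    using total_tr_TM[OF i' i'] base_tr_refl[OF i'] ts.dbase_refl[OF i'] that unfolding TM_simps by simp
  show "base_tr TM i j x \<in> overlap TM j l \<longleftrightarrow> x \<in> overlap TM i l" if "x \<in> overlap TM i j"
    using overlap_base_tr[OF i' j'] that unfolding TM_simps by simp
  show "base_tr TM j l (base_tr TM i j x) = base_tr TM i l x" if "x \<in> overlap TM i j"
    using base_tr_trans[OF i' j'] that unfolding TM_simps by simp
  assume l: "l \<in> charts TM"
  note l' = l[unfolded TM_simps]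
  show "total_tr TM j l (total_tr TM i j (x, w)) = total_tr TM i l (x, w)"
    if x: "x \<in> overlap TM i j" "x \<in> overlap TM i l"
    using total_tr_TM[OF i' j'] total_tr_TM[OF j' l'] total_tr_TM[OF i' l'] x overlap_base_tr[OF i' j']
      base_tr_trans[OF i' j'] ts.dbase_cocycle[OF i' j' l'] unfolding TM_simps by simp
qed

end

section \<open>The splitting maps in a chart\<close>

text \<open>The inverse of the splitting map in a chart: changing the signs of the Christoffel tensors inverts the correction,
and tangent maps of inverse maps are inverse to each other.\<close>

primrec Phi_inv ::
  "('k::base_ring, 'v::{topological_ab_group_add, t2_space}, 'w::{topological_ab_group_add, t2_space},
    'm, 'f, 'i) vbundle \<Rightarrow> 'i \<Rightarrow> ('v \<Rightarrow> 'w \<Rightarrow> 'v \<Rightarrow> 'w) \<Rightarrow> ('v \<Rightarrow> 'v \<Rightarrow> 'v \<Rightarrow> 'v) \<Rightarrow> nat \<Rightarrow>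
    ('v, 'w) multi \<Rightarrow> ('v, 'w) multi" where
  "Phi_inv B i b c 0 = id"
| "Phi_inv B i b c (Suc k) =
     correct (\<lambda>x w v. - b x w v) (\<lambda>x v v'. - c x v v') (Suc k)
       \<circ> T_map B k (multi_over B k (chart_range B i)) (Phi_inv B i b c k)"

lemma lo_correct: "lo n (correct b c n u) = lo n u"
  by (simp add: lo_def correct_def Let_def fun_eq_iff)

lemma correct_empty [simp]: "correct b c n u {} = u {}"
  by (simp add: correct_def Let_def)

text \<open>The coefficient of $\varepsilon^\beta\varepsilon_n$ after the correction, as a function of the
coefficients \<open>y\<close> of $\varepsilon^\beta$, \<open>z\<close> of $\varepsilon^\beta\varepsilon_n$ and \<open>e\<close> of $\varepsilon_n$.  Writing it in a
form independent of \<open>n\<close> makes the corrections for different units comparable.\<close>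

definition twist :: "('v \<Rightarrow> 'w \<Rightarrow> 'v \<Rightarrow> 'w::plus) \<Rightarrow> ('v \<Rightarrow> 'v \<Rightarrow> 'v \<Rightarrow> 'v::plus) \<Rightarrow> nat set \<Rightarrow> 'v \<Rightarrow>
    'v \<times> 'w \<Rightarrow> 'v \<times> 'w \<Rightarrow> 'v \<Rightarrow> 'v \<times> 'w" where
  "twist b c \<beta> x y z e = (if \<beta> = {} then e else fst z + c x (fst y) e, snd z + b x (snd y) e)"

lemma hi_correct:
  "n \<notin> \<beta> \<Longrightarrow> hi n (correct b c n u) \<beta> = twist b c \<beta> (fst (u {})) (u \<beta>) (hi n u \<beta>) (fst (hi n u {}))"
  by (auto simp: hi_def correct_def Let_def twist_def)

text \<open>What the splitting maps in one chart depend on.  The vanishing at \<open>0\<close>, a consequence of the linearity of the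
Christoffel tensors, keeps the corrected families supported in \<open>{1..n}\<close>.\<close>

locale christoffel_chart = typical_fiber B
  for B :: "('k::base_ring, 'v::{topological_ab_group_add, t2_space},
      'w::{topological_ab_group_add, t2_space}, 'm, 'f, 'i) vbundle" +
  fixes i :: 'i and b :: "'v \<Rightarrow> 'w \<Rightarrow> 'v \<Rightarrow> 'w" and c :: "'v \<Rightarrow> 'v \<Rightarrow> 'v \<Rightarrow> 'v"
  assumes open_range: "open (chart_range B i)"
    and b_zero: "x \<in> chart_range B i \<Longrightarrow> b x 0 v = 0"
    and c_zero: "x \<in> chart_range B i \<Longrightarrow> c x 0 v = 0"
    and b_smooth: "smooth (prod_mod (mV B) (prod_mod (mW B) (mV B))) (mW B) (chart_range B i \<times> UNIV \<times> UNIV)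
       (\<lambda>(x, w, v). b x w v)"
    and c_smooth: "smooth (prod_mod (mV B) (prod_mod (mV B) (mV B))) (mV B) (chart_range B i \<times> UNIV \<times> UNIV)
       (\<lambda>(x, w, v). c x w v)"
begin

abbreviation "N \<equiv> chart_range B i"
abbreviation "\<Phi> \<equiv> Phi_chart B i b c"
abbreviation "\<Psi> \<equiv> Phi_inv B i b c"

lemma correct_E:
  assumes u: "u \<in> X (Suc k) N" shows "correct b c (Suc k) u \<in> car (E (Suc k))"
proof (rule EI)
  fix \<beta> :: "nat set" assume \<beta>: "\<not> \<beta> \<subseteq> {1..Suc k}"
  have x: "fst (u {}) \<in> N" and uE: "u \<in> car (E (Suc k))" using u X_iff by blast+
  have "\<not> \<beta> - {Suc k} \<subseteq> {1..Suc k}" "\<beta> \<noteq> {Suc k}" using \<beta> by auto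
  then show "correct b c (Suc k) u \<beta> = 0"
    using E_zero[OF uE \<beta>] E_zero[OF uE, of "\<beta> - {Suc k}"] b_zero[OF x] c_zero[OF x]
    by (simp add: correct_def Let_def zero_prod_def)
qed

lemma correct_X: "u \<in> X (Suc k) N \<Longrightarrow> correct b c (Suc k) u \<in> X (Suc k) N"
  using correct_E X_iff by (simp add: X_iff del: multi_mod_simps)

lemma tlin_eval_fst: "tlin (E k) (mV B) (\<lambda>u. fst (u \<beta>))" and tlin_eval_snd: "tlin (E k) (mW B) (\<lambda>u. snd (u \<beta>))"
  using tlin_compose[OF tlin_eval tlin_fst] tlin_compose[OF tlin_eval tlin_snd] by (simp_all add: comp_def)

lemma correct_smooth: "smooth (E (Suc k)) (E (Suc k)) (X (Suc k) N) (correct b c (Suc k))"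
proof (rule smooth_multi[OF tmod_F])
  fix \<beta> :: "nat set" assume "\<beta> \<subseteq> {1..Suc k}"
  let ?A = "E (Suc k)" and ?Y = "X (Suc k) N" and ?n = "Suc k"
  note V = smooth_linear[OF tmod_E tlin_eval_fst X_car] and W = smooth_linear[OF tmod_E tlin_eval_snd X_car]
  have b: "smooth ?A (mW B) ?Y (\<lambda>u. b (fst (u {})) (snd (u \<gamma>)) (fst (u {?n})))" for \<gamma>
  proof -
    have "smooth ?A (mW B) ?Y (\<lambda>u. (\<lambda>(x, w, v). b x w v) (fst (u {}), snd (u \<gamma>), fst (u {?n})))"
      by (rule smooth_compose[OF tmod_E tmod_prod[OF tmod_V tmod_prod[OF tmod_W tmod_V]] X_car
            smooth_Pair[OF V smooth_Pair[OF W V]] b_smooth])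
        (intro image_subsetI, simp add: X_iff)
    then show ?thesis by simp
  qed
  have c: "smooth ?A (mV B) ?Y (\<lambda>u. c (fst (u {})) (fst (u \<gamma>)) (fst (u {?n})))" for \<gamma>
  proof -
    have "smooth ?A (mV B) ?Y (\<lambda>u. (\<lambda>(x, w, v). c x w v) (fst (u {}), fst (u \<gamma>), fst (u {?n})))"
      by (rule smooth_compose[OF tmod_E tmod_prod[OF tmod_V tmod_prod[OF tmod_V tmod_V]] X_car
            smooth_Pair[OF V smooth_Pair[OF V V]] c_smooth])
        (intro image_subsetI, simp add: X_iff)
    then show ?thesis by simp
  qed
  consider "?n \<notin> \<beta>" | "\<beta> = {?n}" | "?n \<in> \<beta>" "\<beta> \<noteq> {?n}" by blast
  then show "smooth ?A (mF B) ?Y (\<lambda>u. correct b c ?n u \<beta>)"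
  proof cases
    case 1
    then show ?thesis using smooth_linear[OF tmod_E tlin_eval X_car] by (simp add: correct_def Let_def)
  next
    case 2
    show ?thesis
      using smooth_Pair[OF V[of _ _ "{?n}"] smooth_add[OF tmod_E tmod_W X_car W[of _ _ "{?n}"] b[of "{}"]]]
      by (simp add: correct_def Let_def 2)
  next
    case 3
    then show ?thesis
      using smooth_Pair[OF smooth_add[OF tmod_E tmod_V X_car V[of _ _ \<beta>] c[of "\<beta> - {?n}"]]
          smooth_add[OF tmod_E tmod_W X_car W[of _ _ \<beta>] b[of "\<beta> - {?n}"]]]
      by (simp add: correct_def Let_def)
  qed
qed (rule E_zero[OF correct_E])

text \<open>For \<open>k = 0\<close> the shear which defines $\Phi_1$ is the correction for $\varepsilon_1$, so that
  $\Phi_1 = T(\mathrm{id}) \circ K_1$ and the recursion can be started at \<open>0\<close>.\<close>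

lemma Phi_Suc:
  assumes u: "u \<in> X (Suc k) N"
  shows "\<Phi> (Suc k) u = T k N (\<Phi> k) (correct b c (Suc k) u)"
proof (cases k)
  case 0
  have x: "fst (u {}) \<in> N" and uE: "u \<in> car (E (Suc 0))" using u X_iff 0 by blast+
  have "correct b c (Suc 0) u \<beta> = shear b u \<beta>" for \<beta>
  proof (cases "Suc 0 \<in> \<beta> \<and> \<beta> \<noteq> {Suc 0}")
    case True
    then have n: "\<not> \<beta> \<subseteq> {1..Suc 0}" "\<not> \<beta> - {Suc 0} \<subseteq> {1..Suc 0}" by auto
    show ?thesis
      using True E_zero[OF uE n(1)] E_zero[OF uE n(2)] b_zero[OF x] c_zero[OF x]
      by (simp add: correct_def shear_def Let_def zero_prod_def)
  next
    case False
    then consider "\<beta> = {Suc 0}" | "Suc 0 \<notin> \<beta>" by blast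
    then show ?thesis
      by cases (simp_all add: correct_def shear_def Let_def, auto)
  qed
  then have "correct b c (Suc 0) u = shear b u" ..
  then show ?thesis
    using T_id[OF open_range, of 0 "\<Phi> 0" "correct b c (Suc 0) u"] correct_X[OF u] 0 by simp
qed simp

lemma Phi_props:
  "smooth (E k) (E k) (X k N) (\<Phi> k) \<and> (\<forall>u\<in>X k N. fst (\<Phi> k u {}) = fst (u {}))"
proof (induction k)
  case 0
  have "smooth (E 0) (E 0) (X 0 N) (\<lambda>u. u)" by (rule smooth_linear[OF tmod_E tlin_id X_car])
  then show ?case by (simp add: id_def)
next
  case (Suc k)
  have s: "smooth (E k) (E k) (X k N) (\<Phi> k)" using Suc by blast
  have "smooth (E (Suc k)) (E (Suc k)) (X (Suc k) N) (\<lambda>u. T k N (\<Phi> k) (correct b c (Suc k) u))"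
    by (rule smooth_compose[OF tmod_E tmod_E X_car correct_smooth T_smooth[OF open_range s]])
      (use correct_X in blast)
  then have "smooth (E (Suc k)) (E (Suc k)) (X (Suc k) N) (\<Phi> (Suc k))"
    by (rule smooth_cong) (simp only: Phi_Suc)
  moreover have "fst (\<Phi> (Suc k) u {}) = fst (u {})" if u: "u \<in> X (Suc k) N" for u
    using Suc lo_X[OF correct_X[OF u]] Phi_Suc[OF u] by (simp add: T_empty)
  ultimately show ?case by blast
qed

lemma Phi_smooth: "smooth (E k) (E k) (X k N) (\<Phi> k)"
  using Phi_props by blast

lemma Phi_base: "u \<in> X k N \<Longrightarrow> fst (\<Phi> k u {}) = fst (u {})"
  using Phi_props by blast

lemma Phi_X: "u \<in> X k N \<Longrightarrow> \<Phi> k u \<in> X k N"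
  using smooth_maps[OF Phi_smooth] Phi_base X_iff by (metis (no_types, lifting))

text \<open>The correction for $\varepsilon_m$ leaves the coefficients without $\varepsilon_m$ alone.  Hence its tangent map
  does not change the coefficients of $\varepsilon^\alpha\varepsilon_n$ with $\alpha$ not involving
  $\varepsilon_m$, where \<open>m = k + 1\<close>, \<open>n = k + 2\<close>.\<close>

lemma lo_hi_T_correct:
  assumes v: "v \<in> X (Suc (Suc k)) N"
  shows "lo (Suc k) (hi (Suc (Suc k)) (T (Suc k) N (correct b c (Suc k)) v)) = lo (Suc k) (hi (Suc (Suc k)) v)"
proof -
  have vE: "v \<in> car (E (Suc (Suc k)))" using v X_iff by blast
  note lh = lo_X[OF v] hi_car[OF vE]
  let ?a = "lo (Suc (Suc k)) v" and ?b = "hi (Suc (Suc k)) v"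
  have "lo (Suc k) (hi (Suc (Suc k)) (T (Suc k) N (correct b c (Suc k)) v)) =
      lo (Suc k) (Df (E (Suc k)) (E (Suc k)) (X (Suc k) N) (correct b c (Suc k)) ?a ?b)"
    using hi_T[OF open_range correct_smooth v] by simp
  also have "\<dots> = Df (E (Suc k)) (E k) (X (Suc k) N) (\<lambda>u. lo (Suc k) (correct b c (Suc k) u)) ?a ?b"
    using Df_compose_linear[OF tmod_E tmod_E tmod_E mod_open_X[OF open_range] smooth_XD[OF correct_smooth] tlin_lo lh]
    by simp
  also have "\<dots> = lo (Suc k) ?b"
    unfolding lo_correct by (rule Df_linear[OF tmod_E tmod_E mod_open_X[OF open_range] tlin_lo lh])
  finally show ?thesis .
qed

lemma T_correct_X: "v \<in> X (Suc (Suc k)) N \<Longrightarrow> T (Suc k) N (correct b c (Suc k)) v \<in> X (Suc (Suc k)) N"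
  by (rule T_maps[OF open_range correct_smooth]) (use correct_X in blast)

lemma lo_T_correct:
  "v \<in> X (Suc (Suc k)) N \<Longrightarrow> lo (Suc (Suc k)) (T (Suc k) N (correct b c (Suc k)) v) =
     correct b c (Suc k) (lo (Suc (Suc k)) v)"
  by (rule lo_T[OF open_range correct_smooth])

lemma hi_correct_lo:
  assumes v: "v \<in> X (Suc (Suc k)) N" and sw: "swap_fixed k v"
    and \<beta>: "Suc k \<notin> \<beta>" "Suc (Suc k) \<notin> \<beta>"
  shows "hi (Suc k) (correct b c (Suc k) (lo (Suc (Suc k)) v)) \<beta> =
    twist b c \<beta> (fst (v {})) (v \<beta>) (hi (Suc (Suc k)) v \<beta>) (fst (hi (Suc (Suc k)) v {}))"
proof -
  have "hi (Suc k) (lo (Suc (Suc k)) v) \<beta> = hi (Suc (Suc k)) v \<beta>"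
    "hi (Suc k) (lo (Suc (Suc k)) v) {} = hi (Suc (Suc k)) v {}"
    unfolding sw using \<beta> by (simp_all add: lo_def)
  then show ?thesis unfolding hi_correct[OF \<beta>(1)] using \<beta>(2) by (simp add: lo_def)
qed

lemma swap_from_coordinates:
  assumes "w \<in> car (E (Suc (Suc k)))"
    and "\<And>\<beta>. \<beta> \<subseteq> {1..k} \<Longrightarrow> hi (Suc k) (lo (Suc (Suc k)) w) \<beta> = lo (Suc k) (hi (Suc (Suc k)) w) \<beta>"
  shows "swap_fixed k w"
proof
  fix \<beta>
  have "hi (Suc k) (lo (Suc (Suc k)) w) \<in> car (E k)" "lo (Suc k) (hi (Suc (Suc k)) w) \<in> car (E k)"
    by (intro hi_car lo_car assms(1))+
  then show "hi (Suc k) (lo (Suc (Suc k)) w) \<beta> = lo (Suc k) (hi (Suc (Suc k)) w) \<beta>"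
    using E_zero assms(2) by (cases "\<beta> \<subseteq> {1..k}") metis+
qed

text \<open>Let $\beta$ involve neither unit.  The coefficient of $\varepsilon^\beta\varepsilon_m$ is changed only by the tangent
map of the correction for $\varepsilon_m$ and that of $\varepsilon^\beta\varepsilon_n$ only by the correction for
$\varepsilon_n$, in both cases by the same \<open>twist\<close>.\<close>

lemma swap_T_correct_correct:
  assumes u: "u \<in> X (Suc (Suc k)) N"
    and sw: "swap_fixed k u"
  defines "y \<equiv> T (Suc k) N (correct b c (Suc k)) (correct b c (Suc (Suc k)) u)"
  shows "swap_fixed k y"
proof (rule swap_from_coordinates)
  note cu = correct_X[OF u]
  show "y \<in> car (E (Suc (Suc k)))" using T_correct_X[OF cu] X_iff unfolding y_def by blast
  fix \<beta> assume "\<beta> \<subseteq> {1..k}"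
  then have \<beta>: "Suc k \<notin> \<beta>" "Suc (Suc k) \<notin> \<beta>" by auto
  have "hi (Suc k) (lo (Suc (Suc k)) y) \<beta> = hi (Suc k) (correct b c (Suc k) (lo (Suc (Suc k)) u)) \<beta>"
    unfolding y_def lo_T_correct[OF cu] lo_correct ..
  also have "\<dots> = hi (Suc (Suc k)) (correct b c (Suc (Suc k)) u) \<beta>"
    unfolding hi_correct_lo[OF u sw \<beta>] hi_correct[OF \<beta>(2)] ..
  also have "\<dots> = lo (Suc k) (hi (Suc (Suc k)) y) \<beta>"
    unfolding y_def lo_hi_T_correct[OF cu] using \<beta> by (simp add: lo_def)
  finally show "hi (Suc k) (lo (Suc (Suc k)) y) \<beta> = lo (Suc k) (hi (Suc (Suc k)) y) \<beta>" .
qed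

text \<open>The same for the composition in the opposite order, which occurs in the inverse of the splitting map.\<close>

lemma swap_correct_T_correct:
  assumes y: "y \<in> X (Suc (Suc k)) N"
    and sw: "swap_fixed k y"
  defines "u \<equiv> correct b c (Suc (Suc k)) (T (Suc k) N (correct b c (Suc k)) y)"
  shows "swap_fixed k u"
proof (rule swap_from_coordinates)
  let ?u' = "T (Suc k) N (correct b c (Suc k)) y"
  note u' = T_correct_X[OF y]
  show "u \<in> car (E (Suc (Suc k)))" using correct_X[OF u'] X_iff unfolding u_def by blast
  fix \<beta> assume "\<beta> \<subseteq> {1..k}"
  then have \<beta>: "Suc k \<notin> \<beta>" "Suc (Suc k) \<notin> \<beta>" by auto
  have 1: "?u' \<gamma> = y \<gamma> \<and> hi (Suc (Suc k)) ?u' \<gamma> = hi (Suc (Suc k)) y \<gamma>"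
    if "Suc k \<notin> \<gamma>" "Suc (Suc k) \<notin> \<gamma>" for \<gamma>
  proof -
    have "?u' \<gamma> = lo (Suc k) (lo (Suc (Suc k)) ?u') \<gamma>" using that by (simp add: lo_def)
    also have "\<dots> = y \<gamma>" unfolding lo_T_correct[OF y] lo_correct using that by (simp add: lo_def)
    finally have "?u' \<gamma> = y \<gamma>" .
    moreover have "hi (Suc (Suc k)) ?u' \<gamma> = hi (Suc (Suc k)) y \<gamma>"
      using fun_cong[OF lo_hi_T_correct[OF y], of \<gamma>] that by (simp add: lo_def)
    ultimately show ?thesis by blast
  qed
  have "hi (Suc k) (lo (Suc (Suc k)) u) \<beta> = hi (Suc k) (correct b c (Suc k) (lo (Suc (Suc k)) y)) \<beta>"
    unfolding u_def lo_correct lo_T_correct[OF y] ..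
  also have "\<dots> = twist b c \<beta> (fst (?u' {})) (?u' \<beta>) (hi (Suc (Suc k)) ?u' \<beta>) (fst (hi (Suc (Suc k)) ?u' {}))"
    unfolding hi_correct_lo[OF y sw \<beta>] using 1[OF \<beta>] 1[of "{}"] by simp
  also have "\<dots> = lo (Suc k) (hi (Suc (Suc k)) u) \<beta>"
    unfolding u_def using \<beta> hi_correct[OF \<beta>(2), of b c ?u'] by (simp add: lo_def)
  finally show "hi (Suc k) (lo (Suc (Suc k)) u) \<beta> = lo (Suc k) (hi (Suc (Suc k)) u) \<beta>" .
qed

lemma correct_sym_parts:
  assumes u: "u \<in> X (Suc k) N" and s: "symmetric_upto k (lo (Suc k) u)" "symmetric_upto k (hi (Suc k) u)"
  shows "symmetric_upto k (lo (Suc k) (correct b c (Suc k) u))" "symmetric_upto k (hi (Suc k) (correct b c (Suc k) u))"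
proof -
  show "symmetric_upto k (lo (Suc k) (correct b c (Suc k) u))" unfolding lo_correct by (rule s(1))
  show "symmetric_upto k (hi (Suc k) (correct b c (Suc k) u))" unfolding symmetric_upto_def
  proof (intro allI impI)
    fix \<beta> \<beta>' assume b: "\<beta> \<subseteq> {1..k}" "\<beta>' \<subseteq> {1..k}" "card \<beta> = card \<beta>'"
    then have n: "Suc k \<notin> \<beta>" "Suc k \<notin> \<beta>'" by auto
    have "finite \<beta>" "finite \<beta>'" using b finite_subset[OF _ finite_atLeastAtMost] by blast+
    then have e: "(\<beta> = {}) = (\<beta>' = {})" using b(3) card_0_eq[of \<beta>] card_0_eq[of \<beta>'] by simp
    have "hi (Suc k) u \<beta> = hi (Suc k) u \<beta>'" "lo (Suc k) u \<beta> = lo (Suc k) u \<beta>'"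
      by (rule symD[OF s(2) b] symD[OF s(1) b])+
    then have h: "hi (Suc k) u \<beta> = hi (Suc k) u \<beta>'" "u \<beta> = u \<beta>'" using n by (simp_all add: lo_def)
    show "hi (Suc k) (correct b c (Suc k) u) \<beta> = hi (Suc k) (correct b c (Suc k) u) \<beta>'"
      unfolding hi_correct[OF n(1)] hi_correct[OF n(2)] h(1) h(2) twist_def e ..
  qed
qed

text \<open>The parts of $\Phi_n(u) = T\Phi_m(K_n u)$ are symmetric by induction; invariance under the exchange of the last two
units is seen from $\Phi_n = TT\Phi_k \circ TK_m \circ K_n$.\<close>

lemma Phi_symmetric: "u \<in> X k N \<Longrightarrow> symmetric_upto k u \<Longrightarrow> symmetric_upto k (\<Phi> k u)"
proof (induction k arbitrary: u)
  case 0
  show ?case by (rule sym_small) simp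
next
  case (Suc m)
  show ?case
  proof (cases m)
    case 0
    then show ?thesis by (intro sym_small) simp
  next
    case (Suc k)
    let ?m = "Suc k" and ?n = "Suc (Suc k)"
    have u: "u \<in> X ?n N" and su: "symmetric_upto ?n u" using Suc.prems Suc by simp_all
    have uE: "u \<in> car (E ?n)" using u X_iff by blast
    note p = su[unfolded sym_iff_parts[OF uE]]
    note cu = correct_X[OF u]
    note cs = correct_sym_parts[OF u conjunct1[OF p] conjunct1[OF conjunct2[OF p]]]
    have e: "\<Phi> ?n u = T ?m N (\<Phi> ?m) (correct b c ?n u)" by (rule Phi_Suc[OF u])
    have 1: "symmetric_upto ?m (lo ?n (\<Phi> ?n u))" "symmetric_upto ?m (hi ?n (\<Phi> ?n u))"
      unfolding e by (rule T_sym_parts[OF open_range Phi_smooth _ cu cs]; use Suc.IH Suc in blast)+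
    have "\<Phi> ?n u = T ?m N (\<lambda>v. T k N (\<Phi> k) (correct b c ?m v)) (correct b c ?n u)"
      unfolding e
      by (rule T_cong[OF open_range open_range order_refl _ Phi_Suc cu])
        (rule smooth_compose[OF tmod_E tmod_E X_car correct_smooth T_smooth[OF open_range Phi_smooth]],
          use correct_X in blast)
    also have "\<dots> = T ?m N (T k N (\<Phi> k)) (T ?m N (correct b c ?m) (correct b c ?n u))"
      by (rule T_compose[OF open_range open_range correct_smooth T_smooth[OF open_range Phi_smooth] _ cu])
        (use correct_X in blast)
    finally have "swap_fixed k (\<Phi> ?n u)"
      using TT_swap[OF open_range Phi_smooth T_correct_X[OF cu] swap_T_correct_correct[OF u]] p by simp
    moreover have "\<Phi> ?n u \<in> car (E ?n)" using Phi_X[OF u] X_iff by blast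
    ultimately have "symmetric_upto ?n (\<Phi> ?n u)" using 1 sym_iff_parts by blast
    then show ?thesis using Suc by simp
  qed
qed

subsection \<open>The inverse of the splitting map\<close>

lemma christoffel_chart_neg: "christoffel_chart B i (\<lambda>x w v. - b x w v) (\<lambda>x v v'. - c x v v')"
proof unfold_locales
  have "smooth (prod_mod (mV B) (prod_mod (mW B) (mV B))) (mW B) (N \<times> UNIV \<times> UNIV) (\<lambda>z. - (\<lambda>(x, w, v). b x w v) z)"
    by (rule smooth_compose_linear[OF _ tmod_W _ b_smooth tlin_uminus[OF tmod_W]])
      (auto intro: tmod_prod tmod_V tmod_W)
  then show "smooth (prod_mod (mV B) (prod_mod (mW B) (mV B))) (mW B) (N \<times> UNIV \<times> UNIV) (\<lambda>(x, w, v). - b x w v)"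
    by (simp add: split_beta')
  have "smooth (prod_mod (mV B) (prod_mod (mV B) (mV B))) (mV B) (N \<times> UNIV \<times> UNIV) (\<lambda>z. - (\<lambda>(x, w, v). c x w v) z)"
    by (rule smooth_compose_linear[OF _ tmod_V _ c_smooth tlin_uminus[OF tmod_V]])
      (auto intro: tmod_prod tmod_V)
  then show "smooth (prod_mod (mV B) (prod_mod (mV B) (mV B))) (mV B) (N \<times> UNIV \<times> UNIV) (\<lambda>(x, w, v). - c x w v)"
    by (simp add: split_beta')
qed (use open_range b_zero c_zero in auto)

interpretation neg: christoffel_chart B i "\<lambda>x w v. - b x w v" "\<lambda>x v v'. - c x v v'"
  by (rule christoffel_chart_neg)

abbreviation "uncorrect \<equiv> correct (\<lambda>x w v. - b x w v) (\<lambda>x v v'. - c x v v')"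

lemma uncorrect_correct: "n \<noteq> 0 \<Longrightarrow> uncorrect n (correct b c n u) = u" "n \<noteq> 0 \<Longrightarrow> correct b c n (uncorrect n u) = u"
  by (auto simp: correct_def Let_def fun_eq_iff prod_eq_iff)

lemma inv_props:
  "smooth (E k) (E k) (X k N) (\<Psi> k) \<and> (\<forall>u\<in>X k N. fst (\<Psi> k u {}) = fst (u {}))"
proof (induction k)
  case 0
  have "smooth (E 0) (E 0) (X 0 N) (\<lambda>u. u)" by (rule smooth_linear[OF tmod_E tlin_id X_car])
  then show ?case by (simp add: id_def)
next
  case (Suc k)
  have s: "smooth (E k) (E k) (X k N) (\<Psi> k)" and m: "\<Psi> k ` X k N \<subseteq> X k N"
    using Suc smooth_maps[of "E k" "E k" "X k N" "\<Psi> k"] X_iff by (blast, metis (no_types, lifting) image_subsetI)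
  have TX: "T k N (\<Psi> k) ` X (Suc k) N \<subseteq> X (Suc k) N"
    using T_maps[OF open_range s m] by blast
  have "smooth (E (Suc k)) (E (Suc k)) (X (Suc k) N) (\<lambda>u. uncorrect (Suc k) (T k N (\<Psi> k) u))"
    by (rule smooth_compose[OF tmod_E tmod_E X_car T_smooth[OF open_range s] neg.correct_smooth TX])
  moreover have "fst (\<Psi> (Suc k) u {}) = fst (u {})" if u: "u \<in> X (Suc k) N" for u
    using Suc lo_X[OF u] by (simp add: T_empty)
  ultimately show ?case by (simp add: comp_def)
qed

lemma inv_smooth: "smooth (E k) (E k) (X k N) (\<Psi> k)"
  using inv_props by blast

lemma inv_base: "u \<in> X k N \<Longrightarrow> fst (\<Psi> k u {}) = fst (u {})"
  using inv_props by blast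

lemma inv_X: "u \<in> X k N \<Longrightarrow> \<Psi> k u \<in> X k N"
  using smooth_maps[OF inv_smooth] inv_base X_iff by (metis (no_types, lifting))

lemma inv_Phi: "u \<in> X k N \<Longrightarrow> \<Psi> k (\<Phi> k u) = u"
proof (induction k arbitrary: u)
  case (Suc k)
  note cu = correct_X[OF Suc.prems]
  have "T k N (\<Psi> k) (T k N (\<Phi> k) (correct b c (Suc k) u)) = T k N (\<lambda>u. \<Psi> k (\<Phi> k u)) (correct b c (Suc k) u)"
    by (rule T_compose[OF open_range open_range Phi_smooth inv_smooth _ cu, symmetric]) (use Phi_X in blast)
  also have "\<dots> = correct b c (Suc k) u" by (rule T_id[OF open_range Suc.IH cu])
  finally show ?case unfolding Phi_Suc[OF Suc.prems] by (simp add: uncorrect_correct)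
qed simp

lemma Phi_inv: "u \<in> X k N \<Longrightarrow> \<Phi> k (\<Psi> k u) = u"
proof (induction k arbitrary: u)
  case (Suc k)
  have "T k N (\<Phi> k) (T k N (\<Psi> k) u) = T k N (\<lambda>u. \<Phi> k (\<Psi> k u)) u"
    by (rule T_compose[OF open_range open_range inv_smooth Phi_smooth _ Suc.prems, symmetric]) (use inv_X in blast)
  also have "\<dots> = u" by (rule T_id[OF open_range Suc.IH Suc.prems])
  finally show ?case unfolding Phi_Suc[OF inv_X[OF Suc.prems]] by (simp add: uncorrect_correct)
qed simp

text \<open>As for \<open>Phi_symmetric\<close>, with $\Psi_n = K_n^{-1} \circ TK_m^{-1} \circ TT\Psi_k$.\<close>

lemma inv_symmetric: "u \<in> X k N \<Longrightarrow> symmetric_upto k u \<Longrightarrow> symmetric_upto k (\<Psi> k u)"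
proof (induction k arbitrary: u)
  case 0
  show ?case by (rule sym_small) simp
next
  case (Suc m)
  show ?case
  proof (cases m)
    case 0
    then show ?thesis by (intro sym_small) simp
  next
    case (Suc k)
    let ?m = "Suc k" and ?n = "Suc (Suc k)"
    have u: "u \<in> X ?n N" and su: "symmetric_upto ?n u" using Suc.prems Suc by simp_all
    have uE: "u \<in> car (E ?n)" using u X_iff by blast
    note p = su[unfolded sym_iff_parts[OF uE]]
    let ?u' = "T ?m N (\<Psi> ?m) u" and ?y = "T ?m N (T k N (\<Psi> k)) u"
    have e: "\<Psi> ?n u = uncorrect ?n ?u'" by simp
    have im: "T k N (\<Psi> k) ` X ?m N \<subseteq> X ?m N" using T_maps[OF open_range inv_smooth] inv_X by blast
    have u': "?u' \<in> X ?n N" by (rule T_maps[OF open_range inv_smooth _ u]) (use inv_X in blast)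
    have y: "?y \<in> X ?n N" by (rule T_maps[OF open_range T_smooth[OF open_range inv_smooth] im u])
    have s': "symmetric_upto ?m (lo ?n ?u')" "symmetric_upto ?m (hi ?n ?u')"
      by (rule T_sym_parts[OF open_range inv_smooth _ u]; use Suc.IH Suc p in blast)+
    have "\<Psi> ?m = (\<lambda>v. uncorrect ?m (T k N (\<Psi> k) v))" by (simp add: comp_def)
    then have "?u' = T ?m N (uncorrect ?m) ?y"
      using T_compose[OF open_range open_range T_smooth[OF open_range inv_smooth] neg.correct_smooth im u] by simp
    moreover have "swap_fixed k ?y"
      using TT_swap[OF open_range inv_smooth u] p by blast
    ultimately have "swap_fixed k (\<Psi> ?n u)"
      unfolding e using neg.swap_correct_T_correct[OF y] by simp
    moreover have "symmetric_upto ?m (lo ?n (\<Psi> ?n u))" "symmetric_upto ?m (hi ?n (\<Psi> ?n u))"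
      unfolding e by (rule neg.correct_sym_parts[OF u' s'])+
    moreover have "\<Psi> ?n u \<in> car (E ?n)" using inv_X[OF u] X_iff by blast
    ultimately have "symmetric_upto ?n (\<Psi> ?n u)" using sym_iff_parts by blast
    then show ?thesis using Suc by simp
  qed
qed

lemma Phi_symmetric_iff:
  assumes "u \<in> X k N" shows "symmetric_upto k (\<Phi> k u) \<longleftrightarrow> symmetric_upto k u"
  using Phi_symmetric[OF assms] inv_symmetric[OF Phi_X[OF assms]] inv_Phi[OF assms] by metis

end

section \<open>Chart independence of the splitting maps\<close>

text \<open>On a line on which the map is affine the difference quotient is constant at the units.\<close>

lemma Df_affine_on_line:
  assumes A: "tmod A" and B: "tmod B" and U: "mod_open A U" and f: "diffable A B U f"
    and x: "x \<in> U" and v: "v \<in> car A"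
    and eq: "\<And>t. x + scl A t v \<in> U \<Longrightarrow> f (x + scl A t v) = f x + scl B t y"
  shows "Df A B U f x v = y"
proof -
  obtain f1 where f1: "diff_quot A B U f f1" using f by (auto simp: diffable_def)
  have xA: "x \<in> car A" using mod_open_subset[OF U] x by auto
  let ?S = "{t. x + scl A t v \<in> U}"
  have d: "(x, v, t) \<in> dq_dom A U" if "t \<in> ?S" for t using that x v by (auto intro: dq_domI)
  have "f1 (x, v, 0) = y"
  proof (rule eq_at_zero_of_units[where S = ?S and h = "\<lambda>t. f1 (x, v, t)" and h' = "\<lambda>t. y"])
    show "open ?S" by (rule mod_open_line[OF A U xA v])
    show "0 \<in> ?S" using x A by simp
    show "continuous_on ?S (\<lambda>t. f1 (x, v, t))"
      by (rule continuous_on_compose2[OF diff_quotD(3)[OF f1]],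
          intro continuous_on_Pair continuous_on_const continuous_on_id, use d in blast)
    show "f1 (x, v, t) = y" if t: "t \<in> ?S" "t dvd 1" for t
    proof (rule unit_cancel[OF B t(2)])
      have "f (x + scl A t v) = f x + scl B t y" by (rule eq) (use t(1) in simp)
      then show "scl B t (f1 (x, v, t)) = scl B t y"
        unfolding diff_quotD(4)[OF f1 d[OF t(1)], symmetric] by simp
    qed
  qed (use B in \<open>simp_all add: tmod_def continuous_on_const\<close>)
  then show ?thesis using Df_eq[OF A B U f1 x v] by simp
qed

lemma Df_precompose_linear:
  assumes "tmod A" "tmod B" "tmod C" "mod_open A U" "mod_open B U'" "tlin A B l" "diffable B C U' g"
    "l ` U \<subseteq> U'" "x \<in> U" "v \<in> car A"
  shows "Df A C U (\<lambda>x. g (l x)) x v = Df B C U' g (l x) (l v)"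
  using Df_compose[OF assms(1-5) diffable_linear[OF assms(1,6) mod_open_subset[OF assms(4)]] assms(7-10)]
    Df_linear[OF assms(1,2,4,6,9,10)] by simp

context transition_system
begin

text \<open>The point $x + \varepsilon_0 w + \varepsilon_1 v + \varepsilon_0\varepsilon_1 w'$.\<close>

definition first_order :: "'v \<Rightarrow> 'w \<Rightarrow> 'v \<Rightarrow> 'w \<Rightarrow> ('v, 'w) multi" where
  "first_order x w v w' = (\<lambda>\<beta>. if \<beta> = {} then (x, w) else if \<beta> = {1} then (v, w') else 0)"

lemma first_order_X: "x \<in> N \<Longrightarrow> first_order x w v w' \<in> X 1 N"
  by (auto simp: X_iff first_order_def)

lemma first_order_shear: "shear b (first_order x w v w') = first_order x w v (w' + b x w v)"
  by (auto simp: shear_def first_order_def fun_eq_iff)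

lemma first_order_add:
  "chart_add (first_order x w 0 0) (first_order x 0 v w') = first_order x w v w'"
  by (auto simp: chart_add_def first_order_def fun_eq_iff zero_prod_def)

lemma first_order_eqD: "first_order x w v w' = first_order y z u z' \<Longrightarrow> v = u \<and> w' = z'"
  by (drule fun_cong[of _ _ "{1}"]) (simp add: first_order_def)

abbreviation "Dtotal i j \<equiv> Df (mF B) (mF B) (overlap B i j \<times> UNIV) (total_tr B i j)"

context
  fixes i j :: 'i and x :: 'v
  assumes i: "i \<in> charts B" and j: "j \<in> charts B" and x: "x \<in> overlap B i j"
begin

lemma total_open: "mod_open (mF B) (overlap B i j \<times> UNIV)"
  by (rule mod_open_F[OF open_overlap[OF i j]])

lemma Dtotal_fst: "fst (Dtotal i j (x, w) (v, w')) = dbase i j x v"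
proof -
  let ?U = "overlap B i j \<times> (UNIV :: 'w set)"
  have in_U: "(x, w) \<in> ?U" "(v, w') \<in> car (mF B)" using x by simp_all
  note d = diffable_linear[OF tmod_F tlin_fst] base_diffable[OF i j]
  have "fst (Dtotal i j (x, w) (v, w')) = Df (mF B) (mV B) ?U (\<lambda>z. fst (total_tr B i j z)) (x, w) (v, w')"
    by (rule Df_compose_linear[OF tmod_F tmod_F tmod_V total_open total_diffable[OF i j] tlin_fst in_U, symmetric])
  also have "\<dots> = Df (mF B) (mV B) ?U (\<lambda>z. base_tr B i j (fst z)) (x, w) (v, w')"
  proof (rule Df_line_cong[OF tmod_F tmod_V total_open total_open _ _ in_U(1,1,2)])
    show "diffable (mF B) (mV B) ?U (\<lambda>z. fst (total_tr B i j z))"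
      by (rule diffable_compose[OF tmod_F tmod_F _ total_diffable[OF i j] diffable_linear[OF tmod_F tlin_fst order_refl]])
        simp_all
    show "diffable (mF B) (mV B) ?U (\<lambda>z. base_tr B i j (fst z))"
      by (rule diffable_compose[OF tmod_F tmod_V _ d]) auto
  next
    fix t assume "(x, w) + scl (mF B) t (v, w') \<in> ?U"
    then show "fst (total_tr B i j ((x, w) + scl (mF B) t (v, w'))) = base_tr B i j (fst ((x, w) + scl (mF B) t (v, w')))"
      using fst_total[OF i j] by simp
  qed
  also have "\<dots> = dbase i j (fst (x, w)) (fst (v, w'))"
    unfolding dbase_def
    by (rule Df_precompose_linear[OF tmod_F tmod_V tmod_V total_open mod_open_V[OF open_overlap[OF i j]]
          tlin_fst base_diffable[OF i j] _ in_U]) auto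
  finally show ?thesis by simp
qed

lemma snd_total_diffable: "diffable (mF B) (mW B) (overlap B i j \<times> UNIV) (\<lambda>z. snd (total_tr B i j z))"
  by (rule diffable_compose[OF tmod_F tmod_F _ total_diffable[OF i j] diffable_linear[OF tmod_F tlin_snd order_refl]])
    simp_all

text \<open>The total transition map vanishes on the zero section up to the base point and is linear on
  fibers; this determines its derivative at the points of the zero section.\<close>

lemma Dtotal_zero_section: "Dtotal i j (x, 0) (v, w') = (dbase i j x v, fib i j x w')"
proof -
  let ?U = "overlap B i j \<times> (UNIV :: 'w set)"
  have in_U: "(x, 0) \<in> ?U" using x by simp
  have s: "snd (Dtotal i j (x, 0) z) = Df (mF B) (mW B) ?U (\<lambda>z. snd (total_tr B i j z)) (x, 0) z" for z
    by (rule Df_compose_linear[OF tmod_F tmod_F tmod_W total_open total_diffable[OF i j] tlin_snd in_U, symmetric]) simp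
  have "snd (Dtotal i j (x, 0) (v, 0)) = 0"
    unfolding s
    by (rule Df_affine_on_line[OF tmod_F tmod_W total_open snd_total_diffable in_U])
      (use module_hom.zero[OF fib_hom[OF i j]] x tmod_scl(7)[OF tmod_W] in \<open>auto simp: fib_def\<close>)
  moreover have "snd (Dtotal i j (x, 0) (0, w')) = fib i j x w'"
    unfolding s
    by (rule Df_affine_on_line[OF tmod_F tmod_W total_open snd_total_diffable in_U])
      (use module_hom.zero[OF fib_hom[OF i j x]] module_hom.scale[OF fib_hom[OF i j x]] tmod_scl(7)[OF tmod_V]
        in \<open>auto simp: fib_def\<close>)
  moreover have "Dtotal i j (x, 0) ((v, 0) + (0, w')) = Dtotal i j (x, 0) (v, 0) + Dtotal i j (x, 0) (0, w')"
    by (rule Df_add[OF tmod_F tmod_F total_open total_diffable[OF i j] in_U]) simp_all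
  ultimately have "snd (Dtotal i j (x, 0) (v, w')) = fib i j x w'" by simp
  then show ?thesis using Dtotal_fst[of 0 v w'] by (simp add: prod_eq_iff)
qed

lemma T_tr_first_order:
  "T_tr B 1 i j (first_order x w v w') =
     first_order (base_tr B i j x) (fib i j x w) (fst (Dtotal i j (x, w) (v, w'))) (snd (Dtotal i j (x, w) (v, w')))"
proof
  fix \<beta> :: "nat set"
  let ?u = "first_order x w v w'" and ?N = "overlap B i j"
  have u: "?u \<in> X (Suc 0) ?N" using first_order_X[OF x] by simp
  have uE: "?u \<in> car (E (Suc 0))" using u X_iff by blast
  note lh = lo_X[OF u] hi_car[OF uE]
  note o = open_overlap[OF i j] and s = T_tr_smooth[OF i j, of 0]
  have e: "lo (Suc 0) ?u {} = (x, w)" "hi (Suc 0) ?u {} = (v, w')"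
    by (simp_all add: lo_def hi_def first_order_def)
  have "Df (E 0) (E 0) (X 0 ?N) (T_tr B 0 i j) (lo (Suc 0) ?u) (hi (Suc 0) ?u) {} =
      Df (E 0) (mF B) (X 0 ?N) (\<lambda>u. total_tr B i j (u {})) (lo (Suc 0) ?u) (hi (Suc 0) ?u)"
    using Df_coordinate[OF o s lh] by simp
  also have "\<dots> = Dtotal i j (x, w) (v, w')"
    unfolding e[symmetric]
    by (rule Df_precompose_linear[OF tmod_E tmod_F tmod_F mod_open_X[OF o] total_open tlin_eval total_diffable[OF i j] _ lh])
      (intro image_subsetI, simp add: X_iff mem_Times_iff)
  finally have D: "Df (E 0) (E 0) (X 0 ?N) (T_tr B 0 i j) (lo (Suc 0) ?u) (hi (Suc 0) ?u) {} = Dtotal i j (x, w) (v, w')" .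
  have DE: "Df (E 0) (E 0) (X 0 ?N) (T_tr B 0 i j) (lo (Suc 0) ?u) (hi (Suc 0) ?u) \<in> car (E 0)"
    by (rule Df_E_car[OF o s lh])
  have e1: "T_tr B 1 i j ?u = join (Suc 0) (T_tr B 0 i j (lo (Suc 0) ?u))
     (Df (E 0) (E 0) (X 0 ?N) (T_tr B 0 i j) (lo (Suc 0) ?u) (hi (Suc 0) ?u))"
    by (simp add: T_map_join)
  define a g where "a = T_tr B 0 i j (lo (Suc 0) ?u)"
    and "g = Df (E 0) (E 0) (X 0 ?N) (T_tr B 0 i j) (lo (Suc 0) ?u) (hi (Suc 0) ?u)"
  have e2: "T_tr B 1 i j ?u \<beta> = (if 1 \<in> \<beta> then g (\<beta> - {1}) else a \<beta>)"
    unfolding e1 a_def g_def join_def by simp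
  have g: "g \<gamma> = (if \<gamma> = {} then Dtotal i j (x, w) (v, w') else 0)" for \<gamma>
    using D E_zero[OF DE, of \<gamma>] unfolding g_def by auto
  have a: "a \<gamma> = (if \<gamma> = {} then (base_tr B i j x, fib i j x w) else 0)" for \<gamma>
    unfolding a_def using total_split[OF i j x, of w] e(1) by (simp del: lo_empty)
  consider "\<beta> = {}" | "\<beta> = {1}" | "1 \<in> \<beta>" "\<beta> - {1} \<noteq> {}" | "1 \<notin> \<beta>" "\<beta> \<noteq> {}" by blast
  then show "T_tr B 1 i j ?u \<beta> =
     first_order (base_tr B i j x) (fib i j x w) (fst (Dtotal i j (x, w) (v, w'))) (snd (Dtotal i j (x, w) (v, w'))) \<beta>"
    unfolding e2 g a by cases (auto simp: first_order_def)
qed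

text \<open>The transformation law of the Christoffel tensor: the sum of $x + \varepsilon_0 w$ and
  $x + \varepsilon_1 v + \varepsilon_0\varepsilon_1 w'$ with respect to the connection is computed in both charts.\<close>

lemma christoffel_law:
  assumes b: "is_christoffel B L i b" and b': "is_christoffel B L j b'"
  shows "Dtotal i j (x, w) (v, w' + b x w v) =
    (dbase i j x v, fib i j x w' + b' (base_tr B i j x) (fib i j x w) (dbase i j x v))"
proof -
  let ?y = "base_tr B i j x"
  have y: "?y \<in> chart_range B j" using overlap_base[OF i j j x] x overlap_base[OF i j i x]
    by (metis overlap_subset overlap_self subsetD i x)
  have xr: "x \<in> chart_range B i" using x overlap_subset by blast
  note T = T_tr_cocycle[of 1]
  let ?pi = "glue_pt B (T_tr B 1) i" and ?pj = "glue_pt B (T_tr B 1) j"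
  have b0: "b x 0 v = 0" "b x w 0 = 0" for w v
    using b xr module_hom.zero unfolding is_christoffel_def by blast+
  have b0': "b' ?y 0 v = 0" "b' ?y w 0 = 0" for w v
    using b' y module_hom.zero unfolding is_christoffel_def by blast+
  have add: "fadd L (?pi (shear b u)) (?pi (shear b u')) = ?pi (shear b (chart_add u u'))"
    if "u \<in> X 1 (chart_range B i)" "u' \<in> X 1 (chart_range B i)" "fst (u {}) = fst (u' {})" for u u'
    using b that unfolding is_christoffel_def Let_def by blast
  have add': "fadd L (?pj (shear b' u)) (?pj (shear b' u')) = ?pj (shear b' (chart_add u u'))"
    if "u \<in> X 1 (chart_range B j)" "u' \<in> X 1 (chart_range B j)" "fst (u {}) = fst (u' {})" for u u'
    using b' that unfolding is_christoffel_def Let_def by blast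
  have ch: "?pi (first_order x w v w') = ?pj (T_tr B 1 i j (first_order x w v w'))" for w v w'
    by (rule glue_pt_change_chart[OF T i j first_order_X[OF x], symmetric])
  have D0: "Dtotal i j (x, w) (0, 0) = 0"
    using Df_scl[OF tmod_F tmod_F total_open total_diffable[OF i j], of "(x, w)" 0 0] x
      tmod_scl(6)[OF tmod_V] tmod_scl(6)[OF tmod_W] by (simp add: zero_prod_def)
  have f0: "fib i j x 0 = 0" by (rule module_hom.zero[OF fib_hom[OF i j x]])
  have "?pi (first_order x w v (w' + b x w v)) =
      fadd L (?pi (first_order x w 0 0)) (?pi (first_order x 0 v w'))"
    using add[OF first_order_X[OF xr] first_order_X[OF xr], of w 0 0 0 v w']
    by (simp add: first_order_add first_order_shear b0, simp add: first_order_def)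
  also have "\<dots> = fadd L (?pj (first_order ?y (fib i j x w) 0 0)) (?pj (first_order ?y 0 (dbase i j x v) (fib i j x w')))"
    unfolding ch T_tr_first_order D0 Dtotal_zero_section f0 by simp
  also have "\<dots> = ?pj (first_order ?y (fib i j x w) (dbase i j x v) (fib i j x w' + b' ?y (fib i j x w) (dbase i j x v)))"
    using add'[OF first_order_X[OF y] first_order_X[OF y], of "fib i j x w" 0 0 0 "dbase i j x v" "fib i j x w'"]
    by (simp add: first_order_add first_order_shear b0', simp add: first_order_def)
  finally have "?pj (T_tr B 1 i j (first_order x w v (w' + b x w v))) =
     ?pj (first_order ?y (fib i j x w) (dbase i j x v) (fib i j x w' + b' ?y (fib i j x w) (dbase i j x v)))"
    unfolding ch .
  then have "T_tr B 1 i j (first_order x w v (w' + b x w v)) =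
     first_order ?y (fib i j x w) (dbase i j x v) (fib i j x w' + b' ?y (fib i j x w) (dbase i j x v))"
    by (intro glue_pt_inj[OF T j]) (simp_all only: T_tr_first_order first_order_X[OF y])
  then show ?thesis unfolding T_tr_first_order by (auto dest!: first_order_eqD simp: prod_eq_iff)
qed

end

end

context transition_system
begin

abbreviation "Dtangent i j \<equiv> Df mVV mVV (overlap B i j \<times> UNIV) (tangent_tr i j)"

lemma tlin_eval_V: "tlin (E k) mVV (\<lambda>u. (fst (u {}), fst (u \<beta>)))"
  and tlin_eval_W: "tlin (E k) (mF B) (\<lambda>u. (fst (u {}), snd (u \<beta>)))"
  by (intro tlin_Pair tlin_compose[OF tlin_eval tlin_fst, unfolded comp_def]
      tlin_compose[OF tlin_eval tlin_snd, unfolded comp_def])+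

lemma A_tr_coordinate:
  "x = fst (u {}) \<Longrightarrow> \<beta> \<noteq> {} \<Longrightarrow>
    A_tr B i j u \<beta> = (snd (tangent_tr i j (x, fst (u \<beta>))), snd (total_tr B i j (x, snd (u \<beta>))))"
  by (simp add: A_tr_apply tangent_tr_def fib_def)

lemma A_tr_zero_coordinate:
  "i \<in> charts B \<Longrightarrow> j \<in> charts B \<Longrightarrow> fst (u {}) \<in> overlap B i j \<Longrightarrow> A_tr B i j u {} = total_tr B i j (u {})"
  using total_split[of i j "fst (u {})" "snd (u {})"] by (simp add: A_tr_apply)

lemma A_tr_smooth:
  assumes i: "i \<in> charts B" and j: "j \<in> charts B"
  shows "smooth (E k) (E k) (X k (overlap B i j)) (A_tr B i j)"
proof (rule smooth_multi[OF tmod_F])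
  fix \<beta> :: "nat set" assume "\<beta> \<subseteq> {1..k}"
  let ?U = "X k (overlap B i j)"
  show "smooth (E k) (mF B) ?U (\<lambda>u. A_tr B i j u \<beta>)"
  proof (cases "\<beta> = {}")
    case True
    have "smooth (E k) (mF B) ?U (\<lambda>u. total_tr B i j (u {}))"
      by (rule smooth_compose[OF tmod_E tmod_F X_car smooth_base_coordinate smooth_total[OF i j]])
        (intro image_subsetI, simp add: multi_over_def mem_Times_iff)
    then show ?thesis
      unfolding True by (rule smooth_cong) (simp add: A_tr_zero_coordinate[OF i j] X_iff)
  next
    case False
    note VV = tmod_prod[OF tmod_V tmod_V]
    have 1: "smooth (E k) (mV B) ?U (\<lambda>u. snd (tangent_tr i j (fst (u {}), fst (u \<beta>))))"
      by (rule smooth_compose_linear[OF tmod_E VV X_car smooth_compose[OF tmod_E VV X_car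
              smooth_linear[OF tmod_E tlin_eval_V X_car] tangent_tr_smooth[OF i j]] tlin_snd])
        (intro image_subsetI, simp add: X_iff)
    have 2: "smooth (E k) (mW B) ?U (\<lambda>u. snd (total_tr B i j (fst (u {}), snd (u \<beta>))))"
      by (rule smooth_compose_linear[OF tmod_E tmod_F X_car smooth_compose[OF tmod_E tmod_F X_car
              smooth_linear[OF tmod_E tlin_eval_W X_car] smooth_total[OF i j]] tlin_snd])
        (intro image_subsetI, simp add: X_iff)
    show ?thesis using smooth_Pair[OF 1 2] by (simp add: A_tr_coordinate[OF refl False])
  qed
qed (use A_tr_E[OF i j] E_zero in blast)

lemma A_tr_maps:
  assumes "i \<in> charts B" "j \<in> charts B"
  shows "A_tr B i j ` X k (overlap B i j) \<subseteq> X k (overlap B j i)"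
proof (rule image_subsetI)
  fix u assume u: "u \<in> X k (overlap B i j)"
  then have "fst (u {}) \<in> overlap B i i" using overlap_self overlap_subset unfolding X_iff by blast
  then show "A_tr B i j u \<in> X k (overlap B j i)"
    by (rule cocycle_maps[OF A_tr_cocycle assms assms(1) u])
qed

lemma lo_A_tr:
  assumes i: "i \<in> charts B" and j: "j \<in> charts B" and x: "fst (u {}) \<in> overlap B i j"
  shows "lo (Suc k) (A_tr B i j u) = A_tr B i j (lo (Suc k) u)"
proof
  fix \<beta>
  show "lo (Suc k) (A_tr B i j u) \<beta> = A_tr B i j (lo (Suc k) u) \<beta>"
    using module_hom.zero[OF dbase_hom[OF i j x]] module_hom.zero[OF fib_hom[OF i j x]]
    by (auto simp: A_tr_apply lo_def zero_prod_def)
qed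

text \<open>The coefficients of $A^kF$ are transformed independently of each other by the transition maps of the
tangent bundle and of the given bundle, so its derivative is determined by theirs.\<close>

lemma Df_A_tr:
  assumes i: "i \<in> charts B" and j: "j \<in> charts B" and u: "u \<in> X k (overlap B i j)" and v: "v \<in> car (E k)"
  shows "Df (E k) (E k) (X k (overlap B i j)) (A_tr B i j) u v {} = Dtotal i j (u {}) (v {})"
    and "\<beta> \<noteq> {} \<Longrightarrow> Df (E k) (E k) (X k (overlap B i j)) (A_tr B i j) u v \<beta> =
      (snd (Dtangent i j
         (fst (u {}), fst (u \<beta>)) (fst (v {}), fst (v \<beta>))),
       snd (Dtotal i j (fst (u {}), snd (u \<beta>)) (fst (v {}), snd (v \<beta>))))"
proof -
  let ?N = "overlap B i j"
  let ?U = "X k ?N"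
  note o = open_overlap[OF i j] and VV = tmod_prod[OF tmod_V tmod_V]
  note oF = mod_open_F[OF o]
  have oV: "mod_open mVV (?N \<times> UNIV)" using o by (simp add: mod_open_def open_Times)
  note c = Df_coordinate[OF o A_tr_smooth[OF i j] u v]
  have im: "(\<lambda>u. u {}) ` ?U \<subseteq> ?N \<times> UNIV" by (intro image_subsetI) (simp add: X_iff mem_Times_iff)
  have "Df (E k) (mF B) ?U (\<lambda>u. A_tr B i j u {}) u v = Df (E k) (mF B) ?U (\<lambda>u. total_tr B i j (u {})) u v"
  proof (rule Df_line_cong[OF tmod_E tmod_F mod_open_X[OF o] mod_open_X[OF o] _ _ u u v])
    show "diffable (E k) (mF B) ?U (\<lambda>u. A_tr B i j u {})"
      by (rule smooth_XD[OF smooth_coordinate[OF A_tr_smooth[OF i j]]])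
    show "diffable (E k) (mF B) ?U (\<lambda>u. total_tr B i j (u {}))"
      by (rule diffable_compose[OF tmod_E tmod_F X_car diffable_linear[OF tmod_E tlin_eval X_car] total_diffable[OF i j] im])
  qed (simp add: A_tr_zero_coordinate[OF i j] X_iff del: multi_mod_simps)
  also have "\<dots> = Dtotal i j (u {}) (v {})"
    by (rule Df_precompose_linear[OF tmod_E tmod_F tmod_F mod_open_X[OF o] oF tlin_eval total_diffable[OF i j] im u v])
  finally show "Df (E k) (E k) ?U (A_tr B i j) u v {} = Dtotal i j (u {}) (v {})" unfolding c .
  assume \<beta>: "\<beta> \<noteq> {}"
  let ?lV = "\<lambda>u :: ('v, 'w) multi. (fst (u {}), fst (u \<beta>))" and ?lW = "\<lambda>u :: ('v, 'w) multi. (fst (u {}), snd (u \<beta>))"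
  have imV: "?lV ` ?U \<subseteq> ?N \<times> UNIV" and imW: "?lW ` ?U \<subseteq> ?N \<times> UNIV"
    by (intro image_subsetI, simp add: X_iff)+
  have dV: "diffable (E k) mVV ?U (\<lambda>u. tangent_tr i j (?lV u))"
    by (rule diffable_compose[OF tmod_E VV X_car diffable_linear[OF tmod_E tlin_eval_V X_car] tangent_tr_diffable[OF i j] imV])
  have dW: "diffable (E k) (mF B) ?U (\<lambda>u. total_tr B i j (?lW u))"
    by (rule diffable_compose[OF tmod_E tmod_F X_car diffable_linear[OF tmod_E tlin_eval_W X_car] total_diffable[OF i j] imW])
  note oX = mod_open_X[OF o]
  have sV: "diffable (E k) (mV B) ?U (\<lambda>u. snd (tangent_tr i j (?lV u)))"
    by (rule diffable_compose[OF tmod_E VV X_car dV diffable_linear[OF VV tlin_snd order_refl]]) simp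
  have sW: "diffable (E k) (mW B) ?U (\<lambda>u. snd (total_tr B i j (?lW u)))"
    by (rule diffable_compose[OF tmod_E tmod_F X_car dW diffable_linear[OF tmod_F tlin_snd order_refl]]) simp
  have "Df (E k) (mF B) ?U (\<lambda>u. A_tr B i j u \<beta>) u v =
      (Df (E k) (mV B) ?U (\<lambda>u. snd (tangent_tr i j (?lV u))) u v, Df (E k) (mW B) ?U (\<lambda>u. snd (total_tr B i j (?lW u))) u v)"
    unfolding A_tr_coordinate[OF refl \<beta>]
    by (rule Df_Pair[OF tmod_E tmod_V tmod_W oX sV sW u v])
  also have "Df (E k) (mV B) ?U (\<lambda>u. snd (tangent_tr i j (?lV u))) u v =
      snd (Dtangent i j (?lV u) (?lV v))"
    unfolding Df_compose_linear[OF tmod_E VV tmod_V oX dV tlin_snd u v]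
    by (subst Df_precompose_linear[OF tmod_E VV VV oX oV tlin_eval_V tangent_tr_diffable[OF i j] imV u v]) (rule refl)
  also have "Df (E k) (mW B) ?U (\<lambda>u. snd (total_tr B i j (?lW u))) u v = snd (Dtotal i j (?lW u) (?lW v))"
    unfolding Df_compose_linear[OF tmod_E tmod_F tmod_W oX dW tlin_snd u v]
    by (subst Df_precompose_linear[OF tmod_E tmod_F tmod_F oX oF tlin_eval_W total_diffable[OF i j] imW u v]) (rule refl)
  finally show "Df (E k) (E k) ?U (A_tr B i j) u v \<beta> =
      (snd (Dtangent i j (?lV u) (?lV v)),
       snd (Dtotal i j (?lW u) (?lW v)))" unfolding c .
qed

end

text \<open>Christoffel tensors in all charts, smooth and with the transformation laws of a connection on the bundle
(\<open>b\<close>) and on the tangent bundle of the base (\<open>c\<close>).\<close>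

locale splitting = transition_system B
  for B :: "('k::base_ring, 'v::{topological_ab_group_add, t2_space},
      'w::{topological_ab_group_add, t2_space}, 'm, 'f, 'i) vbundle" +
  fixes b :: "'i \<Rightarrow> 'v \<Rightarrow> 'w \<Rightarrow> 'v \<Rightarrow> 'w" and c :: "'i \<Rightarrow> 'v \<Rightarrow> 'v \<Rightarrow> 'v \<Rightarrow> 'v"
  assumes chart: "i \<in> charts B \<Longrightarrow> christoffel_chart B i (b i) (c i)"
    and b_law: "i \<in> charts B \<Longrightarrow> j \<in> charts B \<Longrightarrow> x \<in> overlap B i j \<Longrightarrow>
      Dtotal i j (x, w) (v, w' + b i x w v) =
        (dbase i j x v, fib i j x w' + b j (base_tr B i j x) (fib i j x w) (dbase i j x v))"
    and c_law: "i \<in> charts B \<Longrightarrow> j \<in> charts B \<Longrightarrow> x \<in> overlap B i j \<Longrightarrow>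
      Dtangent i j (x, y) (v, v' + c i x y v) =
        (dbase i j x v, dbase i j x v' + c j (base_tr B i j x) (dbase i j x y) (dbase i j x v))"
begin

abbreviation "\<phi> i \<equiv> Phi_chart B i (b i) (c i)"

text \<open>Comparing the coefficients of $\varepsilon^\beta\varepsilon_n$ on both sides gives the two transformation
laws: the derivative of the transition map in the corrected direction is the corrected image.\<close>

lemma correct_A_tr:
  assumes i: "i \<in> charts B" and j: "j \<in> charts B" and u: "u \<in> X (Suc k) (overlap B i j)"
  shows "correct (b j) (c j) (Suc k) (A_tr B i j u) =
    T k (overlap B i j) (A_tr B i j) (correct (b i) (c i) (Suc k) u)" (is "?l = ?r")
proof -
  let ?n = "Suc k" and ?v = "correct (b i) (c i) (Suc k) u"
  have x: "fst (u {}) \<in> overlap B i j" using u X_iff by blast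
  note o = open_overlap[OF i j]
  have ui: "u \<in> X ?n (chart_range B i)" by (rule X_chart_range[OF u])
  have v: "?v \<in> X ?n (overlap B i j)"
    using christoffel_chart.correct_X[OF chart[OF i] ui] x unfolding X_iff by simp
  have vE: "?v \<in> car (E ?n)" using v X_iff by blast
  note lh = lo_X[OF v] hi_car[OF vE]
  have Au: "A_tr B i j u \<in> X ?n (chart_range B j)"
    using A_tr_maps[OF i j, of ?n] u X_chart_range by blast
  have lo: "lo ?n ?l = lo ?n ?r"
    unfolding lo_correct lo_T[OF o A_tr_smooth[OF i j] v] lo_A_tr[of i j u, OF i j x] ..
  have "hi ?n ?l = hi ?n ?r"
  proof
    fix \<beta>
    have lE: "hi ?n ?l \<in> car (E k)" and rE: "hi ?n ?r \<in> car (E k)"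
      using hi_car[OF christoffel_chart.correct_E[OF chart[OF j] Au]] hi_car[OF T_car[OF o A_tr_smooth[OF i j] v]]
      by blast+
    show "hi ?n ?l \<beta> = hi ?n ?r \<beta>"
    proof (cases "\<beta> \<subseteq> {1..k}")
      case False
      show ?thesis using E_zero[OF lE False] E_zero[OF rE False] by simp
    next
      case True
      then have n: "?n \<notin> \<beta>" by auto
      have h: "hi ?n ?v \<gamma> = twist (b i) (c i) \<gamma> (fst (u {})) (u \<gamma>) (u (insert ?n \<gamma>)) (fst (u {?n}))"
        if "?n \<notin> \<gamma>" for \<gamma>
        unfolding hi_correct[OF that] using that by (simp add: hi_def)
      have l: "hi ?n ?l \<beta> = twist (b j) (c j) \<beta> (base_tr B i j (fst (u {}))) (A_tr B i j u \<beta>)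
          (A_tr B i j u (insert ?n \<beta>)) (dbase i j (fst (u {})) (fst (u {?n})))"
        unfolding hi_correct[OF n] using n by (simp add: hi_def A_tr_apply)
      have e: "fst (hi ?n ?v {}) = fst (u {?n})" using h[of "{}"] by (simp add: twist_def)
      have lov: "lo ?n ?v \<gamma> = u \<gamma>" if "?n \<notin> \<gamma>" for \<gamma>
        unfolding lo_correct using that by (simp add: lo_def)
      have r: "hi ?n ?r \<beta> = Df (E k) (E k) (X k (overlap B i j)) (A_tr B i j) (lo ?n ?v) (hi ?n ?v) \<beta>"
        unfolding hi_T[OF o A_tr_smooth[OF i j] v] ..
      show ?thesis
      proof (cases "\<beta> = {}")
        case True
        have "hi ?n ?r \<beta> = Dtotal i j (u {}) (fst (u {?n}), snd (u {?n}) + b i (fst (u {})) (snd (u {})) (fst (u {?n})))"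
          unfolding r unfolding True Df_A_tr(1)[OF i j lh] using h[of "{}"] by (simp add: twist_def)
        also have "\<dots> = hi ?n ?l \<beta>"
          using b_law[OF i j x, of "snd (u {})" "fst (u {?n})" "snd (u {?n})"]
          unfolding l unfolding True by (simp add: twist_def A_tr_apply)
        finally show ?thesis ..
      next
        case False
        then show ?thesis
          unfolding r Df_A_tr(2)[OF i j lh False] e l
          using n lov[of "{}"] lov[OF n] h[OF n] b_law[OF i j x] c_law[OF i j x]
          by (simp add: twist_def A_tr_apply)
      qed
    qed
  qed
  with lo have "join ?n (lo ?n ?l) (hi ?n ?l) = join ?n (lo ?n ?r) (hi ?n ?r)" by (rule arg_cong2)
  then show ?thesis unfolding join_lo_hi .
qed

text \<open>By \<open>correct_A_tr\<close> and functoriality of \<open>T\<close>, compatibility is passed on from $\Phi_k$ to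
$\Phi_{k+1} = T\Phi_k \circ K_{k+1}$.\<close>

lemma Phi_change_chart:
  assumes i: "i \<in> charts B" and j: "j \<in> charts B"
  shows "u \<in> X k (overlap B i j) \<Longrightarrow> \<phi> j k (A_tr B i j u) = T_tr B k i j (\<phi> i k u)"
proof (induction k arbitrary: u)
  case 0
  have x: "fst (u {}) \<in> overlap B i j" and uE: "u \<in> car (E 0)" using 0 X_iff by blast+
  have AE: "A_tr B i j u \<in> car (E 0)" by (rule A_tr_E[OF i j 0])
  have "A_tr B i j u \<beta> = T_tr B 0 i j u \<beta>" for \<beta>
    using A_tr_zero_coordinate[of i j u, OF i j x] E_zero[OF AE, of \<beta>] by (cases "\<beta> = {}") auto
  then show ?case by auto
next
  case (Suc k)
  note u = Suc.prems and ci = chart[OF i] and cj = chart[OF j] and o = open_overlap[OF i j]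
  let ?N = "overlap B i j" and ?v = "correct (b i) (c i) (Suc k) u"
  note ui = X_chart_range[OF u]
  have v: "?v \<in> X (Suc k) ?N"
    using christoffel_chart.correct_X[OF ci ui] u unfolding X_iff by simp
  have Au: "A_tr B i j u \<in> X (Suc k) (chart_range B j)"
    using A_tr_maps[OF i j, of "Suc k"] u X_chart_range by blast
  have Am: "A_tr B i j ` X k ?N \<subseteq> X k (chart_range B j)"
    using A_tr_maps[OF i j, of k] X_chart_range by blast
  note \<phi>s = christoffel_chart.Phi_smooth[OF ci, of k]
  have \<phi>N: "smooth (E k) (E k) (X k ?N) (\<phi> i k)"
    by (rule smooth_restrict[OF tmod_E \<phi>s X_mono[OF overlap_subset] X_car])
  have \<phi>m: "\<phi> i k ` X k ?N \<subseteq> X k ?N"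
  proof (rule image_subsetI)
    fix w assume w: "w \<in> X k ?N"
    note wi = X_chart_range[OF w]
    show "\<phi> i k w \<in> X k ?N"
      using christoffel_chart.Phi_X[OF ci wi] christoffel_chart.Phi_base[OF ci wi] w unfolding X_iff by simp
  qed
  have "\<phi> j (Suc k) (A_tr B i j u) = T k (chart_range B j) (\<phi> j k) (T k ?N (A_tr B i j) ?v)"
    unfolding christoffel_chart.Phi_Suc[OF cj Au] correct_A_tr[OF i j u] ..
  also have "\<dots> = T k ?N (\<lambda>u. \<phi> j k (A_tr B i j u)) ?v"
    by (rule T_compose[OF o open_chart_range[OF j] A_tr_smooth[OF i j] christoffel_chart.Phi_smooth[OF cj] Am v, symmetric])
  also have "\<dots> = T k ?N (\<lambda>u. T_tr B k i j (\<phi> i k u)) ?v"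
    by (rule T_cong[OF o o order_refl smooth_compose[OF tmod_E tmod_E X_car \<phi>N T_tr_smooth[OF i j] \<phi>m] Suc.IH v])
  also have "\<dots> = T k ?N (T_tr B k i j) (T k ?N (\<phi> i k) ?v)"
    by (rule T_compose[OF o o \<phi>N T_tr_smooth[OF i j] \<phi>m v])
  also have "T k ?N (\<phi> i k) ?v = T k (chart_range B i) (\<phi> i k) ?v"
    by (rule T_cong[OF o open_chart_range[OF i] overlap_subset \<phi>s refl v])
  also have "\<dots> = \<phi> i (Suc k) u" by (rule christoffel_chart.Phi_Suc[OF ci ui, symmetric])
  finally show ?case by simp
qed

section \<open>The derived connections\<close>

definition Split :: "nat \<Rightarrow> ('v, 'w, 'i) glued \<Rightarrow> ('v, 'w, 'i) glued" where
  "Split k = induced_map B (T_tr B k) (\<lambda>i. \<phi> i k)"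

lemma Split_glue_pt:
  assumes i: "i \<in> charts B" and u: "u \<in> X k (chart_range B i)"
  shows "Split k (glue_pt B (A_tr B) i u) = glue_pt B (T_tr B k) i (\<phi> i k u)"
  unfolding Split_def
proof (rule induced_map_glue_pt[OF A_tr_cocycle T_tr_cocycle _ Phi_change_chart i u])
  fix i u assume i: "i \<in> charts B" and u: "u \<in> X k (chart_range B i)"
  show "\<phi> i k u \<in> car (E k) \<and> fst (\<phi> i k u {}) = fst (u {})"
    using christoffel_chart.Phi_X[OF chart[OF i] u] christoffel_chart.Phi_base[OF chart[OF i] u] X_iff by blast
qed

text \<open>Points with the same image lie over the same base point, and can be compared in one chart, where the splitting map has
a left inverse.\<close>

lemma Split_inj: "inj_on (Split k) (A_bundle B k)"
proof (rule inj_onI)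
  fix z z' assume z: "z \<in> A_bundle B k" "z' \<in> A_bundle B k" "Split k z = Split k z'"
  obtain i u where i: "i \<in> charts B" "u \<in> X k (chart_range B i)" "z = glue_pt B (A_tr B) i u"
    using z(1) unfolding A_bundle_def by (rule glueE)
  obtain j u' where j: "j \<in> charts B" "u' \<in> X k (chart_range B j)" "z' = glue_pt B (A_tr B) j u'"
    using z(2) unfolding A_bundle_def by (rule glueE)
  have eq: "glue_pt B (T_tr B k) i (\<phi> i k u) = glue_pt B (T_tr B k) j (\<phi> j k u')"
    using z(3) unfolding i(3) j(3) Split_glue_pt[OF i(1,2)] Split_glue_pt[OF j(1,2)] .
  note Pu = christoffel_chart.Phi_X[OF chart[OF i(1)] i(2)] and Pu' = christoffel_chart.Phi_X[OF chart[OF j(1)] j(2)]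
  have "(i, \<phi> i k u) \<in> glue_pt B (T_tr B k) j (\<phi> j k u')"
    using glue_pt_self[OF T_tr_cocycle i(1) Pu] eq by simp
  note m = glue_pt_member[OF T_tr_cocycle j(1) Pu' this]
  have ov: "u' \<in> X k (overlap B j i)"
    using m(2) j(2) christoffel_chart.Phi_base[OF chart[OF j(1)] j(2)] unfolding X_iff by simp
  have Au': "A_tr B j i u' \<in> X k (chart_range B i)"
    using A_tr_maps[OF j(1) i(1), of k] ov X_chart_range by blast
  have "\<phi> i k u = \<phi> i k (A_tr B j i u')"
    using m(3) Phi_change_chart[OF j(1) i(1) ov] by simp
  then have "u = A_tr B j i u'"
    using christoffel_chart.inv_Phi[OF chart[OF i(1)] i(2)] christoffel_chart.inv_Phi[OF chart[OF i(1)] Au'] by metis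
  then show "z = z'" unfolding i(3) j(3) using glue_pt_change_chart[OF A_tr_cocycle j(1) i(1) ov] by simp
qed

lemma Split_inverse:
  assumes i: "i \<in> charts B" and u: "u \<in> X k (chart_range B i)"
  shows "inv_into (A_bundle B k) (Split k) (glue_pt B (T_tr B k) i (\<phi> i k u)) = glue_pt B (A_tr B) i u"
  using inv_into_f_f[OF Split_inj, of "glue_pt B (A_tr B) i u" k] glueI[OF i u] Split_glue_pt[OF i u]
  by (simp add: A_bundle_def)

lemma A_fixed_iff:
  "i \<in> charts B \<Longrightarrow> u \<in> X k (chart_range B i) \<Longrightarrow> glue_pt B (A_tr B) i u \<in> A_fixed B k \<longleftrightarrow> symmetric_upto k u"
  unfolding A_fixed_def by (rule fixed_pts_iff[OF A_tr_cocycle]) (rule A_tr_symmetric)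

lemma T_fixed_iff:
  "i \<in> charts B \<Longrightarrow> u \<in> X k (chart_range B i) \<Longrightarrow> glue_pt B (T_tr B k) i u \<in> T_fixed B k \<longleftrightarrow> symmetric_upto k u"
  unfolding T_fixed_def by (rule fixed_pts_iff[OF T_tr_cocycle]) (rule T_tr_symmetric)

lemma Split_fixed_pts: "Split k ` A_fixed B k = T_fixed B k"
proof
  show "Split k ` A_fixed B k \<subseteq> T_fixed B k"
  proof (rule image_subsetI)
    fix z assume z: "z \<in> A_fixed B k"
    then have "z \<in> glue B (A_tr B) k" unfolding A_fixed_def fixed_pts_def by blast
    then obtain i u where i: "i \<in> charts B" "u \<in> X k (chart_range B i)" "z = glue_pt B (A_tr B) i u" by (rule glueE)
    have "symmetric_upto k u" using z A_fixed_iff[OF i(1,2)] unfolding i(3) by blast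
    then have "symmetric_upto k (\<phi> i k u)" by (rule christoffel_chart.Phi_symmetric[OF chart[OF i(1)] i(2)])
    then show "Split k z \<in> T_fixed B k"
      unfolding i(3) Split_glue_pt[OF i(1,2)]
      using T_fixed_iff[OF i(1) christoffel_chart.Phi_X[OF chart[OF i(1)] i(2)]] by blast
  qed
  show "T_fixed B k \<subseteq> Split k ` A_fixed B k"
  proof
    fix z assume z: "z \<in> T_fixed B k"
    then have "z \<in> glue B (T_tr B k) k" unfolding T_fixed_def fixed_pts_def by blast
    then obtain i v where i: "i \<in> charts B" "v \<in> X k (chart_range B i)" "z = glue_pt B (T_tr B k) i v" by (rule glueE)
    note ci = chart[OF i(1)]
    define u where "u = Phi_inv B i (b i) (c i) k v"
    have u: "u \<in> X k (chart_range B i)" unfolding u_def by (rule christoffel_chart.inv_X[OF ci i(2)])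
    have uv: "\<phi> i k u = v" unfolding u_def by (rule christoffel_chart.Phi_inv[OF ci i(2)])
    have "symmetric_upto k v" using z T_fixed_iff[OF i(1,2)] unfolding i(3) by blast
    then have "symmetric_upto k u" unfolding u_def by (rule christoffel_chart.inv_symmetric[OF ci i(2)])
    then have "glue_pt B (A_tr B) i u \<in> A_fixed B k" using A_fixed_iff[OF i(1) u] by blast
    moreover have "z = Split k (glue_pt B (A_tr B) i u)" unfolding i(3) Split_glue_pt[OF i(1) u] uv ..
    ultimately show "z \<in> Split k ` A_fixed B k" by blast
  qed
qed

lemma symmetric_upto_add: "symmetric_upto k q \<Longrightarrow> symmetric_upto k q' \<Longrightarrow> symmetric_upto k (q + q')"
  for q :: "nat set \<Rightarrow> 'a::plus"
  unfolding symmetric_upto_def plus_fun_def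
  by (intro allI impI arg_cong2[of _ _ _ _ "(+)"]) blast+

lemma symmetric_upto_scl: "symmetric_upto k q \<Longrightarrow> symmetric_upto k (scl (E k) t q)"
  unfolding symmetric_upto_def multi_mod_simps
  by (intro allI impI arg_cong[of _ _ "scl (mF B) t"]) blast

lemma symmetric_upto_upd: "symmetric_upto k (u({} := z)) \<longleftrightarrow> symmetric_upto k u"
proof -
  have "(u({} := z)) \<beta> = (u({} := z)) \<beta>' \<longleftrightarrow> u \<beta> = u \<beta>'"
    if b: "\<beta> \<subseteq> {1..k}" "\<beta>' \<subseteq> {1..k}" "card \<beta> = card \<beta>'" for \<beta> \<beta>'
  proof -
    have "finite \<beta>" "finite \<beta>'" using b finite_subset[OF _ finite_atLeastAtMost] by blast+
    then have "(\<beta> = {}) = (\<beta>' = {})" using b(3) card_0_eq[of \<beta>] card_0_eq[of \<beta>'] by simp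
    then show ?thesis by (cases "\<beta> = {}") simp_all
  qed
  then show ?thesis unfolding symmetric_upto_def by blast
qed

lemma chart_add_X:
  assumes "u \<in> X k N" "u' \<in> X k N" shows "chart_add u u' \<in> X k N"
  using assms unfolding X_iff E_iff by (auto simp: chart_add_def)

lemma chart_scl_X:
  assumes "u \<in> X k N" shows "chart_scl B t u \<in> X k N"
proof -
  have "u \<in> car (E k)" using assms X_iff by blast
  then have "chart_scl B t u \<in> car (E k)"
    using scl_F_zero[of t] by (intro EI) (auto simp: chart_scl_def zero_prod_def)
  then show ?thesis using assms unfolding X_iff by (simp add: chart_scl_def)
qed

lemma A_linear_add:
  assumes i: "i \<in> charts B" and u: "u \<in> X k (chart_range B i)" "u' \<in> X k (chart_range B i)" "fst (u {}) = fst (u' {})"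
  shows "fadd (A_linear B) (glue_pt B (A_tr B) i u) (glue_pt B (A_tr B) i u') = glue_pt B (A_tr B) i (chart_add u u')"
proof -
  have "glue_pt B (A_tr B) l (chart_add v v') = glue_pt B (A_tr B) i (chart_add u u')"
    if m: "(l, v) \<in> glue_pt B (A_tr B) i u" "(l, v') \<in> glue_pt B (A_tr B) i u'" for l v v'
  proof -
    note d = glue_pt_member[OF A_tr_cocycle i u(1) m(1)] and d' = glue_pt_member[OF A_tr_cocycle i u(2) m(2)]
    have x: "fst (u {}) \<in> overlap B i l" using d(2) X_iff by blast
    have "chart_add v v' = A_tr B i l (chart_add u u')"
      unfolding d(3) d'(3) by (rule A_tr_chart_add[of i l u u', OF i d(1) x u(3), symmetric])
    moreover have "chart_add u u' \<in> X k (overlap B i l)" by (rule chart_add_X[OF d(2) d'(2)])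
    ultimately show ?thesis using glue_pt_change_chart[OF A_tr_cocycle i d(1)] by simp
  qed
  moreover have "(i, u) \<in> glue_pt B (A_tr B) i u" "(i, u') \<in> glue_pt B (A_tr B) i u'"
    using glue_pt_self[OF A_tr_cocycle i] u by blast+
  ultimately show ?thesis unfolding A_linear_def fiber_linear.simps using u(3) by blast
qed

lemma A_linear_scl:
  assumes i: "i \<in> charts B" and u: "u \<in> X k (chart_range B i)"
  shows "fscl (A_linear B) t (glue_pt B (A_tr B) i u) = glue_pt B (A_tr B) i (chart_scl B t u)"
  unfolding A_linear_def fiber_linear.simps
proof (rule induced_map_glue_pt[OF A_tr_cocycle A_tr_cocycle _ _ i u])
  show "chart_scl B t u \<in> car (E k) \<and> fst (chart_scl B t u {}) = fst (u {})"
    if "i \<in> charts B" "u \<in> X k (chart_range B i)" for i u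
    using chart_scl_X[OF that(2)] unfolding X_iff by (simp add: chart_scl_def)
  show "chart_scl B t (A_tr B i j u) = A_tr B i j (chart_scl B t u)"
    if "i \<in> charts B" "j \<in> charts B" "u \<in> X k (overlap B i j)" for i j u
    using A_tr_chart_scl[OF that(1,2)] that(3) X_iff by metis
qed

definition derived :: "nat \<Rightarrow> ('k, ('v, 'w, 'i) glued) fiber_linear" where
  "derived k = \<lparr>fadd = (\<lambda>z z'. Split k (fadd (A_linear B) (inv_into (A_bundle B k) (Split k) z) (inv_into (A_bundle B k) (Split k) z'))),
     fscl = (\<lambda>t z. Split k (fscl (A_linear B) t (inv_into (A_bundle B k) (Split k) z)))\<rparr>"

text \<open>Over each chart the splitting map itself is the trivialization: the derived structure is the push-forward of
the linear structure of $A^kF$, and it takes symmetric families to symmetric ones and only these.\<close>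

lemma derived_linear_subbundle:
  assumes cover: "\<And>p. p \<in> topspace (base B) \<Longrightarrow> \<exists>i\<in>charts B. p \<in> dom B i"
  shows "linear_subbundle B k (derived k) (T_fixed B k)"
  unfolding linear_subbundle_def
proof (intro conjI ballI)
  show "T_fixed B k \<subseteq> T_bundle B k" unfolding T_fixed_def T_bundle_def fixed_pts_def by blast
  fix p assume "p \<in> topspace (base B)"
  then obtain i where i: "i \<in> charts B" and p: "p \<in> dom B i" using cover by blast
  note ci = chart[OF i]
  let ?N = "chart_range B i" and ?\<psi> = "\<phi> i k" and ?\<psi>' = "Phi_inv B i (b i) (c i) k"
  let ?Q = "{q \<in> X k {0}. symmetric_upto k q}"
  let ?X = "X k ?N"
  let ?pt = "\<lambda>u. glue_pt B (T_tr B k) i (?\<psi> u)"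
  have add: "fadd (derived k) (?pt u) (?pt u') = ?pt (chart_add u u')"
    if "u \<in> ?X" "u' \<in> ?X" "fst (u {}) = fst (u' {})" for u u'
    unfolding derived_def fiber_linear.simps Split_inverse[OF i that(1)] Split_inverse[OF i that(2)] A_linear_add[OF i that]
    by (rule Split_glue_pt[OF i chart_add_X[OF that(1,2)]])
  have scl: "fscl (derived k) t (?pt u) = ?pt (chart_scl B t u)" if "u \<in> ?X" for t u
    unfolding derived_def fiber_linear.simps Split_inverse[OF i that] A_linear_scl[OF i that]
    by (rule Split_glue_pt[OF i chart_scl_X[OF that]])
  have fixed: "?pt u \<in> T_fixed B k \<longleftrightarrow> u({} := (0, snd (u {}))) \<in> ?Q" if u: "u \<in> ?X" for u
  proof -
    have "?pt u \<in> T_fixed B k \<longleftrightarrow> symmetric_upto k u"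
      unfolding T_fixed_iff[OF i christoffel_chart.Phi_X[OF ci u]]
      by (rule christoffel_chart.Phi_symmetric_iff[OF ci u])
    moreover have "symmetric_upto k (u({} := (0, snd (u {})))) \<longleftrightarrow> symmetric_upto k u"
      by (rule symmetric_upto_upd)
    moreover have "u({} := (0, snd (u {}))) \<in> X k {0}"
      using u unfolding X_iff E_iff by auto
    ultimately show ?thesis by blast
  qed
  have Q: "0 \<in> ?Q" "\<And>q q'. q \<in> ?Q \<Longrightarrow> q' \<in> ?Q \<Longrightarrow> q + q' \<in> ?Q" "\<And>t q. q \<in> ?Q \<Longrightarrow> scl (E k) t q \<in> ?Q"
  proof -
    show "0 \<in> ?Q" by (simp add: X_iff symmetric_upto_def)
    show "q + q' \<in> ?Q" if "q \<in> ?Q" "q' \<in> ?Q" for q q'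
    proof -
      have "symmetric_upto k (q + q')" using that symmetric_upto_add by blast
      then show ?thesis using that tmod_car(2)[OF tmod_E] unfolding X_iff by simp
    qed
    show "scl (E k) t q \<in> ?Q" if "q \<in> ?Q" for t q
    proof -
      have "symmetric_upto k (scl (E k) t q)" using that symmetric_upto_scl by blast
      moreover have "scl (E k) t q \<in> car (E k)" using that tmod_car(3)[OF tmod_E] X_iff by blast
      moreover have "fst (scl (E k) t q {}) = 0" using that tmod_scl(7)[OF tmod_V] by (simp add: X_iff)
      ultimately show ?thesis unfolding X_iff by blast
    qed
  qed
  show "\<exists>i\<in>charts B. p \<in> dom B i \<and>
       (\<exists>N \<psi> \<psi>' Q. open N \<and> chart B i p \<in> N \<and> N \<subseteq> chart_range B i \<and>
         (let E = multi_mod B k; X = multi_over B k N; pt = (\<lambda>u. glue_pt B (T_tr B k) i (\<psi> u))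
          in smooth E E X \<psi> \<and> smooth E E X \<psi>' \<and>
             (\<forall>u\<in>X. \<psi>' (\<psi> u) = u \<and> \<psi> (\<psi>' u) = u \<and> fst (\<psi> u {}) = fst (u {}) \<and> fst (\<psi>' u {}) = fst (u {})) \<and>
             (\<forall>u\<in>X. \<forall>u'\<in>X. fst (u {}) = fst (u' {}) \<longrightarrow> fadd (derived k) (pt u) (pt u') = pt (chart_add u u')) \<and>
             (\<forall>t. \<forall>u\<in>X. fscl (derived k) t (pt u) = pt (chart_scl B t u)) \<and>
             Q \<subseteq> multi_over B k {0} \<and> 0 \<in> Q \<and> (\<forall>q\<in>Q. \<forall>q'\<in>Q. q + q' \<in> Q) \<and> (\<forall>t. \<forall>q\<in>Q. scl E t q \<in> Q) \<and>
             (\<forall>u\<in>X. pt u \<in> T_fixed B k \<longleftrightarrow> u({} := (0, snd (u {}))) \<in> Q)))"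
    unfolding Let_def
  proof (rule bexI[OF _ i], rule conjI[OF p], rule exI[of _ ?N], rule exI[of _ ?\<psi>], rule exI[of _ ?\<psi>'],
      rule exI[of _ ?Q], intro conjI)
    show "open ?N" by (rule open_chart_range[OF i])
    show "chart B i p \<in> ?N" using p by (simp add: chart_range_def)
    show "?N \<subseteq> ?N" ..
    show "smooth (E k) (E k) ?X ?\<psi>" by (rule christoffel_chart.Phi_smooth[OF ci])
    show "smooth (E k) (E k) ?X ?\<psi>'" by (rule christoffel_chart.inv_smooth[OF ci])
    show "\<forall>u\<in>?X. ?\<psi>' (?\<psi> u) = u \<and> ?\<psi> (?\<psi>' u) = u \<and> fst (?\<psi> u {}) = fst (u {}) \<and> fst (?\<psi>' u {}) = fst (u {})"
      by (intro ballI conjI christoffel_chart.inv_Phi[OF ci] christoffel_chart.Phi_inv[OF ci]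
          christoffel_chart.Phi_base[OF ci] christoffel_chart.inv_base[OF ci])
    show "\<forall>u\<in>?X. \<forall>u'\<in>?X. fst (u {}) = fst (u' {}) \<longrightarrow> fadd (derived k) (?pt u) (?pt u') = ?pt (chart_add u u')"
      by (intro ballI impI add)
    show "\<forall>t. \<forall>u\<in>?X. fscl (derived k) t (?pt u) = ?pt (chart_scl B t u)" by (intro allI ballI scl)
    show "?Q \<subseteq> X k {0}" by blast
    show "0 \<in> ?Q" by (rule Q(1))
    show "\<forall>q\<in>?Q. \<forall>q'\<in>?Q. q + q' \<in> ?Q" by (intro ballI Q(2))
    show "\<forall>t. \<forall>q\<in>?Q. scl (E k) t q \<in> ?Q" by (intro allI ballI Q(3))
    show "\<forall>u\<in>?X. ?pt u \<in> T_fixed B k \<longleftrightarrow> u({} := (0, snd (u {}))) \<in> ?Q" by (intro ballI fixed)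
  qed
qed

end

theorem theorem19p2:
  fixes F :: "('k::base_ring, 'v::{topological_ab_group_add, t2_space},
               'w::{topological_ab_group_add, t2_space}, 'm, 'f, 'i) vbundle"
    and L :: "('k, ('v, 'w, 'i) glued) fiber_linear"
    and L' :: "('k, ('v, 'v, 'i) glued) fiber_linear"
    and k :: nat
  assumes "vector_bundle F"
    and "linear_connection F L"
    and "linear_connection (tangent_bundle F) L'"
    and "k \<ge> 1"
  shows "weakly_symmetric F L L' k \<and>
         Phi F L L' k ` A_fixed F k = T_fixed F k \<and> T_fixed F k = jet_bundle F k"
proof -
  note F = assms(1)
  interpret ts: transition_system F by (rule vector_bundle_transition_system[OF F])
  interpret tt: transition_system "tangent_bundle F" by (rule tangent_transition_system[OF F])
  note TM = TM_simps[OF F]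
  let ?b = "christoffel F L" and ?c = "christoffel (tangent_bundle F) L'"
  have b: "is_christoffel F L i (?b i)" if "i \<in> charts F" for i
    using assms(2) that unfolding linear_connection_def christoffel_def by (metis someI_ex)
  have c: "is_christoffel (tangent_bundle F) L' i (?c i)" if "i \<in> charts F" for i
    using assms(3) that unfolding linear_connection_def christoffel_def TM by (metis someI_ex)
  have dbase: "tt.dbase = ts.dbase" unfolding tt.dbase_def ts.dbase_def TM fun_eq_iff by blast
  interpret sp: splitting F ?b ?c
  proof (intro splitting.intro splitting_axioms.intro ts.transition_system_axioms)
    fix i j x w v w' y v' assume i: "i \<in> charts F"
    show "christoffel_chart F i (?b i) (?c i)"
    proof (intro christoffel_chart.intro christoffel_chart_axioms.intro ts.typical_fiber_axioms ts.open_chart_range i)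
      show "?b i x 0 v = 0" "?c i x 0 v = 0" if "x \<in> chart_range F i" for x v
        using b[OF i] c[OF i] that module_hom.zero unfolding is_christoffel_def TM by blast+
    qed (use b[OF i] c[OF i] in \<open>simp_all add: is_christoffel_def TM\<close>)
    assume j: "j \<in> charts F" and x: "x \<in> overlap F i j"
    show "ts.Dtotal i j (x, w) (v, w' + ?b i x w v) =
        (ts.dbase i j x v, ts.fib i j x w' + ?b j (base_tr F i j x) (ts.fib i j x w) (ts.dbase i j x v))"
      by (rule ts.christoffel_law[OF i j x b[OF i] b[OF j]])
    have fib: "tt.fib i j x v = ts.dbase i j x v" for v
      unfolding tt.fib_def total_tr_TM[OF F i j x] by simp
    have oV: "mod_open (prod_mod (mV F) (mV F)) (overlap F i j \<times> UNIV)"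
      using ts.open_overlap[OF i j] by (simp add: mod_open_def open_Times)
    note VV = tmod_prod[OF ts.tmod_V ts.tmod_V]
    have "ts.Dtangent i j
        (x, y) (v, v' + ?c i x y v) = tt.Dtotal i j (x, y) (v, v' + ?c i x y v)"
      unfolding TM
      by (rule Df_line_cong[OF VV VV oV oV ts.tangent_tr_diffable[OF i j]
            tt.total_diffable[unfolded TM, OF i j]])
        (use x total_tr_TM[OF F i j] in \<open>auto simp: ts.tangent_tr_def\<close>)
    also have "\<dots> = (ts.dbase i j x v, ts.dbase i j x v' + ?c j (base_tr F i j x) (ts.dbase i j x y) (ts.dbase i j x v))"
      unfolding TM using tt.christoffel_law[unfolded TM, OF i j x c[OF i] c[OF j], of y v v'] unfolding dbase fib .
    finally show "ts.Dtangent i j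
        (x, y) (v, v' + ?c i x y v) =
        (ts.dbase i j x v, ts.dbase i j x v' + ?c j (base_tr F i j x) (ts.dbase i j x y) (ts.dbase i j x v))" .
  qed
  have Phi: "Phi F L L' k = sp.Split k"
    unfolding Phi_def sp.Split_def ..
  have "derived_connection F L L' k = sp.derived k"
    unfolding derived_connection_def Phi sp.derived_def Let_def ..
  moreover have "\<exists>i\<in>charts F. p \<in> dom F i" if "p \<in> topspace (base F)" for p
    using F that unfolding vector_bundle_def by blast
  ultimately have "weakly_symmetric F L L' k"
    unfolding weakly_symmetric_def jet_bundle_def using sp.derived_linear_subbundle by simp
  then show ?thesis
    using sp.Split_fixed_pts Phi by (simp add: jet_bundle_def)
qed

end
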